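(* There exist universal constants $c,C>0$ such that the following holds. For any integer $n\ge 1$, letting $m=2^{\lfloor n/2\rfloor}$, there exist $2n+2$ points in $\mathsf{S}_1^m$ such that, for any integer $d\geq 1$, if these points admit an embedding into $\mathsf{S}_1^d$ with distortion $1+\delta$ where $\delta = C n^{-c}$, then $d\ge 2^{\lfloor n/2\rfloor-1}$.
   Context: For an integer $m\ge1$, $\mathsf{S}_1^m$ denotes the space of linear operators on $\mathbb{C}^m$ (i.e. complex $m\times m$ matrices) equipped with the Schatten-1 (nuclear) norm $\|A\|_{\mathsf{S}_1}=\sum_i\sigma_i(A)$, where $\sigma_i(A)$ are the singular values of $A$. Points $A_1,\dots,A_N\in\mathsf{S}_1^m$ embed into $\mathsf{S}_1^d$ with distortion $1+\delta$ if there exist $A'_1,\dots,A'_N\in\mathsf{S}_1^d$ such that $\|A'_i-A'_j\|_{\mathsf{S}_1}\le\|A_i-A_j\|_{\mathsf{S}_1}\le(1+\delta)\|A'_i-A'_j\|_{\mathsf{S}_1}$ for all $i,j\in\{1,\dots,N\}$. *)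

theory Defs
  imports Complex_Main "HOL-Computational_Algebra.Polynomial"
    "Jordan_Normal_Form.Schur_Decomposition"
begin

text \<open>The singular values of \<open>A\<close> are the square roots of the eigenvalues of \<open>A\<^sup>* A\<close>, listed with
  multiplicity. These eigenvalues are real and nonnegative, so taking \<open>Re\<close> loses nothing.\<close>

definition singular_values :: "complex mat \<Rightarrow> real multiset" where
  "singular_values A = image_mset (\<lambda>z. sqrt (Re z)) (proots (char_poly (mat_adjoint A * A)))"

definition schatten1_norm :: "complex mat \<Rightarrow> real" where
  "schatten1_norm A = sum_mset (singular_values A)"

definition embeds_S1 :: "nat \<Rightarrow> (nat \<Rightarrow> complex mat) \<Rightarrow> nat \<Rightarrow> real \<Rightarrow> bool" where
  "embeds_S1 N A d D \<longleftrightarrow>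
     (\<exists>A'. (\<forall>i\<in>{1..N}. A' i \<in> carrier_mat d d) \<and>
       (\<forall>i\<in>{1..N}. \<forall>j\<in>{1..N}.
          schatten1_norm (A' i - A' j) \<le> schatten1_norm (A i - A j) \<and>
          schatten1_norm (A i - A j) \<le> D * schatten1_norm (A' i - A' j)))"

end

theory Submission
  imports Defs "HOL-Analysis.Inner_Product" "HOL-Analysis.Convex"
begin

text \<open>
  Take the points \<open>\<plusminus>1\<close> and \<open>\<plusminus>G i\<close> for anticommuting Hermitian unitaries \<open>G i\<close>, and normalize the norm so that
  \<open>1\<close> has norm \<open>1\<close>. Let \<open>X\<^sub>0\<^sup>\<plusminus>\<close>, \<open>X\<^sub>i\<^sup>\<plusminus>\<close> be their images and \<open>2\<rho> = X\<^sub>0\<^sup>+ - X\<^sub>0\<^sup>-\<close>. The distances to \<open>\<plusminus>1\<close> are tight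
  for the triangle inequality; expressed through dual contractions, this forces \<open>\<rho>\<close> to be almost
  positive (after a rotation) and yields Hermitian contractions \<open>V i\<close> that almost commute with \<open>\<rho>\<close>, with
  \<open>V i * V i * \<rho> \<approx> \<rho>\<close> and \<open>X\<^sub>i\<^sup>+ - X\<^sub>0\<^sup>- \<approx> \<rho> + V i * \<rho>\<close>. The parallelogram identity
  \<open>(V i + V j)\<^sup>2 + (V i - V j)\<^sup>2 = 2 (V i)\<^sup>2 + 2 (V j)\<^sup>2\<close> together with the distances \<open>\<surd>2\<close> between \<open>\<plusminus>G i\<close> and
  \<open>\<plusminus>G j\<close> then forces \<open>(V i * V j + V j * V i) * \<rho> \<approx> 0\<close>.

  Hence the monomials \<open>f(g)\<close> in the \<open>V i\<close>, indexed by subsets \<open>g\<close>, multiply like Clifford monomials when applied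
  to \<open>\<rho>\<close>, up to a polynomial error, and the average over \<open>g, h\<close> of
  \<open>\<plusminus>tr (f(h)\<^sup>* f(g)\<^sup>* f(g \<triangle> h) \<rho>)\<close> is close to \<open>1\<close>. On the other hand the matrix entries of the average over
  \<open>g\<close> are twisted convolutions, which by Plancherel for the \<open>m\<close>-dimensional Clifford representation have
  operator norm \<open>1/\<surd>m\<close> in the normalized \<open>L\<^sup>2\<close> sense; summing over the \<open>d\<close> rows bounds the average by \<open>\<surd>(d/m)\<close>.
\<close>

section \<open>Finitely supported matrices as an inner product space\<close>

text \<open>Three square roots are lost on the way: a defect of order t^8 in the distances becomes
  t^4 when the points are made Hermitian, t^2 when the observables \<open>V i\<close> are extracted,
  and t in the anticommutators, each time through near-equality in Cauchy-Schwarz. Sorting words of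
  at most N letters costs order N^3 t, so t has order n^(-3); this is the origin of the exponent 24
  = 8 * 3. The obstacle is that every relation holds only next to \<open>\<rho>\<close> and only in
  trace norm. Where \<open>\<rho>\<close> is small, the relations say little about
  \<open>V i\<close>, so no exact representation is ever built from the \<open>V i\<close>. Instead,
  words are applied to \<open>\<rho>\<close>: contractions on either side do not increase the trace
  norm, and a word can be carried across \<open>\<rho>\<close> because each letter almost commutes
  with it. The dimension enters through one gain. Cauchy-Schwarz alone bounds a convolution over the
  m^2 subsets with a factor m^2; since all m^2 monomials fit into matrices of size m, the factor
  drops to m, and \<open>d\<close> has to make up for the difference.\<close>

text \<open>
  One type for the matrices of all sizes. It has no unit: on the matrices supported in the upper left \<open>d \<times> d\<close>
  corner, \<open>fdiag d (\<lambda>_. 1)\<close> below takes that role. The norm of the type is the Hilbert-Schmidt norm.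
\<close>

typedef fmat = "{f :: nat \<Rightarrow> nat \<Rightarrow> complex. \<exists>d. \<forall>i j. d \<le> i \<or> d \<le> j \<longrightarrow> f i j = 0}"
  morphisms entry Abs_fmat
  by (rule exI[of _ "\<lambda>i j. 0"]) auto

setup_lifting type_definition_fmat

lift_definition supported :: "nat \<Rightarrow> fmat \<Rightarrow> bool"
  is "\<lambda>d f. \<forall>i j. d \<le> i \<or> d \<le> j \<longrightarrow> f i j = 0" .

lemma supportedD: "supported d A \<Longrightarrow> d \<le> i \<or> d \<le> j \<Longrightarrow> entry A i j = 0"
  by transfer auto

lemma supportedI: "(\<And>i j. d \<le> i \<or> d \<le> j \<Longrightarrow> entry A i j = 0) \<Longrightarrow> supported d A"
  by transfer auto

lemma supported_ex: "\<exists>d. supported d A"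
  by transfer auto

lemma supported_mono: "supported d A \<Longrightarrow> d \<le> e \<Longrightarrow> supported e A"
  by transfer (meson order_trans)

lemma supported_ex2: "\<exists>d. supported d A \<and> supported d B"
proof -
  obtain d e where "supported d A" "supported e B" using supported_ex by blast
  then show ?thesis by (intro exI[of _ "max d e"]) (auto elim: supported_mono)
qed

lemma supported_ex3: "\<exists>d. supported d A \<and> supported d B \<and> supported d C"
proof -
  obtain d e where "supported d A \<and> supported d B" "supported e C" using supported_ex supported_ex2 by blast
  then show ?thesis by (intro exI[of _ "max d e"]) (auto elim: supported_mono)
qed

lemma fmat_eqI: "(\<And>i j. entry A i j = entry B i j) \<Longrightarrow> A = B"
  by transfer auto

instantiation fmat :: ab_group_add
begin
lift_definition zero_fmat :: fmat is "\<lambda>i j. 0" by auto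
lift_definition plus_fmat :: "fmat \<Rightarrow> fmat \<Rightarrow> fmat" is "\<lambda>f g i j. f i j + g i j"
proof -
  fix f g :: "nat \<Rightarrow> nat \<Rightarrow> complex"
  assume "\<exists>d. \<forall>i j. d \<le> i \<or> d \<le> j \<longrightarrow> f i j = 0" "\<exists>d. \<forall>i j. d \<le> i \<or> d \<le> j \<longrightarrow> g i j = 0"
  then obtain d e where "\<forall>i j. d \<le> i \<or> d \<le> j \<longrightarrow> f i j = 0" "\<forall>i j. e \<le> i \<or> e \<le> j \<longrightarrow> g i j = 0"
    by blast
  then show "\<exists>d. \<forall>i j. d \<le> i \<or> d \<le> j \<longrightarrow> f i j + g i j = 0"
    by (intro exI[of _ "max d e"]) auto
qed
lift_definition uminus_fmat :: "fmat \<Rightarrow> fmat" is "\<lambda>f i j. - f i j" by auto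
definition minus_fmat :: "fmat \<Rightarrow> fmat \<Rightarrow> fmat" where "minus_fmat A B = A + - B"
instance
  by standard (unfold minus_fmat_def, (transfer, auto simp: fun_eq_iff)+)
end

lemma entry_zero [simp]: "entry 0 i j = 0"
  by transfer auto
lemma entry_plus [simp]: "entry (A + B) i j = entry A i j + entry B i j"
  by transfer auto
lemma entry_uminus [simp]: "entry (- A) i j = - entry A i j"
  by transfer auto
lemma entry_minus [simp]: "entry (A - B) i j = entry A i j - entry B i j"
  unfolding minus_fmat_def entry_plus entry_uminus by simp

lift_definition cscale :: "complex \<Rightarrow> fmat \<Rightarrow> fmat" is "\<lambda>c f i j. c * f i j" by auto

lift_definition adj :: "fmat \<Rightarrow> fmat" is "\<lambda>f i j. cnj (f j i)" by auto

lemma entry_cscale [simp]: "entry (cscale c A) i j = c * entry A i j"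
  by transfer auto
lemma entry_adj [simp]: "entry (adj A) i j = cnj (entry A j i)"
  by transfer auto

instantiation fmat :: times
begin
text \<open>A bound on the support is not part of the data of \<open>f\<close>, so the sum runs over
  the nonzero entries of row \<open>i\<close>, a finite set; \<open>entry_times\<close> returns to
  the usual range.\<close>

lift_definition times_fmat :: "fmat \<Rightarrow> fmat \<Rightarrow> fmat"
  is "\<lambda>f g i k. \<Sum>j | f i j \<noteq> 0. f i j * g j k"
proof -
  fix f g :: "nat \<Rightarrow> nat \<Rightarrow> complex"
  assume "\<exists>d. \<forall>i j. d \<le> i \<or> d \<le> j \<longrightarrow> f i j = 0" "\<exists>d. \<forall>i j. d \<le> i \<or> d \<le> j \<longrightarrow> g i j = 0"
  then obtain d e where "\<forall>i j. d \<le> i \<or> d \<le> j \<longrightarrow> f i j = 0" "\<forall>i j. e \<le> i \<or> e \<le> j \<longrightarrow> g i j = 0"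
    by blast
  then show "\<exists>d. \<forall>i k. d \<le> i \<or> d \<le> k \<longrightarrow> (\<Sum>j | f i j \<noteq> 0. f i j * g j k) = 0"
    by (intro exI[of _ "max d e"]) auto
qed
instance ..
end

lemma entry_times: "supported d A \<Longrightarrow> entry (A * B) i k = (\<Sum>j<d. entry A i j * entry B j k)"
proof transfer
  fix d i k :: nat and f g :: "nat \<Rightarrow> nat \<Rightarrow> complex"
  assume f: "\<forall>i j. d \<le> i \<or> d \<le> j \<longrightarrow> f i j = (0::complex)"
  have "{j. f i j \<noteq> 0} \<subseteq> {..<d}" using f not_le by blast
  then show "(\<Sum>j | f i j \<noteq> 0. f i j * g j k) = (\<Sum>j<d. f i j * g j k)"
    by (intro sum.mono_neutral_left) auto
qed

definition tr :: "fmat \<Rightarrow> complex" where "tr A = (\<Sum>i | entry A i i \<noteq> 0. entry A i i)"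

lemma tr_eq: "supported d A \<Longrightarrow> tr A = (\<Sum>i<d. entry A i i)"
proof -
  assume A: "supported d A"
  have "{i. entry A i i \<noteq> 0} \<subseteq> {..<d}" using supportedD[OF A] not_le by blast
  then show ?thesis unfolding tr_def
    by (intro sum.mono_neutral_left) auto
qed

lemma supported_simps [intro, simp]:
  "supported d 0"
  "supported d A \<Longrightarrow> supported d B \<Longrightarrow> supported d (A + B)"
  "supported d A \<Longrightarrow> supported d B \<Longrightarrow> supported d (A - B)"
  "supported d A \<Longrightarrow> supported d (- A)"
  "supported d A \<Longrightarrow> supported d (cscale c A)"
  by (rule supportedI; simp add: supportedD)+

lemma supported_adj [intro, simp]: "supported d A \<Longrightarrow> supported d (adj A)"
  by (rule supportedI) (simp add: supportedD disj_commute)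

lemma supported_times [intro, simp]:
  "supported d A \<Longrightarrow> supported d B \<Longrightarrow> supported d (A * B)"
proof -
  assume A: "supported d A" and B: "supported d B"
  have "entry (A * B) i k = 0" if "d \<le> i \<or> d \<le> k" for i k
    using that supportedD[OF A] supportedD[OF B]
    by (subst entry_times[OF A]) (intro sum.neutral, auto)
  then show ?thesis by (rule supportedI)
qed

instance fmat :: ring
proof
  fix A B C :: fmat
  obtain d where d: "supported d A" "supported d B" "supported d C" using supported_ex3 by blast
  show "A * B * C = A * (B * C)"
  proof (rule fmat_eqI)
    fix i l
    have "entry (A * B * C) i l = (\<Sum>k<d. \<Sum>j<d. entry A i j * entry B j k * entry C k l)"
      using d by (simp add: entry_times[of d] sum_distrib_right)
    also have "\<dots> = (\<Sum>j<d. \<Sum>k<d. entry A i j * entry B j k * entry C k l)"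
      by (rule sum.swap)
    also have "\<dots> = entry (A * (B * C)) i l"
      using d by (simp add: entry_times[of d] sum_distrib_left mult.assoc)
    finally show "entry (A * B * C) i l = entry (A * (B * C)) i l" .
  qed
  show "(A + B) * C = A * C + B * C"
    by (rule fmat_eqI) (use d in \<open>simp add: entry_times[of d] algebra_simps sum.distrib\<close>)
  show "A * (B + C) = A * B + A * C"
    by (rule fmat_eqI) (use d in \<open>simp add: entry_times[of d] algebra_simps sum.distrib\<close>)
qed

lemma adj_adj [simp]: "adj (adj A) = A"
  by (rule fmat_eqI) simp
lemma adj_plus [simp]: "adj (A + B) = adj A + adj B"
  by (rule fmat_eqI) simp
lemma adj_minus [simp]: "adj (A - B) = adj A - adj B"
  by (rule fmat_eqI) simp
lemma adj_zero [simp]: "adj 0 = 0"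
  by (rule fmat_eqI) simp
lemma adj_cscale [simp]: "adj (cscale c A) = cscale (cnj c) (adj A)"
  by (rule fmat_eqI) simp
lemma adj_times [simp]: "adj (A * B) = adj B * adj A"
proof (rule fmat_eqI)
  fix i j
  obtain d where d: "supported d A" "supported d B" using supported_ex2 by blast
  show "entry (adj (A * B)) i j = entry (adj B * adj A) i j"
    using d by (simp add: entry_times[of d] mult.commute)
qed

lemma cscale_add_right: "cscale c (A + B) = cscale c A + cscale c B"
  by (rule fmat_eqI) (simp add: algebra_simps)
lemma cscale_add_left: "cscale (c + e) A = cscale c A + cscale e A"
  by (rule fmat_eqI) (simp add: algebra_simps)
lemma cscale_cscale [simp]: "cscale c (cscale e A) = cscale (c * e) A"
  by (rule fmat_eqI) (simp add: algebra_simps)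
lemma cscale_one [simp]: "cscale 1 A = A"
  by (rule fmat_eqI) simp
lemma cscale_times_left [simp]: "cscale c A * B = cscale c (A * B)"
proof (rule fmat_eqI)
  fix i j
  obtain d where d: "supported d A" "supported d B" using supported_ex2 by blast
  show "entry (cscale c A * B) i j = entry (cscale c (A * B)) i j"
    using d by (simp add: entry_times[of d] sum_distrib_left mult.assoc)
qed
lemma cscale_times_right [simp]: "A * cscale c B = cscale c (A * B)"
proof (rule fmat_eqI)
  fix i j
  obtain d where d: "supported d A" "supported d B" using supported_ex2 by blast
  show "entry (A * cscale c B) i j = entry (cscale c (A * B)) i j"
    using d by (simp add: entry_times[of d] sum_distrib_left algebra_simps)
qed

lemma tr_zero [simp]: "tr 0 = 0"
  by (simp add: tr_def)
lemma tr_plus [simp]: "tr (A + B) = tr A + tr B"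
proof -
  obtain d where d: "supported d A" "supported d B" using supported_ex2 by blast
  then show ?thesis by (simp add: tr_eq[of d] sum.distrib)
qed
lemma tr_uminus [simp]: "tr (- A) = - tr A"
proof -
  obtain d where d: "supported d A" using supported_ex by blast
  then show ?thesis by (simp add: tr_eq[of d] sum_negf)
qed
lemma tr_minus [simp]: "tr (A - B) = tr A - tr B"
  using tr_plus[of A "- B"] by simp
lemma tr_cscale [simp]: "tr (cscale c A) = c * tr A"
proof -
  obtain d where d: "supported d A" using supported_ex by blast
  then show ?thesis by (simp add: tr_eq[of d] sum_distrib_left)
qed
lemma tr_adj [simp]: "tr (adj A) = cnj (tr A)"
proof -
  obtain d where d: "supported d A" using supported_ex by blast
  then show ?thesis by (simp add: tr_eq[of d])
qed
lemma tr_times_eq: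
  "supported d A \<Longrightarrow> supported d B \<Longrightarrow> tr (A * B) = (\<Sum>i<d. \<Sum>j<d. entry A i j * entry B j i)"
  by (simp add: tr_eq[of d] entry_times[of d])
lemma tr_commute: "tr (A * B) = tr (B * A)"
proof -
  obtain d where d: "supported d A" "supported d B" using supported_ex2 by blast
  show ?thesis unfolding tr_times_eq[OF d] tr_times_eq[OF d(2,1)]
    by (subst sum.swap) (simp add: mult.commute)
qed

lemma tr_adj_self:
  assumes "supported d A"
  shows "tr (adj A * A) = of_real (\<Sum>j<d. \<Sum>i<d. (cmod (entry A i j))\<^sup>2)"
  unfolding tr_times_eq[OF supported_adj[OF assms] assms] of_real_sum entry_adj
  by (intro sum.cong refl) (subst complex_norm_square, rule mult.commute)

text \<open>Only the real part of the Hilbert-Schmidt pairing is kept, which fits duality with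
  \<open>Re (tr _)\<close> and gives access to Cauchy-Schwarz in real inner product spaces. Where
  the imaginary part matters, it is recovered by pairing also with \<open>cscale \<i>\<close> of a
  matrix.\<close>

instantiation fmat :: real_inner
begin
definition scaleR_fmat :: "real \<Rightarrow> fmat \<Rightarrow> fmat" where "scaleR_fmat r A = cscale (of_real r) A"
definition inner_fmat :: "fmat \<Rightarrow> fmat \<Rightarrow> real" where "inner_fmat A B = Re (tr (adj A * B))"
definition norm_fmat :: "fmat \<Rightarrow> real" where "norm_fmat A = sqrt (inner A A)"
definition dist_fmat :: "fmat \<Rightarrow> fmat \<Rightarrow> real" where "dist_fmat A B = norm (A - B)"
definition sgn_fmat :: "fmat \<Rightarrow> fmat" where "sgn_fmat A = scaleR (inverse (norm A)) A"
definition uniformity_fmat :: "(fmat \<times> fmat) filter"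
  where "uniformity_fmat = (INF e\<in>{0<..}. principal {(x, y). dist x y < e})"
definition open_fmat :: "fmat set \<Rightarrow> bool"
  where "open_fmat U \<longleftrightarrow> (\<forall>x\<in>U. eventually (\<lambda>(x', y). x' = x \<longrightarrow> y \<in> U) uniformity)"
instance
proof
  fix A B C :: fmat and r s :: real and U :: "fmat set"
  show "r *\<^sub>R (A + B) = r *\<^sub>R A + r *\<^sub>R B" by (simp add: scaleR_fmat_def cscale_add_right)
  show "(r + s) *\<^sub>R A = r *\<^sub>R A + s *\<^sub>R A" by (simp add: scaleR_fmat_def cscale_add_left)
  show "r *\<^sub>R s *\<^sub>R A = (r * s) *\<^sub>R A" by (simp add: scaleR_fmat_def)
  show "1 *\<^sub>R A = A" by (simp add: scaleR_fmat_def)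
  show "dist A B = norm (A - B)" by (simp add: dist_fmat_def)
  show "sgn A = inverse (norm A) *\<^sub>R A" by (simp add: sgn_fmat_def)
  show "uniformity = (INF e\<in>{0<..}. principal {(x::fmat, y). dist x y < e})"
    by (simp add: uniformity_fmat_def)
  show "open U \<longleftrightarrow> (\<forall>x\<in>U. eventually (\<lambda>(x', y). x' = x \<longrightarrow> y \<in> U) uniformity)"
    by (simp add: open_fmat_def)
  have "tr (adj B * A) = cnj (tr (adj A * B))"
    by (subst tr_adj[symmetric]) simp
  then show "inner A B = inner B A" by (simp add: inner_fmat_def)
  show "inner (A + B) C = inner A C + inner B C" by (simp add: inner_fmat_def algebra_simps)
  show "inner (r *\<^sub>R A) B = r * inner A B" by (simp add: inner_fmat_def scaleR_fmat_def)
  obtain d where d: "supported d A" using supported_ex by blast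
  have in_eq: "inner A A = (\<Sum>j<d. \<Sum>i<d. (cmod (entry A i j))\<^sup>2)"
    unfolding inner_fmat_def tr_adj_self[OF d] by simp
  show "0 \<le> inner A A" unfolding in_eq by (intro sum_nonneg) auto
  show "inner A A = 0 \<longleftrightarrow> A = 0"
  proof
    assume "inner A A = 0"
    then have "\<forall>j<d. \<forall>i<d. entry A i j = 0"
      unfolding in_eq by (simp add: sum_nonneg_eq_0_iff sum_nonneg)
    then show "A = 0" using d by (intro fmat_eqI) (metis entry_zero not_le supportedD)
  qed (simp add: inner_fmat_def)
  show "norm A = sqrt (inner A A)" by (simp add: norm_fmat_def)
qed
end

lemma supported_scaleR [intro, simp]: "supported d A \<Longrightarrow> supported d (r *\<^sub>R A)"
  by (simp add: scaleR_fmat_def)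
lemma entry_scaleR [simp]: "entry (r *\<^sub>R A) i j = of_real r * entry A i j"
  by (simp add: scaleR_fmat_def)
lemma tr_scaleR [simp]: "tr (r *\<^sub>R A) = of_real r * tr A"
  by (simp add: scaleR_fmat_def)
lemma adj_scaleR [simp]: "adj (r *\<^sub>R A) = r *\<^sub>R adj A"
  by (simp add: scaleR_fmat_def)

lemma norm_sq_eq: "supported d A \<Longrightarrow> (norm A)\<^sup>2 = (\<Sum>j<d. \<Sum>i<d. (cmod (entry A i j))\<^sup>2)"
  using tr_adj_self[of d A] by (simp add: norm_fmat_def inner_fmat_def sum_nonneg)

lemma cmod_sum_mult_sq_le:
  fixes f g :: "'a \<Rightarrow> complex"
  shows "(cmod (\<Sum>i\<in>I. f i * g i))\<^sup>2 \<le> (\<Sum>i\<in>I. (cmod (f i))\<^sup>2) * (\<Sum>i\<in>I. (cmod (g i))\<^sup>2)"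
proof -
  have "cmod (\<Sum>i\<in>I. f i * g i) \<le> (\<Sum>i\<in>I. cmod (f i) * cmod (g i))"
    by (rule order_trans[OF norm_sum]) (simp add: norm_mult)
  then have "(cmod (\<Sum>i\<in>I. f i * g i))\<^sup>2 \<le> (\<Sum>i\<in>I. cmod (f i) * cmod (g i))\<^sup>2"
    by (intro power_mono) auto
  also have "\<dots> \<le> (\<Sum>i\<in>I. (cmod (f i))\<^sup>2) * (\<Sum>i\<in>I. (cmod (g i))\<^sup>2)"
    by (rule Cauchy_Schwarz_ineq_sum)
  finally show ?thesis .
qed

instance fmat :: real_normed_algebra
proof
  fix A B :: fmat and r :: real
  show "r *\<^sub>R A * B = r *\<^sub>R (A * B)" by (simp add: scaleR_fmat_def)
  show "A * r *\<^sub>R B = r *\<^sub>R (A * B)" by (simp add: scaleR_fmat_def)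
  obtain d where d: "supported d A" "supported d B" using supported_ex2 by blast
  have "(norm (A * B))\<^sup>2 = (\<Sum>k<d. \<Sum>i<d. (cmod (\<Sum>j<d. entry A i j * entry B j k))\<^sup>2)"
    using d by (simp add: norm_sq_eq[of d] entry_times[of d])
  also have "\<dots> \<le> (\<Sum>k<d. \<Sum>i<d. (\<Sum>j<d. (cmod (entry A i j))\<^sup>2) * (\<Sum>j<d. (cmod (entry B j k))\<^sup>2))"
    by (intro sum_mono cmod_sum_mult_sq_le)
  also have "\<dots> = (\<Sum>i<d. \<Sum>j<d. (cmod (entry A i j))\<^sup>2) * (\<Sum>k<d. \<Sum>j<d. (cmod (entry B j k))\<^sup>2)"
    by (subst sum.swap) (simp only: sum_product)
  also have "\<dots> = (norm A)\<^sup>2 * (norm B)\<^sup>2"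
    unfolding norm_sq_eq[OF d(1)] norm_sq_eq[OF d(2)] by (subst sum.swap) rule
  finally show "norm (A * B) \<le> norm A * norm B"
    by - (rule power2_le_imp_le, simp_all add: power_mult_distrib)
qed

lemma inner_fmat: "inner A B = Re (tr (adj A * B))" for A B :: fmat
  by (rule inner_fmat_def)

lemma norm_adj [simp]: "norm (adj A) = norm A"
  by (simp add: norm_fmat_def inner_fmat tr_commute[of A])

lemma inner_times_left: "inner (A * B) C = inner B (adj A * C)" for A B C :: fmat
  by (simp add: inner_fmat mult.assoc)

section \<open>Diagonalization of Hermitian matrices\<close>

lemma dim_mat_adjoint [simp]: "dim_row (mat_adjoint A) = dim_col A" "dim_col (mat_adjoint A) = dim_row A"
  by (simp_all add: mat_adjoint_def)

lemma index_mat_adjoint [simp]: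
  "i < dim_col A \<Longrightarrow> j < dim_row A \<Longrightarrow> mat_adjoint A $$ (i, j) = cnj (A $$ (j, i))" for A :: "complex mat"
  by (simp add: mat_adjoint_def mat_of_rows_def)

lemma mat_adjoint_carrier [simp, intro]: "A \<in> carrier_mat n k \<Longrightarrow> mat_adjoint A \<in> carrier_mat k n"
  by (rule carrier_matI) (simp_all add: carrier_matD)

lemma index_mult_mat_sum:
  assumes "A \<in> carrier_mat n k" "B \<in> carrier_mat k l" "i < n" "j < l"
  shows "(A * B) $$ (i, j) = (\<Sum>r<k. A $$ (i, r) * B $$ (r, j))"
  using assms by (auto simp: scalar_prod_def atLeast0LessThan intro!: sum.cong)

lemma square_mult_carrier: "A \<in> carrier_mat n n \<Longrightarrow> B \<in> carrier_mat n n \<Longrightarrow> A * B \<in> carrier_mat n n"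
  by (rule mult_carrier_mat)

lemmas square_mult_assoc = assoc_mult_mat[of _ n n _ n _ n for n]

lemma mat_adjoint_mult:
  fixes A B :: "complex mat"
  assumes "A \<in> carrier_mat n k" "B \<in> carrier_mat k l"
  shows "mat_adjoint (A * B) = mat_adjoint B * mat_adjoint A"
proof (rule eq_matI)
  fix i j assume "i < dim_row (mat_adjoint B * mat_adjoint A)" "j < dim_col (mat_adjoint B * mat_adjoint A)"
  then have ij: "i < l" "j < n" using assms by auto
  then show "mat_adjoint (A * B) $$ (i, j) = (mat_adjoint B * mat_adjoint A) $$ (i, j)"
    using assms index_mult_mat_sum[OF assms ij(2,1)]
      index_mult_mat_sum[OF mat_adjoint_carrier[OF assms(2)] mat_adjoint_carrier[OF assms(1)] ij]
    by (auto simp: mult.commute intro!: sum.cong)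
qed (use assms in auto)

lemma mat_adjoint_adjoint [simp]: "mat_adjoint (mat_adjoint A) = A" for A :: "complex mat"
  by (rule eq_matI) auto

text \<open>The deflation step of the spectral theorem. Gram-Schmidt returns orthogonal but not
  normalized vectors, so the columns of \<open>U\<close> are rescaled by
  \<open>1 / sqrt (q i)\<close>; the factor \<open>c\<close> records this for the first
  column.\<close>

lemma unitary_with_first_column:
  fixes v :: "complex vec"
  assumes v: "v \<in> carrier_vec n" and v0: "v \<noteq> 0\<^sub>v n"
  shows "\<exists>U c. U \<in> carrier_mat n n \<and> mat_adjoint U * U = 1\<^sub>m n \<and> col U 0 = c \<cdot>\<^sub>v v"
proof -
  interpret cof_vec_space n "TYPE(complex)" .
  define b where "b = basis_completion v"
  note bc = basis_completion[OF v v0, folded b_def]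
  define ws where "ws = gram_schmidt n b"
  have n0: "n \<noteq> 0"
  proof
    assume "n = 0"
    then have "v = 0\<^sub>v n" using v by auto
    then show False using v0 by simp
  qed
  from gram_schmidt_result[OF bc(2,4,5) ws_def]
  have ws: "set ws \<subseteq> carrier_vec n" "corthogonal ws" "length ws = n"
    using bc(6) by auto
  obtain vs where bv: "b = v # vs" using bc(6,7) n0 by (cases b) auto
  have hd: "ws ! 0 = v" using gram_schmidt_hd[OF v, of vs, folded bv] ws(3) n0
    unfolding ws_def[symmetric] by (cases ws) auto
  have wsc: "ws ! i \<in> carrier_vec n" if "i < n" for i using ws that by auto
  define q where "q i = (\<Sum>k<n. (cmod (ws ! i $ k))\<^sup>2)" for i
  have ip: "ws ! j \<bullet>c ws ! i = (\<Sum>k<n. cnj (ws ! i $ k) * (ws ! j $ k))" if "i < n" "j < n" for i j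
    using wsc[OF that(1)] wsc[OF that(2)]
    by (auto simp: scalar_prod_def atLeast0LessThan mult.commute intro!: sum.cong)
  have qi: "ws ! i \<bullet>c ws ! i = of_real (q i)" if "i < n" for i
    unfolding ip[OF that that] q_def of_real_sum
    by (intro sum.cong refl) (subst complex_norm_square, rule mult.commute)
  have q0: "q i > 0" if "i < n" for i
  proof -
    have "q i \<noteq> 0" using corthogonalD[OF ws(2), of i i] qi[OF that] that ws(3) by auto
    moreover have "q i \<ge> 0" unfolding q_def by (intro sum_nonneg) auto
    ultimately show ?thesis by simp
  qed
  define U where "U = mat n n (\<lambda>(k, i). of_real (1 / sqrt (q i)) * (ws ! i $ k))"
  have U: "U \<in> carrier_mat n n" by (simp add: U_def)
  have "mat_adjoint U * U = 1\<^sub>m n"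
  proof (rule eq_matI)
    fix i j assume "i < dim_row (1\<^sub>m n :: complex mat)" "j < dim_col (1\<^sub>m n :: complex mat)"
    then have ij: "i < n" "j < n" by auto
    have "(mat_adjoint U * U) $$ (i, j) = (\<Sum>k<n. cnj (U $$ (k, i)) * U $$ (k, j))"
      using U ij by (subst index_mult_mat_sum[OF mat_adjoint_carrier[OF U] U ij]) auto
    also have "\<dots> = (\<Sum>k<n. of_real (1 / sqrt (q i) * (1 / sqrt (q j))) * (cnj (ws ! i $ k) * (ws ! j $ k)))"
      using ij by (intro sum.cong refl) (simp add: U_def)
    also have "\<dots> = of_real (1 / sqrt (q i) * (1 / sqrt (q j))) * (ws ! j \<bullet>c ws ! i)"
      unfolding ip[OF ij] by (simp only: sum_distrib_left)
    also have "\<dots> = (if i = j then 1 else 0)"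
    proof (cases "i = j")
      case True
      have "1 / sqrt (q i) * (1 / sqrt (q i)) * q i = 1"
        using q0[OF ij(1)] by simp
      then show ?thesis using True qi[OF ij(1)] by (simp del: of_real_mult add: of_real_mult[symmetric])
    next
      case False
      then show ?thesis using corthogonalD[OF ws(2), of j i] ij ws(3) by auto
    qed
    finally show "(mat_adjoint U * U) $$ (i, j) = 1\<^sub>m n $$ (i, j)" using ij by simp
  qed (use U in auto)
  moreover have "col U 0 = of_real (1 / sqrt (q 0)) \<cdot>\<^sub>v v"
    using n0 v by (intro eq_vecI) (auto simp: U_def hd)
  ultimately show ?thesis using U by blast
qed

lemma complex_eigenvector_exists:
  assumes A: "A \<in> carrier_mat n n" and n: "n \<noteq> 0"
  shows "\<exists>v e. v \<in> carrier_vec n \<and> v \<noteq> 0\<^sub>v n \<and> A *\<^sub>v v = (e :: complex) \<cdot>\<^sub>v v"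
proof -
  have "degree (char_poly A) \<noteq> 0" using degree_monic_char_poly[OF A] n by simp
  then have "\<not> constant (poly (char_poly A))" by (simp add: constant_degree)
  then obtain e where "poly (char_poly A) e = 0" using fundamental_theorem_of_algebra by blast
  then have "eigenvalue A e" using eigenvalue_root_char_poly[OF A] by simp
  then show ?thesis using A unfolding eigenvalue_def eigenvector_def by auto
qed

text \<open>Induction by deflation: a unitary whose first column is an eigenvector splits off a one
  by one block. The diagonal \<open>f\<close> is not claimed to be real;
  \<open>singular_value_data\<close> gets that from the special form of its matrix.\<close>

lemma hermitian_unitary_diagonalization:
  fixes A :: "complex mat"
  assumes "A \<in> carrier_mat n n" "mat_adjoint A = A"
  shows "\<exists>U f. U \<in> carrier_mat n n \<and> mat_adjoint U * U = 1\<^sub>m n \<and> A = U * mat_diag n f * mat_adjoint U"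
  using assms
proof (induction n arbitrary: A)
  case 0
  then show ?case
    by (intro exI[of _ "1\<^sub>m 0"] exI[of _ "\<lambda>_. 0"]) auto
next
  case (Suc k)
  let ?n = "Suc k"
  note A = Suc.prems(1) and herm = Suc.prems(2)
  obtain v e where v: "v \<in> carrier_vec ?n" "v \<noteq> 0\<^sub>v ?n" and ev: "A *\<^sub>v v = e \<cdot>\<^sub>v v"
    using complex_eigenvector_exists[OF A] by auto
  obtain W c where W: "W \<in> carrier_mat ?n ?n" and WW: "mat_adjoint W * W = 1\<^sub>m ?n"
    and colW: "col W 0 = c \<cdot>\<^sub>v v"
    using unitary_with_first_column[OF v] by blast
  let ?W = "mat_adjoint W"
  have cW: "col W 0 \<in> carrier_vec ?n" using colW v(1) by simp
  have W': "?W \<in> carrier_mat ?n ?n" using W by auto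
  have WW2: "W * ?W = 1\<^sub>m ?n" by (rule mat_mult_left_right_inverse[OF W' W WW])
  define B where "B = ?W * A * W"
  have B: "B \<in> carrier_mat ?n ?n" using A W W' by (auto simp: B_def)
  have AB: "A = W * B * ?W"
  proof -
    have "W * B * ?W = (W * ?W) * A * (W * ?W)"
      unfolding B_def using A W W' by (simp add: square_mult_assoc[of _ ?n] square_mult_carrier[of _ ?n])
    then show ?thesis using A by (simp add: WW2)
  qed
  have hermB: "mat_adjoint B = B"
    unfolding B_def using A W W' herm
    by (simp add: mat_adjoint_mult[of _ ?n ?n _ ?n] square_mult_assoc[of _ ?n] square_mult_carrier[of _ ?n])
  have col0: "col B 0 = e \<cdot>\<^sub>v unit_vec ?n 0"
  proof -
    have "col B 0 = (?W * A) *\<^sub>v col W 0" unfolding B_def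
      using A W W' by (intro col_mult2[of _ ?n ?n _ ?n]) auto
    also have "\<dots> = ?W *\<^sub>v (A *\<^sub>v col W 0)"
      using A W W' cW by (intro assoc_mult_mat_vec[of _ ?n ?n _ ?n]) auto
    also have "A *\<^sub>v col W 0 = e \<cdot>\<^sub>v col W 0"
      unfolding colW using A v(1) ev by (simp add: mult_mat_vec[of _ ?n ?n] smult_smult_assoc mult.commute)
    also have "?W *\<^sub>v (e \<cdot>\<^sub>v col W 0) = e \<cdot>\<^sub>v (?W *\<^sub>v col W 0)"
      using W W' cW by (intro mult_mat_vec[of _ ?n ?n]) auto
    also have "?W *\<^sub>v col W 0 = col (?W * W) 0"
      using W W' by (intro col_mult2[of _ ?n ?n _ ?n, symmetric]) auto
    also have "\<dots> = unit_vec ?n 0" unfolding WW by simp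
    finally show ?thesis .
  qed
  have Bi0: "B $$ (i, 0) = (if i = 0 then e else 0)" if "i < ?n" for i
    using arg_cong[OF col0, of "\<lambda>v. v $ i"] B that by auto
  \<comment> \<open>Being Hermitian turns the vanishing of the rest of the first column into that of
    the first row, so \<open>B\<close> is block diagonal.\<close>
  have B0j: "B $$ (0, j) = 0" if "0 < j" "j < ?n" for j
  proof -
    have "B $$ (0, j) = mat_adjoint B $$ (0, j)" by (simp add: hermB)
    also have "\<dots> = cnj (B $$ (j, 0))" using B that by (intro index_mat_adjoint) auto
    finally show ?thesis using Bi0[OF that(2)] that by simp
  qed
  define B3 where "B3 = mat k k (\<lambda>(i, j). B $$ (Suc i, Suc j))"
  have B3: "B3 \<in> carrier_mat k k" by (simp add: B3_def)
  have "mat_adjoint B3 = B3"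
  proof (rule eq_matI)
    fix i j assume "i < dim_row B3" "j < dim_col B3"
    then have ij: "i < k" "j < k" using B3 by auto
    have "mat_adjoint B3 $$ (i, j) = cnj (B $$ (Suc j, Suc i))"
      using ij B3 by (simp add: B3_def)
    also have "\<dots> = mat_adjoint B $$ (Suc i, Suc j)" using B ij by simp
    finally show "mat_adjoint B3 $$ (i, j) = B3 $$ (i, j)" using ij by (simp add: hermB B3_def)
  qed (use B3 in auto)
  from Suc.IH[OF B3 this] obtain U3 f where U3: "U3 \<in> carrier_mat k k"
    and U3U: "mat_adjoint U3 * U3 = 1\<^sub>m k" and B3d: "B3 = U3 * mat_diag k f * mat_adjoint U3" by blast
  have U3': "mat_adjoint U3 \<in> carrier_mat k k" using U3 by auto
  define g where "g i = (case i of 0 \<Rightarrow> e | Suc j \<Rightarrow> f j)" for i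
  define blk :: "complex \<Rightarrow> complex mat \<Rightarrow> complex mat"
    where "blk a M = four_block_mat (mat 1 1 (\<lambda>_. a)) (0\<^sub>m 1 k) (0\<^sub>m k 1) M" for a M
  have blk_mult: "blk a M * blk b N = blk (a * b) (M * N)"
    if "M \<in> carrier_mat k k" "N \<in> carrier_mat k k" for a b :: complex and M N
  proof -
    have "mat 1 1 (\<lambda>_. a) * mat 1 1 (\<lambda>_. b) = mat 1 1 (\<lambda>_. a * b)"
      by (rule eq_matI) (auto simp: scalar_prod_def)
    then show ?thesis using that unfolding blk_def
      by (subst mult_four_block_mat[of _ 1 1 _ k _ k _ _ 1 _ k]) auto
  qed
  have blk_adj: "mat_adjoint (blk a M) = blk (cnj a) (mat_adjoint M)"
    if "M \<in> carrier_mat k k" for a :: complex and M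
    using that unfolding blk_def by (intro eq_matI) auto
  have Bblk: "B = blk e B3"
    using B Bi0 B0j by (intro eq_matI) (auto simp: B3_def blk_def)
  have diag: "mat_diag ?n g = blk e (mat_diag k f)"
    by (intro eq_matI) (auto simp: mat_diag_def g_def blk_def split: nat.splits)
  define V where "V = blk 1 U3"
  have V: "V \<in> carrier_mat ?n ?n" using U3 by (auto simp: V_def blk_def)
  have one: "blk 1 (1\<^sub>m k) = 1\<^sub>m ?n"
    by (intro eq_matI) (auto simp: blk_def)
  have VV: "mat_adjoint V * V = 1\<^sub>m ?n"
    unfolding V_def using U3 U3' U3U one by (simp add: blk_adj blk_mult)
  have BV: "B = V * mat_diag ?n g * mat_adjoint V"
    unfolding V_def diag Bblk B3d using U3 U3' by (simp add: blk_adj blk_mult)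
  have V': "mat_adjoint V \<in> carrier_mat ?n ?n" using V by auto
  have D: "mat_diag ?n g \<in> carrier_mat ?n ?n" by simp
  show ?case
  proof (intro exI conjI)
    show "W * V \<in> carrier_mat ?n ?n" using W V by auto
    have "mat_adjoint (W * V) * (W * V) = mat_adjoint V * (?W * W) * V"
      using W V W' V' by (simp add: mat_adjoint_mult[of _ ?n ?n _ ?n] square_mult_assoc[of _ ?n] square_mult_carrier[of _ ?n])
    then show "mat_adjoint (W * V) * (W * V) = 1\<^sub>m ?n" using VV by (simp add: WW right_mult_one_mat[OF V'])
    show "A = W * V * mat_diag ?n g * mat_adjoint (W * V)"
      unfolding AB BV using W V W' V' D
      by (simp add: mat_adjoint_mult[of _ ?n ?n _ ?n] square_mult_assoc[of _ ?n] square_mult_carrier[of _ ?n])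
  qed
qed

lemma char_poly_unitary_diag:
  fixes U :: "complex mat"
  assumes U: "U \<in> carrier_mat n n" and UU: "mat_adjoint U * U = 1\<^sub>m n"
  shows "char_poly (U * mat_diag n f * mat_adjoint U) = (\<Prod>i\<leftarrow>[0..<n]. [:- f i, 1:])"
proof -
  have U': "mat_adjoint U \<in> carrier_mat n n" using U by auto
  have UU': "U * mat_adjoint U = 1\<^sub>m n" by (rule mat_mult_left_right_inverse[OF U' U UU])
  have D: "mat_diag n f \<in> carrier_mat n n" by simp
  have "similar_mat_wit (U * mat_diag n f * mat_adjoint U) (mat_diag n f) U (mat_adjoint U)"
    using U U' D by (intro similar_mat_witI[OF UU' UU refl] square_mult_carrier) auto
  then have "similar_mat (U * mat_diag n f * mat_adjoint U) (mat_diag n f)"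
    unfolding similar_mat_def by blast
  then have "char_poly (U * mat_diag n f * mat_adjoint U) = char_poly (mat_diag n f)"
    by (rule char_poly_similar)
  also have "\<dots> = (\<Prod>a\<leftarrow>diag_mat (mat_diag n f). [:- a, 1:])"
    by (rule char_poly_upper_triangular[OF D]) (auto simp: mat_diag_def)
  also have "diag_mat (mat_diag n f) = map f [0..<n]"
    by (auto simp: diag_mat_def mat_diag_def)
  finally show ?thesis by (simp add: o_def)
qed

lemma proots_prod_linear:
  "proots (\<Prod>i\<leftarrow>is. [:- f i, 1:]) = mset (map f is)" for f :: "'a \<Rightarrow> complex"
proof (induction "is")
  case (Cons i "is")
  have "(\<Prod>i\<leftarrow>is. [:- f i, 1:]) \<noteq> 0" by (induction "is") (auto simp del: mult_pCons_left)
  then show ?case using Cons by (simp add: proots_mult del: mult_pCons_left)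
qed simp

lemma singular_value_data:
  assumes A: "A \<in> carrier_mat d d"
  obtains U s where "U \<in> carrier_mat d d" "mat_adjoint U * U = 1\<^sub>m d" "\<And>i. s i \<ge> 0"
    "mat_adjoint A * A = U * mat_diag d (\<lambda>i. of_real ((s i)\<^sup>2)) * mat_adjoint U"
    "schatten1_norm A = (\<Sum>i<d. s i)"
proof -
  let ?H = "mat_adjoint A * A"
  have A': "mat_adjoint A \<in> carrier_mat d d" using A by auto
  have H: "?H \<in> carrier_mat d d" by (rule square_mult_carrier[OF A' A])
  have "mat_adjoint ?H = ?H" using A A' by (simp add: mat_adjoint_mult[of _ d d _ d])
  from hermitian_unitary_diagonalization[OF H this] obtain U f where
    U: "U \<in> carrier_mat d d" and UU: "mat_adjoint U * U = 1\<^sub>m d" and Hd: "?H = U * mat_diag d f * mat_adjoint U"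
    by blast
  have U': "mat_adjoint U \<in> carrier_mat d d" using U by auto
  \<comment> \<open>The value 0 beyond \<open>d\<close> makes \<open>s i \<ge> 0\<close> hold for
    every index, as the conclusion asks.\<close>
  define s where "s i = (if i < d then sqrt (Re (f i)) else 0)" for i
  \<comment> \<open>The eigenvalue is the squared length of column \<open>i\<close> of
    \<open>A * U\<close>, hence real and nonnegative.\<close>
  have f_eq: "f i = of_real (\<Sum>k<d. (cmod ((A * U) $$ (k, i)))\<^sup>2)" if i: "i < d" for i
  proof -
    have D: "mat_diag d f \<in> carrier_mat d d" by simp
    have AU: "A * U \<in> carrier_mat d d" using A U by simp
    have "mat_adjoint (A * U) * (A * U) = mat_adjoint U * ?H * U"
      using A U A' U'
      by (simp add: mat_adjoint_mult[of _ d d _ d] square_mult_assoc[of _ d] square_mult_carrier[of _ d])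
    also have "\<dots> = (mat_adjoint U * U) * mat_diag d f * (mat_adjoint U * U)"
      unfolding Hd using U U' D
      by (simp add: square_mult_assoc[of _ d] square_mult_carrier[of _ d])
    also have "\<dots> = mat_diag d f" unfolding UU by (simp add: left_mult_one_mat[OF D] right_mult_one_mat[OF D])
    finally have "f i = (mat_adjoint (A * U) * (A * U)) $$ (i, i)"
      using i by (simp add: mat_diag_def)
    also have "\<dots> = (\<Sum>k<d. mat_adjoint (A * U) $$ (i, k) * (A * U) $$ (k, i))"
      by (rule index_mult_mat_sum[OF mat_adjoint_carrier[OF AU] AU i i])
    also have "\<dots> = (\<Sum>k<d. cnj ((A * U) $$ (k, i)) * (A * U) $$ (k, i))"
      using AU i by (intro sum.cong refl) (subst index_mat_adjoint, auto simp del: index_mult_mat simp: carrier_matD)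
    also have "\<dots> = of_real (\<Sum>k<d. (cmod ((A * U) $$ (k, i)))\<^sup>2)"
      unfolding of_real_sum by (intro sum.cong refl) (subst complex_norm_square, rule mult.commute)
    finally show ?thesis .
  qed
  have f_s: "f i = of_real ((s i)\<^sup>2)" if "i < d" for i
    using that f_eq[OF that] by (simp add: s_def sum_nonneg)
  have "mat_diag d f = mat_diag d (\<lambda>i. of_real ((s i)\<^sup>2))"
    using f_s by (intro eq_matI) (auto simp: mat_diag_def)
  then have "?H = U * mat_diag d (\<lambda>i. of_real ((s i)\<^sup>2)) * mat_adjoint U" using Hd by simp
  moreover have "s i \<ge> 0" for i
    using f_eq[of i] by (auto simp: s_def sum_nonneg)
  moreover have "schatten1_norm A = (\<Sum>i<d. s i)"
  proof -
    have "proots (char_poly ?H) = mset (map f [0..<d])"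
      unfolding Hd char_poly_unitary_diag[OF U UU] by (rule proots_prod_linear)
    then have "schatten1_norm A = sum_list (map (\<lambda>i. sqrt (Re (f i))) [0..<d])"
      unfolding schatten1_norm_def singular_values_def
      by (simp add: sum_mset_sum_list o_def flip: mset_map)
    also have "\<dots> = (\<Sum>i<d. s i)"
      by (simp add: interv_sum_list_conv_sum_set_nat s_def atLeast0LessThan)
    finally show ?thesis .
  qed
  ultimately show ?thesis using that U UU by blast
qed

section \<open>The trace norm\<close>

definition of_mat :: "complex mat \<Rightarrow> fmat"
  where "of_mat A = Abs_fmat (\<lambda>i j. if i < dim_row A \<and> j < dim_col A then A $$ (i, j) else 0)"

definition fdiag :: "nat \<Rightarrow> (nat \<Rightarrow> complex) \<Rightarrow> fmat"
  where "fdiag d f = Abs_fmat (\<lambda>i j. if i = j \<and> i < d then f i else 0)"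

lemma entry_of_mat: "entry (of_mat A) i j = (if i < dim_row A \<and> j < dim_col A then A $$ (i, j) else 0)"
proof -
  have "\<exists>d. \<forall>i j. d \<le> i \<or> d \<le> j \<longrightarrow> (if i < dim_row A \<and> j < dim_col A then A $$ (i, j) else 0) = 0"
    by (intro exI[of _ "max (dim_row A) (dim_col A)"]) auto
  then show ?thesis unfolding of_mat_def by (subst Abs_fmat_inverse) auto
qed

lemma entry_fdiag: "entry (fdiag d f) i j = (if i = j \<and> i < d then f i else 0)"
proof -
  have "\<exists>e. \<forall>i j. e \<le> i \<or> e \<le> j \<longrightarrow> (if i = j \<and> i < d then f i else 0) = 0"
    by (intro exI[of _ d]) auto
  then show ?thesis unfolding fdiag_def by (subst Abs_fmat_inverse) auto
qed

lemma supported_of_mat: "A \<in> carrier_mat d d \<Longrightarrow> supported d (of_mat A)"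
  by (rule supportedI) (auto simp: entry_of_mat)

lemma supported_fdiag [intro, simp]: "supported d (fdiag d f)"
  by (rule supportedI) (auto simp: entry_fdiag)

lemma of_mat_minus:
  "A \<in> carrier_mat n k \<Longrightarrow> B \<in> carrier_mat n k \<Longrightarrow> of_mat (A - B) = of_mat A - of_mat B"
  by (rule fmat_eqI) (auto simp: entry_of_mat)

lemma of_mat_adjoint: "of_mat (mat_adjoint A) = adj (of_mat A)"
  by (rule fmat_eqI) (auto simp: entry_of_mat)

lemma of_mat_mult:
  assumes A: "A \<in> carrier_mat d d" and B: "B \<in> carrier_mat d d"
  shows "of_mat (A * B) = of_mat A * of_mat B"
proof (rule fmat_eqI)
  fix i j
  show "entry (of_mat (A * B)) i j = entry (of_mat A * of_mat B) i j"
  proof (cases "i < d \<and> j < d")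
    case True
    then have "entry (of_mat (A * B)) i j = (\<Sum>r<d. A $$ (i, r) * B $$ (r, j))"
      using A B index_mult_mat_sum[OF A B] by (simp add: entry_of_mat del: index_mult_mat)
         (simp add: entry_of_mat)
    also have "\<dots> = entry (of_mat A * of_mat B) i j"
      unfolding entry_times[OF supported_of_mat[OF A]] using A B True by (simp add: entry_of_mat)
    finally show ?thesis .
  next
    case False
    then have "d \<le> i \<or> d \<le> j" by auto
    moreover have "supported d (of_mat (A * B))" "supported d (of_mat A * of_mat B)"
      using A B by (auto intro!: supported_of_mat mult_carrier_mat)
    ultimately show ?thesis by (simp add: supportedD)
  qed
qed

lemma of_mat_diag: "of_mat (mat_diag d f) = fdiag d f"
  by (rule fmat_eqI) (auto simp: entry_of_mat entry_fdiag mat_diag_def)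

lemma of_mat_one: "of_mat (1\<^sub>m d) = fdiag d (\<lambda>_. 1)"
  by (rule fmat_eqI) (auto simp: entry_of_mat entry_fdiag)

lemma fdiag_times [simp]: "fdiag d f * fdiag d g = fdiag d (\<lambda>i. f i * g i)"
proof (rule fmat_eqI)
  fix i j
  have "entry (fdiag d f * fdiag d g) i j = (\<Sum>k<d. if k = i then entry (fdiag d f) i i * entry (fdiag d g) i j else 0)"
    unfolding entry_times[OF supported_fdiag] by (intro sum.cong refl) (auto simp: entry_fdiag)
  then show "entry (fdiag d f * fdiag d g) i j = entry (fdiag d (\<lambda>i. f i * g i)) i j"
    by (auto simp: entry_fdiag)
qed

lemma adj_fdiag [simp]: "adj (fdiag d f) = fdiag d (\<lambda>i. cnj (f i))"
  by (rule fmat_eqI) (auto simp: entry_fdiag)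

lemma tr_fdiag [simp]: "tr (fdiag d f) = (\<Sum>i<d. f i)"
  by (simp add: tr_eq[OF supported_fdiag] entry_fdiag)

lemma fdiag_one_times: "supported d A \<Longrightarrow> fdiag d (\<lambda>_. 1) * A = A"
proof (rule fmat_eqI)
  fix i j assume A: "supported d A"
  have "entry (fdiag d (\<lambda>_. 1) * A) i j = (\<Sum>k<d. if k = i then entry A i j else 0)"
    unfolding entry_times[OF supported_fdiag] by (intro sum.cong refl) (auto simp: entry_fdiag)
  then show "entry (fdiag d (\<lambda>_. 1) * A) i j = entry A i j"
    using supportedD[OF A, of i j] by auto
qed

lemma times_fdiag_one: "supported d A \<Longrightarrow> A * fdiag d (\<lambda>_. 1) = A"
  using arg_cong[OF fdiag_one_times[of d "adj A"], of adj] by simp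

text \<open>Operator norm at most 1, expressed by left multiplication in the Hilbert-Schmidt norm so
  that no vectors are needed: a matrix \<open>M\<close> serves as the tuple of its columns.\<close>

definition contraction :: "fmat \<Rightarrow> bool"
  where "contraction T \<longleftrightarrow> (\<forall>M. norm (T * M) \<le> norm M)"

lemma contraction_times_le: "contraction T \<Longrightarrow> norm (T * M) \<le> norm M"
  by (simp add: contraction_def)

text \<open>Moving \<open>adj T\<close> across the inner product bounds the square of
  \<open>norm (adj T * M)\<close> by \<open>norm M * norm (adj T * M)\<close>, and one factor
  cancels.\<close>

lemma contraction_adj:
  assumes "contraction T"
  shows "contraction (adj T)"
  unfolding contraction_def
proof
  fix M
  have "(norm (adj T * M))\<^sup>2 = inner M (T * (adj T * M))"
    by (simp add: power2_norm_eq_inner inner_times_left)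
  also have "\<dots> \<le> norm M * norm (T * (adj T * M))"
    by (rule norm_cauchy_schwarz)
  also have "\<dots> \<le> norm M * norm (adj T * M)"
    by (intro mult_left_mono contraction_times_le assms) auto
  finally have "norm (adj T * M) * norm (adj T * M) \<le> norm M * norm (adj T * M)"
    by (simp add: power2_eq_square)
  then show "norm (adj T * M) \<le> norm M"
    using norm_ge_zero[of M] by (cases "norm (adj T * M) = 0") auto
qed

lemma contraction_times_right_le: "contraction T \<Longrightarrow> norm (M * T) \<le> norm M"
  using contraction_times_le[OF contraction_adj, of T "adj M"]
  by (metis adj_times norm_adj)

lemma contraction_mult: "contraction S \<Longrightarrow> contraction T \<Longrightarrow> contraction (S * T)"
  unfolding contraction_def mult.assoc by (meson order_trans)

lemma contraction_uminus: "contraction T \<Longrightarrow> contraction (- T)"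
  by (simp add: contraction_def)

lemma contraction_average: 
  assumes "contraction S" "contraction T"
  shows "contraction ((1 / 2) *\<^sub>R (S + T))"
  unfolding contraction_def
proof
  fix M
  have "norm ((1 / 2) *\<^sub>R (S + T) * M) = (1 / 2) * norm (S * M + T * M)"
    by (simp add: distrib_right del: scaleR_add_right)
  also have "\<dots> \<le> (1 / 2) * (norm (S * M) + norm (T * M))"
    by (simp add: norm_triangle_ineq)
  also have "\<dots> \<le> norm M"
    using assms[THEN contraction_times_le, of M] by simp
  finally show "norm ((1 / 2) *\<^sub>R (S + T) * M) \<le> norm M" .
qed

text \<open>The nuclear norm by duality with the operator norm, which makes the triangle inequality
  and the behaviour under contractions immediate. That the supremum is attained and equals the sum
  of the singular values comes from \<open>trnorm_of_mat\<close>.\<close>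

definition trnorm :: "fmat \<Rightarrow> real"
  where "trnorm M = (SUP T\<in>{T. contraction T}. Re (tr (T * M)))"

lemma re_tr_mult_le:
  assumes "contraction T"
  shows "Re (tr (T * (L * R))) \<le> norm L * norm R"
proof -
  have "Re (tr (T * (L * R))) = inner (adj R) (T * L)"
    by (simp add: inner_fmat tr_commute[of R] mult.assoc)
  also have "\<dots> \<le> norm (adj R) * norm (T * L)" by (rule norm_cauchy_schwarz)
  also have "\<dots> \<le> norm R * norm L"
    by (simp add: mult_left_mono contraction_times_le assms)
  finally show ?thesis by (simp add: mult.commute)
qed

lemma trnorm_eqI:
  assumes "contraction T" "Re (tr (T * (L * R))) = s" "norm L * norm R = s"
  shows "trnorm (L * R) = s"
  unfolding trnorm_def
proof (rule cSup_eq_maximum)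
  show "s \<in> (\<lambda>T. Re (tr (T * (L * R)))) ` {T. contraction T}"
    using assms(1,2) by (intro image_eqI[of _ _ T]) auto
  fix x assume "x \<in> (\<lambda>T. Re (tr (T * (L * R)))) ` {T. contraction T}"
  then show "x \<le> s" unfolding assms(3)[symmetric] by (auto intro: re_tr_mult_le)
qed

text \<open>The polar decomposition A = W |A| in disguise: \<open>L\<close> is W |A|^(1/2),
  \<open>R\<close> is |A|^(1/2), and \<open>T\<close> is the adjoint of W. The two factors bound
  every dual pairing from above and \<open>T\<close> attains the bound, which is what
  \<open>trnorm_eqI\<close> asks for.\<close>

lemma trnorm_of_mat:
  assumes A: "A \<in> carrier_mat d d"
  obtains L R T where "supported d L" "supported d R" "supported d T" "contraction T"
    "of_mat A = L * R" "(norm L)\<^sup>2 = schatten1_norm A" "(norm R)\<^sup>2 = schatten1_norm A"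
    "Re (tr (T * of_mat A)) = schatten1_norm A"
proof -
  obtain U s where U: "U \<in> carrier_mat d d" and UU: "mat_adjoint U * U = 1\<^sub>m d"
    and s0: "\<And>i. s i \<ge> 0"
    and AA: "mat_adjoint A * A = U * mat_diag d (\<lambda>i. of_real ((s i)\<^sup>2)) * mat_adjoint U"
    and nA: "schatten1_norm A = (\<Sum>i<d. s i)"
    using singular_value_data[OF A] by blast
  have U': "mat_adjoint U \<in> carrier_mat d d" using U by auto
  have A': "mat_adjoint A \<in> carrier_mat d d" using A by auto
  have UU2: "U * mat_adjoint U = 1\<^sub>m d" by (rule mat_mult_left_right_inverse[OF U' U UU])
  define Q where "Q = of_mat U"
  define M where "M = of_mat A"
  define D where "D f = fdiag d (\<lambda>i. of_real (f i))" for f :: "nat \<Rightarrow> real"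
  have sQ: "supported d Q" and sM: "supported d M" using U A by (auto simp: Q_def M_def supported_of_mat)
  have sD: "supported d (D f)" for f by (simp add: D_def)
  have D_adj: "adj (D f) = D f" for f by (simp add: D_def)
  have D_mult: "D f * D g = D (\<lambda>i. f i * g i)" for f g by (simp add: D_def)
  have D_mult': "D f * (D g * X) = D (\<lambda>i. f i * g i) * X" for f g X by (simp add: D_mult flip: mult.assoc)
  have D_tr: "tr (D f) = of_real (\<Sum>i<d. f i)" for f by (simp add: D_def)
  have one: "D (\<lambda>_. 1) * X = X" "X * D (\<lambda>_. 1) = X" if "supported d X" for X
    using fdiag_one_times[OF that] times_fdiag_one[OF that] by (simp_all add: D_def)
  have "adj Q * Q = of_mat (mat_adjoint U * U)"
    by (simp add: of_mat_mult[OF U' U] of_mat_adjoint Q_def)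
  then have QQ: "adj Q * Q = D (\<lambda>_. 1)" by (simp add: UU of_mat_one D_def)
  have "Q * adj Q = of_mat (U * mat_adjoint U)"
    by (simp add: of_mat_mult[OF U U'] of_mat_adjoint Q_def)
  then have QQ2: "Q * adj Q = D (\<lambda>_. 1)" by (simp add: UU2 of_mat_one D_def)
  have QQX: "adj Q * (Q * X) = X" if "supported d X" for X
    using that one by (simp add: QQ flip: mult.assoc)
  have dU: "mat_diag d (\<lambda>i. complex_of_real ((s i)\<^sup>2)) \<in> carrier_mat d d" by simp
  have "adj M * M = of_mat (mat_adjoint A * A)"
    by (simp add: of_mat_mult[OF A' A] of_mat_adjoint M_def)
  also have "\<dots> = Q * D (\<lambda>i. (s i)\<^sup>2) * adj Q"
    unfolding AA Q_def D_def of_mat_adjoint[symmetric] of_mat_diag[symmetric]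
    using of_mat_mult[OF square_mult_carrier[OF U dU] U'] of_mat_mult[OF U dU] by simp
  finally have MM: "adj M * M = Q * (D (\<lambda>i. (s i)\<^sup>2) * adj Q)" by (simp add: mult.assoc)
  have MMX: "adj M * (M * X) = Q * (D (\<lambda>i. (s i)\<^sup>2) * (adj Q * X))" for X
    using arg_cong[OF MM, of "\<lambda>Y. Y * X"] by (simp add: mult.assoc)
  have trQ: "tr (Q * (X * adj Q)) = tr X" if "supported d X" for X
    by (subst tr_commute) (simp add: mult.assoc QQ one that)
  \<comment> \<open>A pseudoinverse of \<open>s\<close>, so that the construction also covers
    singular \<open>A\<close>.\<close>
  define r where "r i = (if s i = 0 then 0 else 1 / s i)" for i
  have r0: "r i \<ge> 0" for i using s0 by (simp add: r_def)
  define L where "L = M * (Q * (D (\<lambda>i. sqrt (r i)) * adj Q))"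
  define R where "R = Q * (D (\<lambda>i. sqrt (s i)) * adj Q)"
  define T where "T = Q * (D r * (adj Q * adj M))"
  note simps = mult.assoc QQX QQ D_mult D_mult' one sD sQ sM D_adj MMX
  \<comment> \<open>\<open>M\<close> vanishes on the kernel of |M|; hence the support projection
    that \<open>L * R\<close> leaves behind may be replaced by the identity.\<close>
  have Z: "M * (Q * D (\<lambda>i. if s i = 0 then 1 else 0)) = 0" (is "?Z = 0")
  proof -
    have "(norm ?Z)\<^sup>2 = Re (tr (adj ?Z * ?Z))"
      by (simp add: power2_norm_eq_inner inner_fmat)
    also have "adj ?Z * ?Z = D (\<lambda>i. (if s i = 0 then 1 else 0) * ((s i)\<^sup>2 * (if s i = 0 then 1 else 0)))"
      by (simp add: simps)
    also have "(\<lambda>i. (if s i = 0 then 1 else 0) * ((s i)\<^sup>2 * (if s i = 0 then 1 else 0))) = (\<lambda>i. 0)"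
      by auto
    finally show ?thesis by (simp add: D_tr)
  qed
  have "L * R = M * (Q * (D (\<lambda>i. sqrt (r i) * sqrt (s i)) * adj Q))"
    by (simp add: L_def R_def simps)
  also have "D (\<lambda>i. sqrt (r i) * sqrt (s i)) = D (\<lambda>_. 1) - D (\<lambda>i. if s i = 0 then 1 else 0)"
    using s0 by (intro fmat_eqI) (auto simp: D_def entry_fdiag r_def real_sqrt_divide)
  also have "M * (Q * ((D (\<lambda>_. 1) - D (\<lambda>i. if s i = 0 then 1 else 0)) * adj Q)) =
      M * (Q * (D (\<lambda>_. 1) * adj Q)) - M * (Q * D (\<lambda>i. if s i = 0 then 1 else 0)) * adj Q"
    by (simp add: algebra_simps)
  also have "\<dots> = M" unfolding Z by (simp add: one sQ sM QQ2)
  finally have LR: "M = L * R" by simp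
  have nL: "(norm L)\<^sup>2 = schatten1_norm A"
  proof -
    have "(norm L)\<^sup>2 = Re (tr (adj L * L))"
      by (simp add: power2_norm_eq_inner inner_fmat)
    also have "adj L * L = Q * (D (\<lambda>i. sqrt (r i) * ((s i)\<^sup>2 * sqrt (r i))) * adj Q)"
      by (simp add: L_def simps)
    also have "(\<lambda>i. sqrt (r i) * ((s i)\<^sup>2 * sqrt (r i))) = s"
    proof
      fix i
      have "sqrt (r i) * ((s i)\<^sup>2 * sqrt (r i)) = (sqrt (r i))\<^sup>2 * (s i)\<^sup>2"
        by (simp add: power2_eq_square)
      also have "\<dots> = s i" using r0[of i] by (simp add: r_def power2_eq_square)
      finally show "sqrt (r i) * ((s i)\<^sup>2 * sqrt (r i)) = s i" .
    qed
    finally show ?thesis by (simp add: trQ sD D_tr nA)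
  qed
  have nR: "(norm R)\<^sup>2 = schatten1_norm A"
  proof -
    have "(norm R)\<^sup>2 = Re (tr (adj R * R))"
      by (simp add: power2_norm_eq_inner inner_fmat)
    also have "adj R * R = Q * (D (\<lambda>i. sqrt (s i) * sqrt (s i)) * adj Q)"
      by (simp add: R_def simps)
    also have "(\<lambda>i. sqrt (s i) * sqrt (s i)) = s" using s0 by auto
    finally show ?thesis by (simp add: trQ sD D_tr nA)
  qed
  have trT: "Re (tr (T * M)) = schatten1_norm A"
  proof -
    have "T * M = Q * (D (\<lambda>i. r i * (s i)\<^sup>2) * adj Q)"
      using QQX[of "D (\<lambda>i. (s i)\<^sup>2) * adj Q"] by (simp add: T_def MM mult.assoc sD sQ D_mult')
    also have "(\<lambda>i. r i * (s i)\<^sup>2) = s" by (auto simp: r_def power2_eq_square)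
    finally show ?thesis by (simp add: trQ sD D_tr nA)
  qed
  \<comment> \<open>\<open>T * adj T\<close> is the projection onto the range of |M|, so
    \<open>adj T\<close> is contractive; the claim for \<open>T\<close> follows by passing to the
    adjoint.\<close>
  have "contraction (adj T)"
    unfolding contraction_def
  proof
    fix N
    define P where "P = Q * (D (\<lambda>i. if s i = 0 then 0 else 1) * adj Q)"
    have "T * adj T = Q * (D (\<lambda>i. r i * ((s i)\<^sup>2 * r i)) * adj Q)"
      by (simp add: T_def simps)
    also have "(\<lambda>i. r i * ((s i)\<^sup>2 * r i)) = (\<lambda>i. if s i = 0 then 0 else 1)"
      by (auto simp: r_def power2_eq_square)
    finally have TT: "T * adj T = P" by (simp add: P_def)
    have Padj: "adj P = P" by (simp add: P_def simps)
    have "P * P = Q * (D (\<lambda>i. (if s i = 0 then 0 else 1) * (if s i = 0 then 0 else 1)) * adj Q)"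
      by (simp add: P_def simps)
    also have "(\<lambda>i. (if s i = 0 then 0 else 1) * (if s i = 0 then 0 else 1)) = (\<lambda>i. (if s i = 0 then 0 else 1) :: real)"
      by auto
    finally have PP: "P * P = P" by (simp add: P_def)
    have PN: "inner N (P * N) = (norm (P * N))\<^sup>2"
      using arg_cong[OF PP, of "\<lambda>X. X * N"]
      by (simp add: power2_norm_eq_inner inner_times_left Padj mult.assoc)
    have "(norm (P * N))\<^sup>2 \<le> norm N * norm (P * N)"
      unfolding PN[symmetric] by (rule norm_cauchy_schwarz)
    then have le: "norm (P * N) \<le> norm N"
      using norm_ge_zero[of N] by (cases "norm (P * N) = 0") (auto simp: power2_eq_square)
    have "(norm (adj T * N))\<^sup>2 = inner N (T * adj T * N)"
      by (simp add: power2_norm_eq_inner inner_times_left mult.assoc)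
    also have "\<dots> = (norm (P * N))\<^sup>2" by (simp add: TT PN)
    finally show "norm (adj T * N) \<le> norm N" using le by (simp add: power2_eq_iff_nonneg)
  qed
  then have "contraction T" using contraction_adj[of "adj T"] by simp
  moreover have "supported d L" "supported d R" "supported d T"
    by (simp_all add: L_def R_def T_def sM sQ sD)
  ultimately show ?thesis using that LR nL nR trT unfolding M_def by blast
qed

lemma schatten1_norm_eq_trnorm:
  assumes "A \<in> carrier_mat d d"
  shows "schatten1_norm A = trnorm (of_mat A)"
proof -
  obtain L R T where *: "contraction T" "of_mat A = L * R" "(norm L)\<^sup>2 = schatten1_norm A"
    "(norm R)\<^sup>2 = schatten1_norm A" "Re (tr (T * of_mat A)) = schatten1_norm A"
    using trnorm_of_mat[OF assms] by metis
  from *(3,4) have "norm L = norm R" by (metis norm_ge_zero power2_eq_iff_nonneg)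
  then have "norm L * norm R = schatten1_norm A" using *(4) by (simp add: power2_eq_square)
  then show ?thesis using trnorm_eqI[of T L R] * by simp
qed

lemma supported_eq_of_mat:
  "supported d M \<Longrightarrow> M = of_mat (mat d d (\<lambda>(i, j). entry M i j))"
  by (rule fmat_eqI) (auto simp: entry_of_mat supportedD)

lemma trnorm_attained:
  assumes "supported d M"
  obtains L R T where "supported d L" "supported d R" "supported d T" "contraction T"
    "M = L * R" "(norm L)\<^sup>2 = trnorm M" "(norm R)\<^sup>2 = trnorm M" "Re (tr (T * M)) = trnorm M"
proof -
  have "mat d d (\<lambda>(i, j). entry M i j) \<in> carrier_mat d d" by simp
  from trnorm_of_mat[OF this] schatten1_norm_eq_trnorm[OF this] show ?thesis
    using that unfolding supported_eq_of_mat[OF assms, symmetric] by metis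
qed

lemma trnorm_factor:
  obtains L R where "M = L * R" "(norm L)\<^sup>2 = trnorm M" "(norm R)\<^sup>2 = trnorm M"
proof -
  obtain d where "supported d M" using supported_ex by blast
  then show ?thesis using that trnorm_attained by metis
qed

lemma trnorm_dual:
  assumes "supported d M"
  obtains T where "supported d T" "contraction T" "Re (tr (T * M)) = trnorm M"
  using trnorm_attained[OF assms] by metis

lemma trnorm_nonneg [simp]: "0 \<le> trnorm M"
  using trnorm_factor[of M] by (metis zero_le_power2)

lemma re_tr_contraction_le: "contraction T \<Longrightarrow> Re (tr (T * M)) \<le> trnorm M"
proof -
  assume T: "contraction T"
  obtain L R where *: "M = L * R" "(norm L)\<^sup>2 = trnorm M" "(norm R)\<^sup>2 = trnorm M"
    by (rule trnorm_factor)
  then have "norm L = norm R" by (metis norm_ge_zero power2_eq_iff_nonneg)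
  then show ?thesis using re_tr_mult_le[OF T, of L R] * by (simp add: power2_eq_square)
qed

lemma re_tr_le_trnorm: "Re (tr M) \<le> trnorm M"
proof -
  obtain L R where *: "M = L * R" "(norm L)\<^sup>2 = trnorm M" "(norm R)\<^sup>2 = trnorm M"
    by (rule trnorm_factor)
  then have n: "norm L = norm R" by (metis norm_ge_zero power2_eq_iff_nonneg)
  have "Re (tr (L * R)) = inner (adj R) L" by (simp add: inner_fmat tr_commute[of R])
  also have "\<dots> \<le> norm (adj R) * norm L" by (rule norm_cauchy_schwarz)
  finally show ?thesis using * n by (simp add: power2_eq_square)
qed

lemma trnorm_le:
  assumes "\<And>T. contraction T \<Longrightarrow> Re (tr (T * M)) \<le> s"
  shows "trnorm M \<le> s"
proof -
  obtain d where "supported d M" using supported_ex by blast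
  then obtain T where "contraction T" "Re (tr (T * M)) = trnorm M" by (rule trnorm_dual)
  then show ?thesis using assms by metis
qed

lemma trnorm_times_le: "trnorm (L * R) \<le> norm L * norm R"
  by (rule trnorm_le) (rule re_tr_mult_le)

lemma trnorm_triangle: "trnorm (M + N) \<le> trnorm M + trnorm N"
proof (rule trnorm_le)
  fix T assume "contraction T"
  from re_tr_contraction_le[OF this, of M] re_tr_contraction_le[OF this, of N]
  show "Re (tr (T * (M + N))) \<le> trnorm M + trnorm N" by (simp add: distrib_left)
qed

lemma trnorm_uminus [simp]: "trnorm (- M) = trnorm M"
proof -
  have "trnorm (- M) \<le> trnorm M" for M
    by (rule trnorm_le) (use re_tr_contraction_le[OF contraction_uminus, of _ M] in simp)
  from this[of M] this[of "- M"] show ?thesis by simp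
qed

lemma trnorm_zero [simp]: "trnorm 0 = 0"
  using trnorm_times_le[of 0 0] trnorm_nonneg[of 0] by simp

lemma trnorm_minus_commute: "trnorm (M - N) = trnorm (N - M)"
  using trnorm_uminus[of "M - N"] by simp

lemma trnorm_triangle_minus: "trnorm (A - C) \<le> trnorm (A - B) + trnorm (B - C)"
  using trnorm_triangle[of "A - B" "B - C"] by simp

lemma trnorm_scaleR_le: "0 \<le> r \<Longrightarrow> trnorm (r *\<^sub>R M) \<le> r * trnorm M"
  by (rule trnorm_le) (simp add: mult_left_mono re_tr_contraction_le)

lemma trnorm_scaleR: 
  assumes "0 \<le> r" 
  shows "trnorm (r *\<^sub>R M) = r * trnorm M"
proof (cases "r = 0")
  case False
  then have "trnorm M \<le> inverse r * trnorm (r *\<^sub>R M)"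
    using trnorm_scaleR_le[of "inverse r" "r *\<^sub>R M"] assms by simp
  then have "r * trnorm M \<le> trnorm (r *\<^sub>R M)" using False assms by (simp add: field_simps)
  then show ?thesis using trnorm_scaleR_le[OF assms, of M] by simp
qed (use trnorm_scaleR_le[of 0 M] trnorm_nonneg[of 0] in simp)

lemma trnorm_contraction_left: "contraction T \<Longrightarrow> trnorm (T * M) \<le> trnorm M"
  by (rule trnorm_le) (simp add: re_tr_contraction_le contraction_mult flip: mult.assoc)

lemma trnorm_contraction_right: "contraction T \<Longrightarrow> trnorm (M * T) \<le> trnorm M"
proof (rule trnorm_le)
  fix S assume "contraction T" "contraction S"
  then show "Re (tr (S * (M * T))) \<le> trnorm M"
    using re_tr_contraction_le[of "T * S" M] contraction_mult[of T S]
    by (simp add: tr_commute[of "S * M"] mult.assoc flip: mult.assoc)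
qed

lemma trnorm_adj [simp]: "trnorm (adj M) = trnorm M"
proof -
  have "trnorm (adj M) \<le> trnorm M" for M
  proof (rule trnorm_le)
    fix T assume "contraction T"
    then have "Re (tr (adj T * M)) \<le> trnorm M" by (intro re_tr_contraction_le contraction_adj)
    moreover have "tr (T * adj M) = cnj (tr (adj T * M))"
      by (subst tr_adj[symmetric]) (simp add: tr_commute[of T])
    ultimately show "Re (tr (T * adj M)) \<le> trnorm M" by simp
  qed
  from this[of M] this[of "adj M"] show ?thesis by simp
qed

section \<open>Rigidity of the trace norm\<close>

text \<open>Near-equality in Cauchy-Schwarz. The first two of the square roots lost below come from
  here; the third comes also from the scaled variant \<open>close\<close> inside
  \<open>anticommutator_small\<close>.\<close>

lemma norm_diff_le_sqrt:
  fixes X Y :: "'a::real_inner"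
  assumes "norm X \<le> 1" "norm Y \<le> 1" "inner X Y \<ge> 1 - e"
  shows "norm (X - Y) \<le> sqrt (2 * e)"
proof (rule real_le_rsqrt)
  have "(norm X)\<^sup>2 \<le> 1" "(norm Y)\<^sup>2 \<le> 1" using assms(1,2) by (simp_all add: power_le_one)
  moreover have "(norm (X - Y))\<^sup>2 = (norm X)\<^sup>2 + (norm Y)\<^sup>2 - 2 * inner X Y"
    by (simp add: power2_norm_eq_inner inner_diff_left inner_diff_right inner_commute)
  ultimately show "(norm (X - Y))\<^sup>2 \<le> 2 * e" using assms(3) by simp
qed

lemma trnorm_unit_factor:
  assumes "trnorm M \<le> 1"
  obtains L R where "M = L * R" "norm L \<le> 1" "norm R \<le> 1"
proof -
  obtain L R where "M = L * R" "(norm L)\<^sup>2 = trnorm M" "(norm R)\<^sup>2 = trnorm M"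
    by (rule trnorm_factor)
  then show ?thesis using that assms power_le_one_iff[of "norm L" 2] power_le_one_iff[of "norm R" 2] by simp
qed

lemma inner_adj_factor: "inner (adj R) (T * L) = Re (tr (T * (L * R)))"
  by (simp add: inner_fmat tr_commute[of R] mult.assoc)

lemma inner_adj_factor_right: "inner (adj L) (R * T) = Re (tr (T * (L * R)))"
  by (simp add: inner_fmat tr_commute[of T] mult.assoc)

lemma trnorm_times_left_le: "norm R \<le> 1 \<Longrightarrow> trnorm (X * R) \<le> norm X"
  using trnorm_times_le[of X R] mult_left_mono[of "norm R" 1 "norm X"] by simp

lemma trnorm_times_right_le: "norm L \<le> 1 \<Longrightarrow> trnorm (L * X) \<le> norm X"
  using trnorm_times_le[of L X] mult_right_mono[of "norm L" 1 "norm X"] by simp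

text \<open>
  For a factorization \<open>M = L * R\<close> with \<open>norm L, norm R \<le> 1\<close>, the trace \<open>tr (T * M)\<close> is an inner product of
  \<open>adj R\<close> and \<open>T * L\<close>; if it is close to \<open>1\<close>, the two are close to each other.
\<close>

lemma trnorm_dual_almost_isometric:
  assumes M: "trnorm M \<le> 1" and T: "contraction T" and tr: "Re (tr (T * M)) \<ge> 1 - e"
  shows "trnorm (adj T * (T * M) - M) \<le> 2 * sqrt (2 * e)"
    and "trnorm (T * M - adj (T * M)) \<le> 2 * sqrt (2 * e)"
proof -
  obtain L R where LR: "M = L * R" and L: "norm L \<le> 1" and R: "norm R \<le> 1"
    using trnorm_unit_factor[OF M] by blast
  have TL: "norm (adj R - T * L) \<le> sqrt (2 * e)"
    using tr L R order_trans[OF contraction_times_le[OF T] L]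
    by (intro norm_diff_le_sqrt) (auto simp: inner_adj_factor LR)
  have RT: "norm (adj L - R * T) \<le> sqrt (2 * e)"
    using tr L R order_trans[OF contraction_times_right_le[OF T] R]
    by (intro norm_diff_le_sqrt) (auto simp: inner_adj_factor_right LR)
  have RT': "norm (L - adj T * adj R) \<le> sqrt (2 * e)"
    using RT norm_adj[of "adj L - R * T"] by simp
  have "trnorm (adj T * (T * M) - M) = trnorm ((adj T * (adj R - T * L) + (L - adj T * adj R)) * R)"
    using trnorm_uminus[of "adj T * (T * M) - M"] by (simp add: LR algebra_simps)
  also have "\<dots> \<le> norm (adj T * (adj R - T * L) + (L - adj T * adj R))"
    by (rule trnorm_times_left_le[OF R])
  also have "\<dots> \<le> norm (adj T * (adj R - T * L)) + norm (L - adj T * adj R)"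
    by (rule norm_triangle_ineq)
  also have "\<dots> \<le> sqrt (2 * e) + sqrt (2 * e)"
    using order_trans[OF contraction_times_le[OF contraction_adj[OF T]] TL] RT' by (rule add_mono)
  finally show "trnorm (adj T * (T * M) - M) \<le> 2 * sqrt (2 * e)" by simp
  \<comment> \<open>\<open>adj R * R\<close> is Hermitian, so a matrix close to it is close to its
    own adjoint.\<close>
  have P: "trnorm (adj R * R - T * M) \<le> sqrt (2 * e)"
    using order_trans[OF trnorm_times_left_le[OF R] TL] by (simp add: LR algebra_simps)
  have "trnorm (T * M - adj (T * M)) \<le> trnorm (T * M - adj R * R) + trnorm (adj R * R - adj (T * M))"
    by (rule trnorm_triangle_minus)
  also have "trnorm (T * M - adj R * R) \<le> sqrt (2 * e)"
    using P by (simp add: trnorm_minus_commute)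
  also have "trnorm (adj R * R - adj (T * M)) \<le> sqrt (2 * e)"
    using P trnorm_adj[of "adj R * R - T * M"] by simp
  finally show "trnorm (T * M - adj (T * M)) \<le> 2 * sqrt (2 * e)" by simp
qed

text \<open>The bound on \<open>tr M\<close> makes \<open>M\<close> almost positive, in the sense
  that \<open>adj R\<close> is close to \<open>L\<close>. Since \<open>T * L\<close> is close to
  \<open>adj R\<close> as well, \<open>T\<close> acts on \<open>M\<close> almost as the identity,
  from either side.\<close>

lemma trnorm_align:
  assumes M: "trnorm M \<le> 1" and tr1: "Re (tr M) \<ge> 1 - e"
    and T: "contraction T" and tr: "Re (tr (T * M)) \<ge> 1 - e"
  shows "trnorm (T * M - M) \<le> 2 * sqrt (2 * e)" and "trnorm (M * T - M) \<le> 2 * sqrt (2 * e)"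
proof -
  obtain L R where LR: "M = L * R" and L: "norm L \<le> 1" and R: "norm R \<le> 1"
    using trnorm_unit_factor[OF M] by blast
  have TL: "norm (T * L - adj R) \<le> sqrt (2 * e)"
    using tr L R order_trans[OF contraction_times_le[OF T] L]
    by (intro norm_diff_le_sqrt) (auto simp: inner_adj_factor LR inner_commute[of _ "adj R"])
  have RT: "norm (R * T - adj L) \<le> sqrt (2 * e)"
    using tr L R order_trans[OF contraction_times_right_le[OF T] R]
    by (intro norm_diff_le_sqrt) (auto simp: inner_adj_factor_right LR inner_commute[of _ "adj L"])
  have RL: "norm (adj R - L) \<le> sqrt (2 * e)"
    using tr1 L R by (intro norm_diff_le_sqrt) (auto simp: inner_fmat LR tr_commute[of R])
  have LR': "norm (adj L - R) \<le> sqrt (2 * e)"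
    using RL norm_adj[of "adj R - L"] by (simp add: norm_minus_commute)
  have "trnorm (T * M - M) = trnorm (((T * L - adj R) + (adj R - L)) * R)"
    by (simp add: LR algebra_simps)
  also have "\<dots> \<le> norm ((T * L - adj R) + (adj R - L))"
    by (rule trnorm_times_left_le[OF R])
  also have "\<dots> \<le> norm (T * L - adj R) + norm (adj R - L)"
    by (rule norm_triangle_ineq)
  finally show "trnorm (T * M - M) \<le> 2 * sqrt (2 * e)" using TL RL by simp
  have "trnorm (M * T - M) = trnorm (L * ((R * T - adj L) + (adj L - R)))"
    by (simp add: LR algebra_simps)
  also have "\<dots> \<le> norm ((R * T - adj L) + (adj L - R))"
    by (rule trnorm_times_right_le[OF L])
  also have "\<dots> \<le> norm (R * T - adj L) + norm (adj L - R)"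
    by (rule norm_triangle_ineq)
  finally show "trnorm (M * T - M) \<le> 2 * sqrt (2 * e)" using RT LR' by simp
qed

text \<open>With \<open>a = p + M\<close>, the observable \<open>V\<close> acts almost as 1 on
  \<open>p\<close> and almost as -1 on \<open>M\<close>, so \<open>V * a\<close> is close to
  \<open>p - M\<close>, which is \<open>2 *\<^sub>R p - a\<close>.\<close>

lemma half_observable:
  assumes e: "0 \<le> e"
    and le1: "trnorm p \<le> 1" "trnorm q \<le> 1" "trnorm (a - p) \<le> 1" "trnorm (a - q) \<le> 1"
    and tra: "Re (tr a) \<ge> 2 - e"
    and V: "contraction V" and Vp: "Re (tr (V * p)) \<ge> 1 - e" and Vq: "Re (tr (V * q)) \<le> - (1 - e)"
  shows "trnorm (V * a - (2 *\<^sub>R p - a)) \<le> 8 * sqrt e"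
    and "trnorm (a * V - (2 *\<^sub>R p - a)) \<le> 8 * sqrt e"
    and "trnorm (V * (V * a) - a) \<le> 16 * sqrt e"
proof -
  define M where "M = a - p"
  have a: "a = p + M" by (simp add: M_def)
  have "sqrt (4 * e) = sqrt (2\<^sup>2 * e)" by simp
  then have sq4: "sqrt (4 * e) = 2 * sqrt e" by (simp add: real_sqrt_mult)
  have sq2: "2 * sqrt (2 * e) \<le> 4 * sqrt e" using e sq4 real_sqrt_le_mono[of "2 * e" "4 * e"] by simp
  \<comment> \<open>The second point enters here: \<open>tr (V * q)\<close> is near -1 and
    \<open>a - q\<close> has norm at most 1, so \<open>tr (V * a)\<close> stays below
    \<open>e\<close>; this pushes \<open>tr (V * M)\<close> towards -1.\<close>
  have "Re (tr (V * a)) \<le> e"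
    using Vq order_trans[OF re_tr_contraction_le[OF V, of "a - q"] le1(4)] by (simp add: right_diff_distrib)
  then have VM: "Re (tr (- V * M)) \<ge> 1 - 2 * e" using Vp by (simp add: M_def right_diff_distrib)
  have trp: "Re (tr p) \<ge> 1 - e" using tra order_trans[OF re_tr_le_trnorm[of "a - p"] le1(3)] by simp
  have trM: "Re (tr M) \<ge> 1 - 2 * e" using tra order_trans[OF re_tr_le_trnorm[of p] le1(1)] e by (simp add: M_def)
  note Mal = trnorm_align[OF le1(3)[folded M_def] trM contraction_uminus[OF V] VM]
  note pal = trnorm_align[OF le1(1) trp V Vp]
  have M1: "trnorm (V * M + M) \<le> 4 * sqrt e"
    using Mal(1) sq4 trnorm_uminus[of "V * M + M"] by (simp add: mult.commute[of e] del: trnorm_uminus)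
  have M2: "trnorm (M * V + M) \<le> 4 * sqrt e"
    using Mal(2) sq4 trnorm_uminus[of "M * V + M"] by (simp add: mult.commute[of e] del: trnorm_uminus)
  have p1: "trnorm (V * p - p) \<le> 4 * sqrt e" and p2: "trnorm (p * V - p) \<le> 4 * sqrt e"
    using pal sq2 by linarith+
  have eq: "2 *\<^sub>R p - a = p - M" by (simp add: M_def scaleR_2)
  have "V * a - (2 *\<^sub>R p - a) = (V * p - p) + (V * M + M)"
    unfolding eq by (simp add: a distrib_left)
  then show 1: "trnorm (V * a - (2 *\<^sub>R p - a)) \<le> 8 * sqrt e"
    using trnorm_triangle[of "V * p - p" "V * M + M"] M1 p1 by simp
  have "a * V - (2 *\<^sub>R p - a) = (p * V - p) + (M * V + M)"
    unfolding eq by (simp add: a distrib_right)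
  then show "trnorm (a * V - (2 *\<^sub>R p - a)) \<le> 8 * sqrt e"
    using trnorm_triangle[of "p * V - p" "M * V + M"] M2 p2 by simp
  have "V * (V * a) - a = V * (V * a - (2 *\<^sub>R p - a)) + ((V * p - p) - (V * M + M))"
    unfolding eq by (simp add: a algebra_simps)
  then have "trnorm (V * (V * a) - a) \<le> trnorm (V * (V * a - (2 *\<^sub>R p - a))) + trnorm ((V * p - p) - (V * M + M))"
    by (metis trnorm_triangle)
  also have "trnorm (V * (V * a - (2 *\<^sub>R p - a))) \<le> 8 * sqrt e"
    by (rule order_trans[OF trnorm_contraction_left[OF V] 1])
  also have "trnorm ((V * p - p) - (V * M + M)) \<le> 8 * sqrt e"
    using trnorm_triangle[of "V * p - p" "- (V * M + M)"] M1 p1 trnorm_uminus[of "V * M + M"] by (simp del: minus_add_distrib trnorm_uminus)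
  finally show "trnorm (V * (V * a) - a) \<le> 16 * sqrt e" by simp
qed

lemma hermitian_dual:
  assumes "supported d M" "adj M = M"
  obtains V where "supported d V" "contraction V" "adj V = V" "Re (tr (V * M)) = trnorm M"
proof -
  obtain T where T: "supported d T" "contraction T" "Re (tr (T * M)) = trnorm M"
    using trnorm_dual[OF assms(1)] by blast
  let ?V = "(1 / 2) *\<^sub>R (T + adj T)"
  have "tr (adj T * M) = cnj (tr (T * M))"
    by (subst tr_adj[symmetric]) (simp add: assms(2) tr_commute[of _ M])
  then have "Re (tr (?V * M)) = trnorm M" using T(3) by (simp add: distrib_right del: scaleR_add_right)
  moreover have "adj ?V = ?V" by (simp add: add.commute)
  ultimately show ?thesis
    using that[of ?V] T contraction_average[OF T(2) contraction_adj[OF T(2)]] by blast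
qed

text \<open>\<open>V\<close> is a Hermitian dual witness for \<open>trnorm (p - q)\<close>. As that
  distance is almost 2 and both points have norm at most 1, its trace pairing is almost 1 with
  \<open>p\<close> and almost -1 with \<open>q\<close>.\<close>

lemma pair_observable:
  assumes e: "0 \<le> e"
    and sup: "supported d p" "supported d q" and herm: "adj p = p" "adj q = q"
    and le1: "trnorm p \<le> 1" "trnorm q \<le> 1" "trnorm (a - p) \<le> 1" "trnorm (a - q) \<le> 1"
    and tra: "Re (tr a) \<ge> 2 - e" and pq: "trnorm (p - q) \<ge> 2 - e"
  obtains V where "supported d V" "contraction V" "adj V = V"
    "trnorm (V * a - (2 *\<^sub>R p - a)) \<le> 8 * sqrt e"
    "trnorm (V * a - (a - 2 *\<^sub>R q)) \<le> 8 * sqrt e"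
    "trnorm (V * a - a * V) \<le> 16 * sqrt e"
    "trnorm (V * (V * a) - a) \<le> 16 * sqrt e"
proof -
  obtain V where V: "supported d V" "contraction V" "adj V = V" "Re (tr (V * (p - q))) = trnorm (p - q)"
    using hermitian_dual[of d "p - q"] sup herm by auto
  have V1: "Re (tr (V * p)) \<le> 1" "- Re (tr (V * q)) \<le> 1"
    using order_trans[OF re_tr_contraction_le[OF V(2)] le1(1)]
      order_trans[OF re_tr_contraction_le[OF contraction_uminus[OF V(2)]] le1(2)] by simp_all
  then have Vp: "Re (tr (V * p)) \<ge> 1 - e" and Vq: "Re (tr (V * q)) \<le> - (1 - e)"
    using V(4) pq by (simp_all add: right_diff_distrib)
  note h1 = half_observable[OF e le1 tra V(2) Vp Vq]
  \<comment> \<open>Exchanging \<open>p\<close> with \<open>q\<close> and \<open>V\<close> with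
    \<open>- V\<close> preserves the hypotheses and yields the estimate in terms of
    \<open>q\<close>.\<close>
  have "Re (tr (- V * q)) \<ge> 1 - e" "Re (tr (- V * p)) \<le> - (1 - e)" using Vp Vq by simp_all
  note h2 = half_observable[OF e le1(2,1,4,3) tra contraction_uminus[OF V(2)] this]
  have "trnorm (V * a - (a - 2 *\<^sub>R q)) \<le> 8 * sqrt e"
    using h2(1) trnorm_uminus[of "V * a - (a - 2 *\<^sub>R q)"] by (simp add: algebra_simps)
  moreover have "trnorm (V * a - a * V) \<le> 16 * sqrt e"
    using trnorm_triangle_minus[of "V * a" "a * V" "2 *\<^sub>R p - a"] h1(1,2)
    by (simp add: trnorm_minus_commute[of "2 *\<^sub>R p - a"])
  ultimately show ?thesis using that[OF V(1-3) h1(1)] h1(3) by blast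
qed

section \<open>Anticommutation from distances close to the square root of 2\<close>

lemma sqrt_2_le: "sqrt 2 \<le> 3 / 2"
  by (rule real_le_lsqrt) (simp_all add: power2_eq_square)

text \<open>For \<open>G = V + W\<close> the parallelogram identity bounds the Hilbert-Schmidt norm
  of \<open>G * L\<close> by about sqrt 2, while \<open>sep\<close> bounds the trace norm of
  \<open>G * \<rho>\<close> from below by about the same number. An L^1 norm that large against such
  an L^2 norm leaves no room for |G| to vary, so \<open>G * (G * \<rho>)\<close> is close to
  \<open>2 *\<^sub>R \<rho>\<close>. Expanding the square leaves the anticommutator.\<close>

lemma anticommutator_small:
  fixes V W :: fmat
  assumes rho: "trnorm \<rho> \<le> 1" "Re (tr \<rho>) \<ge> 1 - \<mu>"
    and V: "contraction V" "adj V = V" and W: "contraction W" "adj W = W"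
    and comm: "trnorm (V * \<rho> - \<rho> * V) \<le> \<mu>" "trnorm (W * \<rho> - \<rho> * W) \<le> \<mu>"
    and sq: "trnorm (V * (V * \<rho>) - \<rho>) \<le> \<mu>" "trnorm (W * (W * \<rho>) - \<rho>) \<le> \<mu>"
    and sep: "trnorm ((V + W) * \<rho>) \<ge> sqrt 2 - \<mu>" "trnorm ((V - W) * \<rho>) \<ge> sqrt 2 - \<mu>"
    and herm: "adj \<rho> = \<rho>" and mu: "\<mu> \<le> 1"
  shows "trnorm ((V * W + W * V) * \<rho>) \<le> 27 * sqrt \<mu>"
proof -
  have mu0: "0 \<le> \<mu>" using comm(1) trnorm_nonneg order_trans by blast
  have mu_le: "\<mu> \<le> sqrt \<mu>" using mu mu0 by (intro real_le_rsqrt) (simp add: power2_eq_square mult_left_le)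
  obtain L R where LR: "\<rho> = L * R" and L: "norm L \<le> 1" and R: "norm R \<le> 1"
    using trnorm_unit_factor[OF rho(1)] by blast
  have RL: "norm (adj R - L) \<le> sqrt (2 * \<mu>)"
    using rho(2) L R by (intro norm_diff_le_sqrt) (auto simp: inner_fmat LR tr_commute[of R])
  define G where "G = V + W"
  have energy: "norm (X * L) \<ge> sqrt 2 - \<mu>" if "trnorm (X * \<rho>) \<ge> sqrt 2 - \<mu>" for X
    using that trnorm_times_left_le[OF R, of "X * L"] by (simp add: LR mult.assoc)
  have GL: "(norm (G * L))\<^sup>2 \<le> 2 + 3 * \<mu>"
  proof -
    have "(norm ((V + W) * L))\<^sup>2 + (norm ((V - W) * L))\<^sup>2 = 2 * (norm (V * L))\<^sup>2 + 2 * (norm (W * L))\<^sup>2"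
      by (simp add: power2_norm_eq_inner algebra_simps inner_diff_left inner_diff_right
          inner_add_left inner_add_right inner_commute)
    also have "\<dots> \<le> 2 * 1 + 2 * 1"
      using order_trans[OF contraction_times_le[OF V(1)] L] order_trans[OF contraction_times_le[OF W(1)] L]
      by (intro add_mono mult_left_mono) (simp_all add: power_le_one)
    finally have 1: "(norm ((V + W) * L))\<^sup>2 + (norm ((V - W) * L))\<^sup>2 \<le> 4" by simp
    \<comment> \<open>The difference uses up about half of the total 4 and leaves only about 2 for
      the sum.\<close>
    have "(sqrt 2 - \<mu>)\<^sup>2 \<le> (norm ((V - W) * L))\<^sup>2"
      using energy[OF sep(2)] order_trans[OF mu, of "sqrt 2"] by (intro power_mono) auto
    moreover have "(sqrt 2 - \<mu>)\<^sup>2 \<ge> 2 - 3 * \<mu>"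
    proof -
      have "(sqrt 2 - \<mu>)\<^sup>2 = 2 - 2 * sqrt 2 * \<mu> + \<mu>\<^sup>2" by (simp add: power2_diff)
      moreover have "2 * sqrt 2 * \<mu> \<le> 3 * \<mu>" using sqrt_2_le mu0 by (intro mult_right_mono) auto
      moreover have "0 \<le> \<mu>\<^sup>2" by simp
      ultimately show ?thesis by linarith
    qed
    ultimately show ?thesis using 1 unfolding G_def by linarith
  qed
  have commG: "trnorm (G * \<rho> - \<rho> * G) \<le> 2 * \<mu>"
    using trnorm_triangle[of "V * \<rho> - \<rho> * V" "W * \<rho> - \<rho> * W"] comm by (simp add: G_def algebra_simps)
  obtain d where "supported d (G * \<rho>)" using supported_ex by blast
  then obtain T where T: "contraction T" "Re (tr (T * (G * \<rho>))) = trnorm (G * \<rho>)" by (rule trnorm_dual)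
  define S where "S = (1 / 2) *\<^sub>R (T + adj T)"
  have S: "contraction S" unfolding S_def by (rule contraction_average[OF T(1) contraction_adj[OF T(1)]])
  have S_adj: "adj S = S" by (simp add: S_def add.commute)
  have adjG: "adj G = G" by (simp add: G_def V W)
  \<comment> \<open>The witness \<open>T\<close> loses \<open>\<mu>\<close>; its adjoint loses
    \<open>3 * \<mu>\<close>, since \<open>G\<close> has to be commuted past \<open>\<rho>\<close>
    first. The average loses \<open>2 * \<mu>\<close>.\<close>
  have trS: "Re (tr (S * (G * \<rho>))) \<ge> sqrt 2 - 2 * \<mu>"
  proof -
    have "tr (adj T * (G * \<rho>)) = cnj (tr (T * (\<rho> * G)))"
      by (subst tr_adj[symmetric]) (simp add: adjG herm tr_commute[of "adj T"])
    then have "Re (tr (adj T * (G * \<rho>))) = Re (tr (T * (G * \<rho>))) - Re (tr (T * (G * \<rho> - \<rho> * G)))"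
      by (simp add: right_diff_distrib)
    moreover have "Re (tr (T * (G * \<rho> - \<rho> * G))) \<le> 2 * \<mu>"
      by (rule order_trans[OF re_tr_contraction_le[OF T(1)] commG])
    ultimately have "Re (tr (adj T * (G * \<rho>))) \<ge> sqrt 2 - 3 * \<mu>" "Re (tr (T * (G * \<rho>))) \<ge> sqrt 2 - \<mu>"
      using T(2) sep(1) by (simp_all add: G_def)
    then show ?thesis by (simp add: S_def distrib_right)
  qed
  then have inSGL: "inner (adj R) (S * (G * L)) \<ge> sqrt 2 - 2 * \<mu>"
    by (simp add: inner_adj_factor LR mult.assoc)
  have sqrt9: "sqrt (9 * \<mu>) = 3 * sqrt \<mu>"
  proof -
    have "sqrt (9 * \<mu>) = sqrt (3\<^sup>2 * \<mu>)" by simp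
    then show ?thesis by (simp add: real_sqrt_mult)
  qed
  \<comment> \<open>Near-equality in Cauchy-Schwarz for vectors of lengths about sqrt 2 and 1. The 9
    under the root is 3 + 4 * 3/2, where 3/2 bounds sqrt 2.\<close>
  have close: "norm (X - sqrt 2 *\<^sub>R Y) \<le> 3 * sqrt \<mu>"
    if "(norm X)\<^sup>2 \<le> 2 + 3 * \<mu>" "norm Y \<le> 1" "inner X Y \<ge> sqrt 2 - 2 * \<mu>" for X Y :: fmat
  proof -
    have "(norm (X - sqrt 2 *\<^sub>R Y))\<^sup>2 = (norm X)\<^sup>2 + 2 * (norm Y)\<^sup>2 - 2 * sqrt 2 * inner X Y"
      by (simp add: power2_norm_eq_inner algebra_simps inner_diff_left inner_diff_right inner_commute)
    also have "\<dots> \<le> (2 + 3 * \<mu>) + 2 * 1 - 2 * sqrt 2 * (sqrt 2 - 2 * \<mu>)"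
      using that by (intro diff_mono add_mono mult_left_mono) (simp_all add: power_le_one)
    also have "\<dots> = 3 * \<mu> + 4 * (sqrt 2 * \<mu>)" by (simp add: algebra_simps)
    also have "\<dots> \<le> 3 * \<mu> + 4 * (3 / 2 * \<mu>)" using mult_right_mono[OF sqrt_2_le mu0] by (intro add_left_mono mult_left_mono) auto
    finally have "(norm (X - sqrt 2 *\<^sub>R Y))\<^sup>2 \<le> 9 * \<mu>" by simp
    then show ?thesis using real_le_rsqrt sqrt9 by fastforce
  qed
  have c1: "norm (G * L - sqrt 2 *\<^sub>R (S * adj R)) \<le> 3 * sqrt \<mu>"
    using order_trans[OF contraction_times_le[OF S], of "adj R" 1] R inSGL GL
    by (intro close) (simp_all add: inner_commute[of "G * L"] inner_times_left[of S] S_adj)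
  have c2: "norm (S * (G * L) - sqrt 2 *\<^sub>R adj R) \<le> 3 * sqrt \<mu>"
  proof (rule close)
    show "(norm (S * (G * L)))\<^sup>2 \<le> 2 + 3 * \<mu>"
      by (rule order_trans[OF power_mono[OF contraction_times_le[OF S]] GL]) simp
  qed (use R inSGL in \<open>simp_all add: inner_commute[of _ "adj R"]\<close>)
  have RL2: "trnorm (sqrt 2 *\<^sub>R ((adj R - L) * R)) \<le> 2 * sqrt \<mu>"
  proof -
    have "trnorm (sqrt 2 *\<^sub>R ((adj R - L) * R)) = sqrt 2 * trnorm ((adj R - L) * R)"
      by (rule trnorm_scaleR) simp
    also have "\<dots> \<le> sqrt 2 * sqrt (2 * \<mu>)"
      by (intro mult_left_mono order_trans[OF trnorm_times_left_le[OF R] RL]) simp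
    also have "\<dots> = (sqrt 2 * sqrt 2) * sqrt \<mu>" by (simp only: real_sqrt_mult mult.assoc)
    finally show ?thesis by simp
  qed
  have g1: "trnorm (G * \<rho> - sqrt 2 *\<^sub>R (S * \<rho>)) \<le> 5 * sqrt \<mu>"
  proof -
    have "G * \<rho> - sqrt 2 *\<^sub>R (S * \<rho>) =
        (G * L - sqrt 2 *\<^sub>R (S * adj R)) * R + S * (sqrt 2 *\<^sub>R ((adj R - L) * R))"
      by (simp add: LR algebra_simps)
    then have "trnorm (G * \<rho> - sqrt 2 *\<^sub>R (S * \<rho>)) \<le>
        trnorm ((G * L - sqrt 2 *\<^sub>R (S * adj R)) * R) + trnorm (S * (sqrt 2 *\<^sub>R ((adj R - L) * R)))"
      by (metis trnorm_triangle)
    then show ?thesis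
      using order_trans[OF trnorm_times_left_le[OF R] c1]
        order_trans[OF trnorm_contraction_left[OF S] RL2] by linarith
  qed
  have g2: "trnorm (S * (G * \<rho>) - sqrt 2 *\<^sub>R \<rho>) \<le> 5 * sqrt \<mu>"
  proof -
    have "S * (G * \<rho>) - sqrt 2 *\<^sub>R \<rho> =
        (S * (G * L) - sqrt 2 *\<^sub>R adj R) * R + sqrt 2 *\<^sub>R ((adj R - L) * R)"
      by (simp add: LR algebra_simps)
    then have "trnorm (S * (G * \<rho>) - sqrt 2 *\<^sub>R \<rho>) \<le>
        trnorm ((S * (G * L) - sqrt 2 *\<^sub>R adj R) * R) + trnorm (sqrt 2 *\<^sub>R ((adj R - L) * R))"
      by (metis trnorm_triangle)
    then show ?thesis using order_trans[OF trnorm_times_left_le[OF R] c2] RL2 by linarith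
  qed
  have G2l: "trnorm (G * X) \<le> 2 * trnorm X" for X
    using trnorm_triangle[of "V * X" "W * X"] trnorm_contraction_left[OF V(1), of X]
      trnorm_contraction_left[OF W(1), of X] by (simp add: G_def distrib_right)
  have G2r: "trnorm (X * G) \<le> 2 * trnorm X" for X
    using trnorm_triangle[of "X * V" "X * W"] trnorm_contraction_right[OF V(1), of X]
      trnorm_contraction_right[OF W(1), of X] by (simp add: G_def distrib_left)
  \<comment> \<open>The four terms telescope along \<open>G G \<rho>\<close>,
    \<open>G \<rho> G\<close>, \<open>sqrt 2 S \<rho> G\<close>, \<open>sqrt 2 S G \<rho>\<close>,
    \<open>2 \<rho>\<close>. Together with the two defects in \<open>sq\<close> they sum to at most
    26.5 times \<open>sqrt \<mu>\<close>, rounded up to 27.\<close>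
  let ?A = "G * (G * \<rho> - \<rho> * G)" and ?B = "(G * \<rho> - sqrt 2 *\<^sub>R (S * \<rho>)) * G"
    and ?C = "sqrt 2 *\<^sub>R (S * (\<rho> * G - G * \<rho>))" and ?D = "sqrt 2 *\<^sub>R (S * (G * \<rho>) - sqrt 2 *\<^sub>R \<rho>)"
  have A: "trnorm ?A \<le> 4 * \<mu>" using G2l[of "G * \<rho> - \<rho> * G"] commG by linarith
  have B: "trnorm ?B \<le> 10 * sqrt \<mu>" using G2r[of "G * \<rho> - sqrt 2 *\<^sub>R (S * \<rho>)"] g1 by linarith
  have C: "trnorm ?C \<le> 3 * \<mu>"
  proof -
    have "trnorm ?C = sqrt 2 * trnorm (S * (\<rho> * G - G * \<rho>))" by (rule trnorm_scaleR) simp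
    also have "\<dots> \<le> 3 / 2 * (2 * \<mu>)"
      using order_trans[OF trnorm_contraction_left[OF S], of "\<rho> * G - G * \<rho>" "2 * \<mu>"] commG sqrt_2_le
      by (intro mult_mono) (auto simp: trnorm_minus_commute)
    finally show ?thesis by simp
  qed
  have D: "trnorm ?D \<le> 15 / 2 * sqrt \<mu>"
  proof -
    have "trnorm ?D = sqrt 2 * trnorm (S * (G * \<rho>) - sqrt 2 *\<^sub>R \<rho>)" by (rule trnorm_scaleR) simp
    also have "\<dots> \<le> 3 / 2 * (5 * sqrt \<mu>)" using g2 sqrt_2_le by (intro mult_mono) auto
    finally show ?thesis by simp
  qed
  have "(V * W + W * V) * \<rho> = ?A + ?B + ?C + ?D - (V * (V * \<rho>) - \<rho>) - (W * (W * \<rho>) - \<rho>)"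
    by (simp add: G_def algebra_simps scaleR_2)
  then have "trnorm ((V * W + W * V) * \<rho>) \<le>
      trnorm ?A + trnorm ?B + trnorm ?C + trnorm ?D + trnorm (V * (V * \<rho>) - \<rho>) + trnorm (W * (W * \<rho>) - \<rho>)"
    using trnorm_triangle[of ?A ?B] trnorm_triangle[of "?A + ?B" ?C] trnorm_triangle[of "?A + ?B + ?C" ?D]
      trnorm_triangle[of "?A + ?B + ?C + ?D" "- (V * (V * \<rho>) - \<rho>)"]
      trnorm_triangle[of "?A + ?B + ?C + ?D - (V * (V * \<rho>) - \<rho>)" "- (W * (W * \<rho>) - \<rho>)"]
      trnorm_uminus[of "V * (V * \<rho>) - \<rho>"] trnorm_uminus[of "W * (W * \<rho>) - \<rho>"]
    by (simp del: trnorm_uminus minus_diff_eq)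
  then show ?thesis using A B C D sq mu_le real_sqrt_ge_zero[OF mu0] by linarith
qed

text \<open>The map \<open>h\<close> rotates \<open>a\<close> to an almost positive matrix and takes the Hermitian part.\<close>

lemma hermitian_points:
  assumes t: "0 \<le> t" and sup: "supported d a"
    and a: "trnorm a \<ge> 2 - 2 * t ^ 8"
    and X: "\<And>X. X \<in> \<X> \<Longrightarrow> trnorm X \<le> 1" "\<And>X. X \<in> \<X> \<Longrightarrow> trnorm (a - X) \<le> 1"
  obtains h where "\<And>M. supported d M \<Longrightarrow> supported d (h M)" "\<And>M. adj (h M) = h M"
    "\<And>M N. h (M - N) = h M - h N" "\<And>M. trnorm (h M) \<le> trnorm M"
    "Re (tr (h a)) \<ge> 2 - 2 * t ^ 8"
    "\<And>X Y. X \<in> \<X> \<Longrightarrow> Y \<in> \<X> \<Longrightarrow> trnorm (X - Y) \<le> trnorm (h X - h Y) + 12 * t ^ 4"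
proof -
  obtain U where U: "supported d U" "contraction U" "Re (tr (U * a)) = trnorm a"
    using trnorm_dual[OF sup] by blast
  define h where "h M = (1 / 2) *\<^sub>R (U * M + adj (U * M))" for M
  have h_le: "trnorm (h M) \<le> trnorm M" for M
  proof -
    have "trnorm (h M) = 1 / 2 * trnorm (U * M + adj (U * M))" unfolding h_def by (rule trnorm_scaleR) simp
    also have "\<dots> \<le> 1 / 2 * (trnorm (U * M) + trnorm (adj (U * M)))"
      by (intro mult_left_mono trnorm_triangle) simp
    also have "\<dots> \<le> trnorm M" using trnorm_contraction_left[OF U(2), of M] by (simp del: adj_times)
    finally show ?thesis .
  qed
  have h_minus: "h (M - N) = h M - h N" for M N
    by (simp add: h_def algebra_simps)
  \<comment> \<open>The defect in the distances is an eighth power so that the square root taken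
    here, and two more later, still give powers of \<open>t\<close>.\<close>
  have sq: "2 * sqrt (2 * (2 * t ^ 8)) = 4 * t ^ 4"
  proof -
    have "(2 * t ^ 4)\<^sup>2 = 2 * (2 * t ^ 8)" by (simp add: power_mult_distrib flip: power_mult)
    from real_sqrt_unique[OF this] show ?thesis using t by simp
  qed
  \<comment> \<open>The pairing of \<open>U\<close> with \<open>a = X + (a - X)\<close> is almost 2,
    and at most 1 with each summand; so it is almost 1 with \<open>X\<close>, and one rotation
    serves all points at once.\<close>
  have Xtr: "Re (tr (U * X)) \<ge> 1 - 2 * t ^ 8" if "X \<in> \<X>" for X
    using order_trans[OF re_tr_contraction_le[OF U(2)] X(2)[OF that]] a U(3) by (simp add: right_diff_distrib)
  have Xiso: "trnorm (X - adj U * (U * X)) \<le> 4 * t ^ 4" "trnorm (U * X - h X) \<le> 2 * t ^ 4" if "X \<in> \<X>" for X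
  proof -
    note * = trnorm_dual_almost_isometric[OF X(1)[OF that] U(2) Xtr[OF that], unfolded sq]
    show "trnorm (X - adj U * (U * X)) \<le> 4 * t ^ 4" using *(1) by (simp add: trnorm_minus_commute)
    have "U * X = (1 / 2) *\<^sub>R (U * X) + (1 / 2) *\<^sub>R (U * X)" by (simp flip: scaleR_add_left)
    then have "U * X - h X = (1 / 2) *\<^sub>R (U * X - adj (U * X))"
      unfolding h_def scaleR_add_right scaleR_diff_right by (metis add_diff_cancel_left)
    then have "trnorm (U * X - h X) = 1 / 2 * trnorm (U * X - adj (U * X))"
      using trnorm_scaleR[of "1 / 2"] by simp
    then show "trnorm (U * X - h X) \<le> 2 * t ^ 4" using *(2) by simp
  qed
  show ?thesis
  proof (rule that[of h])
    show "supported d (h M)" if "supported d M" for M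
      using that U(1) by (simp add: h_def del: adj_times scaleR_add_right)
    show "adj (h M) = h M" for M by (simp add: h_def add.commute)
    have "Re (tr (h a)) = Re (tr (U * a))" by (simp add: h_def del: adj_times scaleR_add_right)
    then show "Re (tr (h a)) \<ge> 2 - 2 * t ^ 8" using U(3) a by simp
    fix X Y assume XY: "X \<in> \<X>" "Y \<in> \<X>"
    \<comment> \<open>Of the 12, 8 come from undoing \<open>U\<close> on both points and 4 from
      replacing \<open>U * X\<close> and \<open>U * Y\<close> by their Hermitian parts.\<close>
    have "trnorm (X - Y) = trnorm ((X - adj U * (U * X)) - (Y - adj U * (U * Y)) + adj U * (U * X - U * Y))"
      by (simp add: algebra_simps)
    also have "\<dots> \<le> trnorm ((X - adj U * (U * X)) - (Y - adj U * (U * Y))) + trnorm (adj U * (U * X - U * Y))"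
      by (rule trnorm_triangle)
    also have "trnorm ((X - adj U * (U * X)) - (Y - adj U * (U * Y))) \<le> 4 * t ^ 4 + 4 * t ^ 4"
      using trnorm_triangle[of "X - adj U * (U * X)" "- (Y - adj U * (U * Y))"] Xiso(1)[OF XY(1)]
        Xiso(1)[OF XY(2)] trnorm_uminus[of "Y - adj U * (U * Y)"]
      by (simp del: trnorm_uminus minus_diff_eq)
    also have "trnorm (adj U * (U * X - U * Y)) \<le> trnorm (U * X - U * Y)"
      by (rule trnorm_contraction_left[OF contraction_adj[OF U(2)]])
    also have "trnorm (U * X - U * Y) \<le> 2 * t ^ 4 + trnorm (h X - h Y) + 2 * t ^ 4"
      using trnorm_triangle_minus[of "U * X" "U * Y" "h X"] trnorm_triangle_minus[of "h X" "U * Y" "h Y"]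
        Xiso(2)[OF XY(1)] Xiso(2)[OF XY(2)] by (simp add: trnorm_minus_commute[of "h Y"])
    finally show "trnorm (X - Y) \<le> trnorm (h X - h Y) + 12 * t ^ 4" by simp
  qed (rule h_minus h_le)+
qed

text \<open>The defect goes from \<open>t ^ 8\<close> to \<open>t ^ 4\<close> in
  \<open>hermitian_points\<close>, to \<open>t\<^sup>2\<close> in \<open>pair_observable\<close> and
  to \<open>t\<close> in \<open>anticommutator_small\<close>. The 189 is 27 * 7, where 7 is the root
  of the 49 in the intermediate defect \<open>49 * t\<^sup>2\<close>; the bound 1/7 on
  \<open>t\<close> keeps that defect below 1.\<close>

lemma approximate_clifford_relations:
  fixes p q :: "'i \<Rightarrow> fmat"
  assumes t: "0 \<le> t" "t \<le> 1 / 7"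
    and sup: "supported d a" "\<And>i. i \<in> I \<Longrightarrow> supported d (p i)" "\<And>i. i \<in> I \<Longrightarrow> supported d (q i)"
    and a: "trnorm a \<le> 2" "trnorm a \<ge> 2 - 2 * t ^ 8"
    and le1: "\<And>i. i \<in> I \<Longrightarrow> trnorm (p i) \<le> 1" "\<And>i. i \<in> I \<Longrightarrow> trnorm (a - p i) \<le> 1"
      "\<And>i. i \<in> I \<Longrightarrow> trnorm (q i) \<le> 1" "\<And>i. i \<in> I \<Longrightarrow> trnorm (a - q i) \<le> 1"
    and pq: "\<And>i. i \<in> I \<Longrightarrow> trnorm (p i - q i) \<ge> 2 - 2 * t ^ 8"
    and sep: "\<And>i j. i \<in> I \<Longrightarrow> j \<in> I \<Longrightarrow> i \<noteq> j \<Longrightarrow> trnorm (p i - p j) \<ge> sqrt 2 - 2 * t ^ 8"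
      "\<And>i j. i \<in> I \<Longrightarrow> j \<in> I \<Longrightarrow> i \<noteq> j \<Longrightarrow> trnorm (p i - q j) \<ge> sqrt 2 - 2 * t ^ 8"
  obtains \<rho> V where "supported d \<rho>" "trnorm \<rho> \<le> 1" "Re (tr \<rho>) \<ge> 1 - 189 * t"
    "\<And>i. i \<in> I \<Longrightarrow> supported d (V i)" "\<And>i. i \<in> I \<Longrightarrow> contraction (V i)" "\<And>i. i \<in> I \<Longrightarrow> adj (V i) = V i"
    "\<And>i. i \<in> I \<Longrightarrow> trnorm (V i * \<rho> - \<rho> * V i) \<le> 189 * t"
    "\<And>i. i \<in> I \<Longrightarrow> trnorm (V i * (V i * \<rho>) - \<rho>) \<le> 189 * t"
    "\<And>i j. i \<in> I \<Longrightarrow> j \<in> I \<Longrightarrow> i \<noteq> j \<Longrightarrow> trnorm ((V i * V j + V j * V i) * \<rho>) \<le> 189 * t"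
proof -
  define \<X> where "\<X> = p ` I \<union> q ` I"
  have X1: "trnorm X \<le> 1" if "X \<in> \<X>" for X using that le1 by (auto simp: \<X>_def)
  have X2: "trnorm (a - X) \<le> 1" if "X \<in> \<X>" for X using that le1 by (auto simp: \<X>_def)
  obtain h where h: "\<And>M. supported d M \<Longrightarrow> supported d (h M)" "\<And>M. adj (h M) = h M"
    "\<And>M N. h (M - N) = h M - h N" "\<And>M. trnorm (h M) \<le> trnorm M"
    "Re (tr (h a)) \<ge> 2 - 2 * t ^ 8"
    "\<And>X Y. X \<in> \<X> \<Longrightarrow> Y \<in> \<X> \<Longrightarrow> trnorm (X - Y) \<le> trnorm (h X - h Y) + 12 * t ^ 4"
    using hermitian_points[OF t(1) sup(1) a(2) X1 X2] by blast
  have t1: "t \<le> 1" using t by simp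
  have t84: "t ^ 8 \<le> t ^ 4" and t42: "t ^ 4 \<le> t\<^sup>2" and t2: "t\<^sup>2 \<le> t"
    using power_decreasing[of 4 8 t] power_decreasing[of 2 4 t] power_decreasing[of 1 2 t] t(1) t1 by simp_all
  have sq16: "sqrt (16 * t ^ 4) = 4 * t\<^sup>2"
  proof -
    have "(4 * t\<^sup>2)\<^sup>2 = 16 * t ^ 4" by (simp add: power_mult_distrib flip: power_mult)
    from real_sqrt_unique[OF this] show ?thesis by simp
  qed
  define b where "b = h a"
  have "\<exists>V. supported d V \<and> contraction V \<and> adj V = V \<and>
      trnorm (V * b - (2 *\<^sub>R h (p i) - b)) \<le> 32 * t\<^sup>2 \<and> trnorm (V * b - (b - 2 *\<^sub>R h (q i))) \<le> 32 * t\<^sup>2 \<and>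
      trnorm (V * b - b * V) \<le> 64 * t\<^sup>2 \<and> trnorm (V * (V * b) - b) \<le> 64 * t\<^sup>2" if i: "i \<in> I" for i
  proof -
    have "trnorm (b - h (p i)) \<le> 1" "trnorm (b - h (q i)) \<le> 1"
      using order_trans[OF h(4) le1(2)[OF i]] order_trans[OF h(4) le1(4)[OF i]] by (simp_all add: h(3) b_def)
    \<comment> \<open>The defect is at most 14 times \<open>t ^ 4\<close>; it is rounded up to 16 so
      that its square root is exact.\<close>
    moreover have "trnorm (h (p i) - h (q i)) \<ge> 2 - 16 * t ^ 4"
    proof -
      have "trnorm (p i - q i) \<le> trnorm (h (p i) - h (q i)) + 12 * t ^ 4"
        using i by (intro h(6)) (auto simp: \<X>_def)
      then show ?thesis using pq[OF i] t84 zero_le_power[OF t(1), of 4] by linarith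
    qed
    moreover have "Re (tr b) \<ge> 2 - 16 * t ^ 4" using h(5) t84 t(1) zero_le_power[of t 4] unfolding b_def by linarith
    ultimately obtain V where "supported d V" "contraction V" "adj V = V"
      "trnorm (V * b - (2 *\<^sub>R h (p i) - b)) \<le> 8 * sqrt (16 * t ^ 4)"
      "trnorm (V * b - (b - 2 *\<^sub>R h (q i))) \<le> 8 * sqrt (16 * t ^ 4)"
      "trnorm (V * b - b * V) \<le> 16 * sqrt (16 * t ^ 4)"
      "trnorm (V * (V * b) - b) \<le> 16 * sqrt (16 * t ^ 4)"
      using pair_observable[OF _ h(1)[OF sup(2)[OF i]] h(1)[OF sup(3)[OF i]] h(2) h(2)
          order_trans[OF h(4) le1(1)[OF i]] order_trans[OF h(4) le1(3)[OF i]], of "16 * t ^ 4" b] t(1)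
      by (metis mult_nonneg_nonneg zero_le_numeral zero_le_power)
    then show ?thesis unfolding sq16 by (intro exI[of _ V]) simp
  qed
  then have "\<forall>i\<in>I. \<exists>V. supported d V \<and> contraction V \<and> adj V = V \<and>
      trnorm (V * b - (2 *\<^sub>R h (p i) - b)) \<le> 32 * t\<^sup>2 \<and> trnorm (V * b - (b - 2 *\<^sub>R h (q i))) \<le> 32 * t\<^sup>2 \<and>
      trnorm (V * b - b * V) \<le> 64 * t\<^sup>2 \<and> trnorm (V * (V * b) - b) \<le> 64 * t\<^sup>2"
    by blast
  from bchoice[OF this] obtain V where V': "\<forall>i\<in>I. supported d (V i) \<and> contraction (V i) \<and> adj (V i) = V i \<and>
      trnorm (V i * b - (2 *\<^sub>R h (p i) - b)) \<le> 32 * t\<^sup>2 \<and>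
      trnorm (V i * b - (b - 2 *\<^sub>R h (q i))) \<le> 32 * t\<^sup>2 \<and>
      trnorm (V i * b - b * V i) \<le> 64 * t\<^sup>2 \<and> trnorm (V i * (V i * b) - b) \<le> 64 * t\<^sup>2" ..
  from V' have V: "\<And>i. i \<in> I \<Longrightarrow> supported d (V i)" "\<And>i. i \<in> I \<Longrightarrow> contraction (V i)"
    "\<And>i. i \<in> I \<Longrightarrow> adj (V i) = V i" by auto
  from V' have Vp: "\<And>i. i \<in> I \<Longrightarrow> trnorm (V i * b - (2 *\<^sub>R h (p i) - b)) \<le> 32 * t\<^sup>2" by blast
  from V' have Vq: "\<And>i. i \<in> I \<Longrightarrow> trnorm (V i * b - (b - 2 *\<^sub>R h (q i))) \<le> 32 * t\<^sup>2" by blast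
  from V' have Vc: "\<And>i. i \<in> I \<Longrightarrow> trnorm (V i * b - b * V i) \<le> 64 * t\<^sup>2" by blast
  from V' have Vs: "\<And>i. i \<in> I \<Longrightarrow> trnorm (V i * (V i * b) - b) \<le> 64 * t\<^sup>2" by blast
  define \<rho> where "\<rho> = (1 / 2) *\<^sub>R b"
  have half: "trnorm ((1 / 2) *\<^sub>R M) = 1 / 2 * trnorm M" for M by (rule trnorm_scaleR) simp
  have rho1: "trnorm \<rho> \<le> 1" using order_trans[OF h(4) a(1)] by (simp add: \<rho>_def half b_def)
  have rho_tr: "Re (tr \<rho>) \<ge> 1 - t ^ 8" using h(5) by (simp add: \<rho>_def b_def)
  have rho_adj: "adj \<rho> = \<rho>" by (simp add: \<rho>_def b_def h(2))
  have "V i * \<rho> - \<rho> * V i = (1 / 2) *\<^sub>R (V i * b - b * V i)" for i by (simp add: \<rho>_def algebra_simps)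
  then have comm: "trnorm (V i * \<rho> - \<rho> * V i) \<le> 32 * t\<^sup>2" if "i \<in> I" for i
    using Vc[OF that] by (simp add: half)
  have "V i * (V i * \<rho>) - \<rho> = (1 / 2) *\<^sub>R (V i * (V i * b) - b)" for i by (simp add: \<rho>_def algebra_simps)
  then have sqr: "trnorm (V i * (V i * \<rho>) - \<rho>) \<le> 32 * t\<^sup>2" if "i \<in> I" for i
    using Vs[OF that] by (simp add: half)
  have le49: "x \<le> 49 * t\<^sup>2" if "x \<le> 32 * t\<^sup>2" for x
    using that zero_le_power2[of t] by linarith
  have anti: "trnorm ((V i * V j + V j * V i) * \<rho>) \<le> 189 * t" if ij: "i \<in> I" "j \<in> I" "i \<noteq> j" for i j
  proof -
    \<comment> \<open>The sign \<open>s\<close> treats both separations together,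
      \<open>Y = q j\<close> with \<open>s = 1\<close> and \<open>Y = p j\<close> with
      \<open>s = -1\<close>: \<open>h (p i)\<close> is close to half of \<open>b + V i * b\<close>,
      and \<open>h Y\<close> to half of \<open>b - s *\<^sub>R (V j * b)\<close>. The loss is 32
      from the two observables and 14 from the rotation, rounded up from 46 to the square
      49.\<close>
    have sep': "trnorm ((V i + s *\<^sub>R V j) * \<rho>) \<ge> sqrt 2 - 49 * t\<^sup>2"
      if Y: "Y \<in> \<X>" and d: "trnorm (p i - Y) \<ge> sqrt 2 - 2 * t ^ 8"
        and s: "trnorm (s *\<^sub>R (V j * b) - (b - 2 *\<^sub>R h Y)) \<le> 32 * t\<^sup>2" for s Y
    proof -
      have dh: "trnorm (h (p i) - h Y) \<ge> sqrt 2 - 14 * t ^ 4"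
        using h(6)[of "p i" Y] Y d ij t84 by (simp add: \<X>_def)
      have "2 *\<^sub>R (h (p i) - h Y) = 2 *\<^sub>R ((V i + s *\<^sub>R V j) * \<rho>) - (V i * b - (2 *\<^sub>R h (p i) - b)) - (s *\<^sub>R (V j * b) - (b - 2 *\<^sub>R h Y))"
        by (simp add: \<rho>_def algebra_simps)
      then have "trnorm (2 *\<^sub>R (h (p i) - h Y)) \<le> trnorm (2 *\<^sub>R ((V i + s *\<^sub>R V j) * \<rho>))
          + trnorm (V i * b - (2 *\<^sub>R h (p i) - b)) + trnorm (s *\<^sub>R (V j * b) - (b - 2 *\<^sub>R h Y))"
        using trnorm_triangle_minus[of "2 *\<^sub>R ((V i + s *\<^sub>R V j) * \<rho>)" "V i * b - (2 *\<^sub>R h (p i) - b)" 0]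
          trnorm_triangle_minus[of "2 *\<^sub>R ((V i + s *\<^sub>R V j) * \<rho>) - (V i * b - (2 *\<^sub>R h (p i) - b))" "s *\<^sub>R (V j * b) - (b - 2 *\<^sub>R h Y)" 0]
        by (simp add: trnorm_uminus[of "V i * b - (2 *\<^sub>R h (p i) - b)", symmetric] trnorm_uminus[of "s *\<^sub>R (V j * b) - (b - 2 *\<^sub>R h Y)", symmetric])
      then have "2 * trnorm (h (p i) - h Y) \<le> 2 * trnorm ((V i + s *\<^sub>R V j) * \<rho>) + 32 * t\<^sup>2 + 32 * t\<^sup>2"
        using Vp[OF ij(1)] s trnorm_scaleR[of 2 "h (p i) - h Y"] trnorm_scaleR[of 2 "(V i + s *\<^sub>R V j) * \<rho>"] by linarith
      then show ?thesis using dh t42 zero_le_power2[of t] by linarith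
    qed
    have "trnorm ((V i + 1 *\<^sub>R V j) * \<rho>) \<ge> sqrt 2 - 49 * t\<^sup>2"
      by (rule sep'[of "q j"]) (use Vq[OF ij(2)] sep(2)[OF ij] ij(2) in \<open>auto simp: \<X>_def\<close>)
    moreover have "trnorm ((V i + (- 1) *\<^sub>R V j) * \<rho>) \<ge> sqrt 2 - 49 * t\<^sup>2"
    proof (rule sep'[of "p j"])
      show "trnorm ((- 1) *\<^sub>R (V j * b) - (b - 2 *\<^sub>R h (p j))) \<le> 32 * t\<^sup>2"
        using Vp[OF ij(2)] trnorm_uminus[of "V j * b - (2 *\<^sub>R h (p j) - b)"] by (simp add: algebra_simps)
    qed (use sep(1)[OF ij] ij(2) in \<open>auto simp: \<X>_def\<close>)
    moreover have "49 * t\<^sup>2 \<le> 1" using power_mono[OF t(2,1), of 2] by (simp add: power2_eq_square)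
    moreover have "Re (tr \<rho>) \<ge> 1 - 49 * t\<^sup>2" using rho_tr t84 t42 zero_le_power2[of t] by linarith
    ultimately have "trnorm ((V i * V j + V j * V i) * \<rho>) \<le> 27 * sqrt (49 * t\<^sup>2)"
      using ij V le49[OF comm] le49[OF sqr] rho1 rho_adj
      by (intro anticommutator_small) auto
    also have "sqrt (49 * t\<^sup>2) = 7 * t" using t(1) by (simp add: real_sqrt_mult real_sqrt_eq_iff)
    finally show ?thesis by simp
  qed
  have "32 * t\<^sup>2 \<le> 189 * t" "t ^ 8 \<le> 189 * t" using t84 t42 t2 t(1) by linarith+
  then have le189: "x \<le> 189 * t" if "x \<le> 32 * t\<^sup>2" for x using that by linarith
  show ?thesis
  proof (rule that[of \<rho> V])
    show "supported d \<rho>" using h(1)[OF sup(1)] by (simp add: \<rho>_def b_def)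
    show "Re (tr \<rho>) \<ge> 1 - 189 * t" using rho_tr t84 t42 t2 t(1) by linarith
  qed (use V le189[OF comm] le189[OF sqr] anti rho1 in auto)
qed

section \<open>Words in approximately anticommuting observables\<close>

text \<open>As \<open>fmat\<close> has no unit, a word is represented by its action on a matrix
  instead of a product; the first letter is the leftmost factor.\<close>

definition act :: "(nat \<Rightarrow> fmat) \<Rightarrow> nat list \<Rightarrow> fmat \<Rightarrow> fmat"
  where "act V w M = foldr (\<lambda>i X. V i * X) w M"

text \<open>The same product as in \<open>act V w\<close>, with its letters in the same order, but
  to the right of \<open>M\<close>.\<close>

definition ract :: "(nat \<Rightarrow> fmat) \<Rightarrow> nat list \<Rightarrow> fmat \<Rightarrow> fmat"
  where "ract V w M = foldl (\<lambda>X i. X * V i) M w"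

definition word :: "nat \<Rightarrow> nat set \<Rightarrow> nat list"
  where "word N S = filter (\<lambda>i. i \<in> S) [0..<N]"

text \<open>The sign for sorting the letter \<open>i\<close> into the increasing word of \<open>S\<close>.\<close>

definition insert_sign :: "nat \<Rightarrow> nat set \<Rightarrow> real"
  where "insert_sign i S = (- 1) ^ length (filter (\<lambda>j. j \<in> S) [0..<i])"

text \<open>\<open>wset\<close> and \<open>wsign\<close> give the index set and the sign of the
  Clifford product of the word \<open>w\<close> with the monomial of \<open>S\<close>: letters are
  absorbed one at a time, the last one first, and a letter that meets its own copy cancels.\<close>

fun wset :: "nat list \<Rightarrow> nat set \<Rightarrow> nat set"
  where "wset [] S = S"
  | "wset (i # w) S = sym_diff {i} (wset w S)"

fun wsign :: "nat list \<Rightarrow> nat set \<Rightarrow> real"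
  where "wsign [] S = 1"
  | "wsign (i # w) S = insert_sign i (wset w S) * wsign w S"

lemma act_Nil [simp]: "act V [] M = M"
  by (simp add: act_def)
lemma act_Cons [simp]: "act V (i # w) M = V i * act V w M"
  by (simp add: act_def)
lemma act_append: "act V (u @ v) M = act V u (act V v M)"
  by (induction u) auto
lemma act_diff: "act V w (M - M') = act V w M - act V w M'"
  by (induction w) (auto simp: right_diff_distrib)
lemma act_scaleR: "act V w (r *\<^sub>R M) = r *\<^sub>R act V w M"
  by (induction w) auto
lemma act_times: "act V w (A * B) = act V w A * B"
  by (induction w) (auto simp: mult.assoc)
lemma ract_Nil [simp]: "ract V [] M = M"
  by (simp add: ract_def)
lemma ract_Cons [simp]: "ract V (i # w) M = ract V w (M * V i)"
  by (simp add: ract_def)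
lemma ract_diff: "ract V w (M - M') = ract V w M - ract V w M'"
  by (induction w arbitrary: M M') (auto simp: left_diff_distrib)
lemma ract_plus: "ract V w (M + M') = ract V w M + ract V w M'"
  by (induction w arbitrary: M M') (auto simp: distrib_right)
lemma times_ract: "A * ract V w M = ract V w (A * M)"
  by (induction w arbitrary: M) (auto simp: mult.assoc)

lemma set_word [simp]: "S \<subseteq> {..<N} \<Longrightarrow> set (word N S) = S"
  by (auto simp: word_def)
lemma set_word_subset: "set (word N S) \<subseteq> {..<N}"
  by (auto simp: word_def)
lemma distinct_word [simp]: "distinct (word N S)"
  by (simp add: word_def)
lemma length_word_le: "length (word N S) \<le> N"
  unfolding word_def by (rule order_trans[OF length_filter_le]) simp
lemma word_empty [simp]: "word N {} = []"
  by (simp add: word_def)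

lemma wset_append: "wset (u @ v) S = wset u (wset v S)"
  by (induction u) auto

lemma wset_distinct: "distinct w \<Longrightarrow> wset w S = sym_diff (set w) S"
  by (induction w) auto

lemma wsign_abs: "\<bar>wsign w S\<bar> = 1"
  by (induction w) (auto simp: abs_mult insert_sign_def)

lemma wsign_sq: "wsign w S * wsign w S = 1"
  using wsign_abs[of w S] by (metis abs_mult_self_eq mult_1)

lemma word_split:
  assumes "i < N"
  shows "word N S = filter (\<lambda>j. j \<in> S) [0..<i] @ (if i \<in> S then [i] else []) @ filter (\<lambda>j. j \<in> S) [Suc i..<N]"
proof -
  have "[0..<N] = [0..<i] @ i # [Suc i..<N]"
    using assms upt_add_eq_append[of 0 i "N - i"] upt_conv_Cons[of i N] by simp
  then show ?thesis by (simp add: word_def)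
qed

lemma word_sym_diff_split:
  assumes "i < N"
  shows "word N (sym_diff {i} S) =
    filter (\<lambda>j. j \<in> S) [0..<i] @ (if i \<in> S then [] else [i]) @ filter (\<lambda>j. j \<in> S) [Suc i..<N]"
proof -
  have "filter (\<lambda>j. j \<in> sym_diff {i} S) [0..<i] = filter (\<lambda>j. j \<in> S) [0..<i]"
    "filter (\<lambda>j. j \<in> sym_diff {i} S) [Suc i..<N] = filter (\<lambda>j. j \<in> S) [Suc i..<N]"
    by (rule filter_cong; auto)+
  then show ?thesis unfolding word_split[OF assms] by simp
qed

lemma trnorm_triangle3: "trnorm (A - C) \<le> x + y" if "trnorm (A - B) \<le> x" "trnorm (B - C) \<le> y"
  using trnorm_triangle_minus[of A C B] that by linarith

text \<open>The exact representation is the instance with the identity as \<open>\<rho>\<close> and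
  \<open>\<kappa> = 0\<close>. Exact and approximate products therefore obey the same sign function
  \<open>wsign\<close> and can be compared term by term.\<close>

locale almost_clifford =
  fixes V :: "nat \<Rightarrow> fmat" and N :: nat and \<rho> :: fmat and \<kappa> :: real
  assumes contr: "i < N \<Longrightarrow> contraction (V i)"
    and herm: "i < N \<Longrightarrow> adj (V i) = V i"
    and comm: "i < N \<Longrightarrow> trnorm (V i * \<rho> - \<rho> * V i) \<le> \<kappa>"
    and square: "i < N \<Longrightarrow> trnorm (V i * (V i * \<rho>) - \<rho>) \<le> \<kappa>"
    and anti: "i < N \<Longrightarrow> j < N \<Longrightarrow> i \<noteq> j \<Longrightarrow> trnorm ((V i * V j + V j * V i) * \<rho>) \<le> \<kappa>"
    and kappa_nonneg: "0 \<le> \<kappa>"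
begin

text \<open>The price of exchanging or cancelling two adjacent letters when at most \<open>N\<close>
  letters stand between them and \<open>\<rho>\<close>.\<close>

definition swap_error :: real
  where "swap_error = (2 * N + 1) * \<kappa>"

lemma swap_error_nonneg: "0 \<le> swap_error"
  using kappa_nonneg by (simp add: swap_error_def)

lemma swap_error_le: "n \<le> N \<Longrightarrow> real (2 * n + 1) * \<kappa> \<le> swap_error"
  unfolding swap_error_def using kappa_nonneg by (intro mult_right_mono) auto

lemma norm_act_le: "set w \<subseteq> {..<N} \<Longrightarrow> norm (act V w M) \<le> norm M"
proof (induction w)
  case (Cons i w)
  then show ?case using order_trans[OF contraction_times_le[OF contr[of i]]] by simp
qed simp

lemma trnorm_act_le: "set w \<subseteq> {..<N} \<Longrightarrow> trnorm (act V w M) \<le> trnorm M"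
proof (induction w)
  case (Cons i w)
  then show ?case using order_trans[OF trnorm_contraction_left[OF contr[of i]]] by simp
qed simp

lemma trnorm_ract_le: "set w \<subseteq> {..<N} \<Longrightarrow> trnorm (ract V w M) \<le> trnorm M"
proof (induction w arbitrary: M)
  case (Cons i w)
  then show ?case using order_trans[OF Cons.IH trnorm_contraction_right[OF contr[of i]]] by simp
qed simp

lemma trnorm_act_ract: "set w \<subseteq> {..<N} \<Longrightarrow> trnorm (act V w \<rho> - ract V w \<rho>) \<le> length w * \<kappa>"
proof (induction w)
  case (Cons i w)
  then have i: "i < N" and w: "set w \<subseteq> {..<N}" by auto
  have "trnorm (V i * act V w \<rho> - V i * ract V w \<rho>) \<le> length w * \<kappa>"
    using order_trans[OF trnorm_contraction_left[OF contr[OF i]] Cons.IH[OF w]] by (simp add: right_diff_distrib)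
  moreover have "trnorm (V i * ract V w \<rho> - ract V w (\<rho> * V i)) \<le> \<kappa>"
    unfolding times_ract ract_diff[symmetric] by (rule order_trans[OF trnorm_ract_le[OF w] comm[OF i]])
  ultimately show ?case
    using trnorm_triangle3 by (fastforce simp: algebra_simps)
qed simp

text \<open>Letters can only be exchanged next to \<open>\<rho>\<close>; commuting the word \<open>w\<close> past \<open>\<rho>\<close> and back costs
  \<open>2 * length w * \<kappa>\<close>.\<close>

lemma anti_act:
  assumes "i < N" "j < N" "i \<noteq> j" and w: "set w \<subseteq> {..<N}"
  shows "trnorm (V i * (V j * act V w \<rho>) + V j * (V i * act V w \<rho>)) \<le> (2 * length w + 1) * \<kappa>"
proof -
  let ?X = "act V w \<rho> - ract V w \<rho>"
  have c: "trnorm (V i * (V j * ?X)) \<le> length w * \<kappa>" "trnorm (V j * (V i * ?X)) \<le> length w * \<kappa>"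
    using trnorm_contraction_left[OF contr[OF assms(1)]] trnorm_contraction_left[OF contr[OF assms(2)]]
      trnorm_act_ract[OF w] by (meson order_trans)+
  have "V i * (V j * act V w \<rho>) + V j * (V i * act V w \<rho>) =
      V i * (V j * ?X) + V j * (V i * ?X) + ract V w ((V i * V j + V j * V i) * \<rho>)"
    by (simp add: algebra_simps times_ract ract_plus)
  then have "trnorm (V i * (V j * act V w \<rho>) + V j * (V i * act V w \<rho>)) \<le>
      trnorm (V i * (V j * ?X)) + trnorm (V j * (V i * ?X)) + trnorm (ract V w ((V i * V j + V j * V i) * \<rho>))"
    by (smt (verit) trnorm_triangle)
  also have "\<dots> \<le> length w * \<kappa> + length w * \<kappa> + \<kappa>"
    by (intro add_mono c order_trans[OF trnorm_ract_le[OF w] anti[OF assms(1-3)]])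
  finally show ?thesis by (simp add: algebra_simps)
qed

lemma square_act:
  assumes "i < N" and w: "set w \<subseteq> {..<N}"
  shows "trnorm (V i * (V i * act V w \<rho>) - act V w \<rho>) \<le> (2 * length w + 1) * \<kappa>"
proof -
  let ?X = "act V w \<rho> - ract V w \<rho>"
  have c: "trnorm (V i * (V i * ?X)) \<le> length w * \<kappa>" "trnorm ?X \<le> length w * \<kappa>"
    using trnorm_contraction_left[OF contr[OF assms(1)]] trnorm_act_ract[OF w] by (meson order_trans)+
  have "V i * (V i * act V w \<rho>) - act V w \<rho> =
      V i * (V i * ?X) + - ?X + ract V w (V i * (V i * \<rho>) - \<rho>)"
    by (simp add: algebra_simps times_ract ract_diff)
  then have "trnorm (V i * (V i * act V w \<rho>) - act V w \<rho>) \<le>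
      trnorm (V i * (V i * ?X)) + trnorm (- ?X) + trnorm (ract V w (V i * (V i * \<rho>) - \<rho>))"
    by (smt (verit) trnorm_triangle)
  also have "\<dots> \<le> length w * \<kappa> + length w * \<kappa> + \<kappa>"
    unfolding trnorm_uminus by (intro add_mono c order_trans[OF trnorm_ract_le[OF w] square[OF assms(1)]])
  finally show ?thesis by (simp add: algebra_simps)
qed

text \<open>Letter \<open>i\<close> is exchanged with the letters of \<open>u\<close> one by one;
  the letters already passed stay outside as contractions and do not amplify the error.\<close>

lemma move_act:
  assumes "i < N" "set u \<subseteq> {..<i}" "set v \<subseteq> {..<N}" "length u + length v \<le> N"
  shows "trnorm (V i * act V (u @ v) \<rho> - (- 1) ^ length u *\<^sub>R act V (u @ i # v) \<rho>) \<le> length u * swap_error"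
  using assms(2,4)
proof (induction u)
  case (Cons j u)
  then have j: "j < N" "i \<noteq> j" using assms(1) by auto
  have uv: "set (u @ v) \<subseteq> {..<N}" using Cons.prems assms(1,3) by auto
  have "(2 * length (u @ v) + 1) * \<kappa> \<le> swap_error"
    using Cons.prems(2) by (intro swap_error_le) simp
  from order_trans[OF anti_act[OF assms(1) j uv] this] have 1: "trnorm (V i * (V j * act V (u @ v) \<rho>) - - (V j * (V i * act V (u @ v) \<rho>))) \<le> swap_error"
    by simp
  have "trnorm (V j * (V i * act V (u @ v) \<rho> - (- 1) ^ length u *\<^sub>R act V (u @ i # v) \<rho>)) \<le> length u * swap_error"
    using Cons.prems by (intro order_trans[OF trnorm_contraction_left[OF contr[OF j(1)]] Cons.IH]) auto
  then have 2: "trnorm (- (V j * (V i * act V (u @ v) \<rho>)) - (- 1) ^ length (j # u) *\<^sub>R (V j * act V (u @ i # v) \<rho>))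
      \<le> length u * swap_error"
    using trnorm_uminus[of "V j * (V i * act V (u @ v) \<rho> - (- 1) ^ length u *\<^sub>R act V (u @ i # v) \<rho>)"]
    by (simp add: right_diff_distrib del: trnorm_uminus)
  show ?case using trnorm_triangle3[OF 1 2] by (simp add: algebra_simps)
qed simp

lemma insert_act:
  assumes i: "i < N"
  shows "trnorm (V i * act V (word N S) \<rho> - insert_sign i S *\<^sub>R act V (word N (sym_diff {i} S)) \<rho>) \<le> N * swap_error"
proof -
  define u where "u = filter (\<lambda>j. j \<in> S) [0..<i]"
  define v where "v = filter (\<lambda>j. j \<in> S) [Suc i..<N]"
  have u: "set u \<subseteq> {..<i}" "length u \<le> i" and v: "set v \<subseteq> {..<N}" "length v \<le> N - Suc i"
    using length_filter_le[of _ "[0..<i]"] length_filter_le[of _ "[Suc i..<N]"] by (auto simp: u_def v_def)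
  note word_splits = word_split[OF i, of S, folded u_def v_def] word_sym_diff_split[OF i, of S, folded u_def v_def]
  show ?thesis
  proof (cases "i \<in> S")
    case False
    have "real (length u) * swap_error \<le> N * swap_error"
      using u(2) i swap_error_nonneg by (intro mult_right_mono) auto
    moreover have "length u + length v \<le> N" using u(2) v(2) i by auto
    ultimately show ?thesis
      using order_trans[OF move_act[OF i u(1) v(1)]] False
      unfolding word_splits insert_sign_def u_def[symmetric]
      by simp
  next
    case True
    have iv: "set (i # v) \<subseteq> {..<N}" using v i by auto
    have uN: "set u \<subseteq> {..<N}" using u i by auto
    have len: "length u + length (i # v) \<le> N" using u(2) v(2) i by auto
    note 1 = move_act[OF i u(1) iv len]
    have "trnorm ((- 1) ^ length u *\<^sub>R act V u (V i * (V i * act V v \<rho>) - act V v \<rho>)) =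
        trnorm (act V u (V i * (V i * act V v \<rho>) - act V v \<rho>))"
      by (cases "even (length u)") auto
    also have "\<dots> \<le> (2 * length v + 1) * \<kappa>"
      by (rule order_trans[OF trnorm_act_le[OF uN] square_act[OF i v(1)]])
    also have "\<dots> \<le> swap_error"
      using v(2) by (intro swap_error_le) simp
    finally have 2: "trnorm ((- 1) ^ length u *\<^sub>R act V (u @ i # i # v) \<rho> - (- 1) ^ length u *\<^sub>R act V (u @ v) \<rho>)
        \<le> swap_error"
      by (simp add: act_append act_diff scaleR_diff_right)
    \<comment> \<open>\<open>u\<close> has at most \<open>i < N\<close> letters, so the additional
      cancellation still fits into \<open>N\<close> steps.\<close>
    have "real (length u) * swap_error + swap_error = (real (length u) + 1) * swap_error"
      by (simp add: algebra_simps)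
    also have "\<dots> \<le> real N * swap_error"
      using u(2) i swap_error_nonneg by (intro mult_right_mono) auto
    finally have "real (length u) * swap_error + swap_error \<le> N * swap_error"
      by (simp add: mult.assoc)
    then show ?thesis
      using trnorm_triangle3[OF 1 2] True
      unfolding word_splits insert_sign_def u_def[symmetric]
      by simp
  qed
qed

lemma word_act:
  assumes "set w \<subseteq> {..<N}"
  shows "trnorm (act V w (act V (word N S) \<rho>) - wsign w S *\<^sub>R act V (word N (wset w S)) \<rho>)
    \<le> length w * (N * swap_error)"
  using assms
proof (induction w)
  case (Cons i w)
  then have i: "i < N" and w: "set w \<subseteq> {..<N}" by auto
  let ?f = "\<lambda>S. act V (word N S) \<rho>"
  have 1: "trnorm (V i * act V w (?f S) - wsign w S *\<^sub>R (V i * ?f (wset w S))) \<le> length w * (N * swap_error)"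
    using order_trans[OF trnorm_contraction_left[OF contr[OF i]] Cons.IH[OF w]] by (simp add: right_diff_distrib)
  have "trnorm (wsign w S *\<^sub>R X) = trnorm X" for X
    using wsign_abs[of w S] by (cases "wsign w S = 1") (auto simp: abs_if split: if_splits)
  then have "trnorm (wsign w S *\<^sub>R (V i * ?f (wset w S)) - wsign w S *\<^sub>R (insert_sign i (wset w S) *\<^sub>R ?f (wset (i # w) S)))
      \<le> N * swap_error"
    unfolding scaleR_diff_right[symmetric] using insert_act[OF i, of "wset w S"] by simp
  from trnorm_triangle3[OF 1 this] show ?case by (simp add: algebra_simps)
qed simp

text \<open>The letters are Hermitian, so the adjoint reverses the word;
  \<open>fdiag d (\<lambda>_. 1)\<close> stands in for the unit and turns the word into a
  matrix.\<close>

lemma adj_act_times: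
  assumes "set w \<subseteq> {..<N}" "\<And>i. i < N \<Longrightarrow> supported d (V i)" "supported d Y"
  shows "adj (act V w (fdiag d (\<lambda>_. 1))) * Y = act V (rev w) Y"
  using assms
proof (induction w arbitrary: Y)
  case Nil
  then show ?case by (simp add: fdiag_one_times)
next
  case (Cons i w)
  then have i: "i < N" by auto
  then have "adj (act V (i # w) (fdiag d (\<lambda>_. 1))) * Y = adj (act V w (fdiag d (\<lambda>_. 1))) * (V i * Y)"
    by (simp add: herm mult.assoc)
  also have "\<dots> = act V (rev w) (V i * Y)" using Cons.prems i by (intro Cons.IH) auto
  finally show ?case by (simp add: act_append)
qed

end

section \<open>Twisted convolution\<close>

lemma bessel_inequality:
  fixes v :: "'a \<Rightarrow> 'b::real_inner"
  assumes "finite F" and D: "0 < D"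
    and v: "\<And>a. a \<in> F \<Longrightarrow> inner (v a) (v a) = D"
    and orth: "\<And>a b. a \<in> F \<Longrightarrow> b \<in> F \<Longrightarrow> a \<noteq> b \<Longrightarrow> inner (v a) (v b) = 0"
  shows "(\<Sum>a\<in>F. (inner (v a) M)\<^sup>2) \<le> D * (norm M)\<^sup>2"
proof -
  define P where "P = (\<Sum>a\<in>F. (inner (v a) M / D) *\<^sub>R v a)"
  have vP: "inner (v a) P = inner (v a) M" if a: "a \<in> F" for a
  proof -
    have "inner (v a) P = (\<Sum>b\<in>F. inner (v b) M / D * inner (v a) (v b))"
      by (simp add: P_def inner_sum_right)
    also have "\<dots> = (\<Sum>b\<in>F. if b = a then inner (v a) M else 0)"
      using a D by (intro sum.cong refl) (auto simp: v orth)
    finally show ?thesis using a assms(1) by simp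
  qed
  have "inner P X = (\<Sum>a\<in>F. inner (v a) M / D * inner (v a) X)" for X
    by (simp add: P_def inner_sum_left)
  then have PX: "inner P M = (\<Sum>a\<in>F. (inner (v a) M)\<^sup>2) / D" "inner P P = (\<Sum>a\<in>F. (inner (v a) M)\<^sup>2) / D"
    by (simp_all add: vP power2_eq_square sum_divide_distrib)
  have "0 \<le> inner (M - P) (M - P)" by simp
  also have "\<dots> = (norm M)\<^sup>2 - 2 * inner P M + inner P P"
    by (simp add: power2_norm_eq_inner inner_diff_left inner_diff_right inner_commute)
  finally have "(\<Sum>a\<in>F. (inner (v a) M)\<^sup>2) / D \<le> (norm M)\<^sup>2" by (simp add: PX)
  then show ?thesis using D by (simp add: field_simps)
qed

lemma trnorm_eq_0D: "trnorm M \<le> 0 \<Longrightarrow> M = 0"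
  using trnorm_factor[of M] by (metis antisym mult_zero_left norm_eq_zero trnorm_nonneg zero_eq_power2)

text \<open>For exact Clifford monomials f this is the sign relating f(g) f(h) to
  f(\<open>sym_diff g h\<close>), computed as the sign to which the product of the adjoints of f(h)
  and f(g) with f(\<open>sym_diff g h\<close>) reduces.\<close>

definition twist :: "nat \<Rightarrow> nat set \<Rightarrow> nat set \<Rightarrow> real"
  where "twist N g h = wsign (rev (word N h) @ rev (word N g)) (sym_diff g h)"

lemma adj_sum: "adj (sum f A) = (\<Sum>a\<in>A. adj (f a))"
  by (induction A rule: infinite_finite_induct) auto

lemma tr_sum: "tr (sum f A) = (\<Sum>a\<in>A. tr (f a))"
  by (induction A rule: infinite_finite_induct) auto

lemma contraction_fdiag_one: "contraction (fdiag d (\<lambda>_. 1))"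
  unfolding contraction_def
proof
  fix M
  let ?E = "fdiag d (\<lambda>_. 1)"
  have "(norm (?E * M))\<^sup>2 = inner M (?E * M)"
    by (simp add: power2_norm_eq_inner inner_times_left flip: mult.assoc)
  also have "\<dots> \<le> norm M * norm (?E * M)" by (rule norm_cauchy_schwarz)
  finally show "norm (?E * M) \<le> norm M"
    using norm_ge_zero[of M] by (cases "norm (?E * M) = 0") (auto simp: power2_eq_square)
qed

text \<open>Evenness of \<open>N\<close> excludes a nontrivial central monomial: for odd
  \<open>N\<close> the product of all generators commutes with each of them and can have nonzero
  trace.\<close>

locale clifford =
  fixes G :: "nat \<Rightarrow> fmat" and N m :: nat
  assumes even_N: "even N" and m_pos: "0 < m"
    and G_supported: "i < N \<Longrightarrow> supported m (G i)"
    and G_adj: "i < N \<Longrightarrow> adj (G i) = G i"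
    and G_square: "i < N \<Longrightarrow> G i * G i = fdiag m (\<lambda>_. 1)"
    and G_anti: "i < N \<Longrightarrow> j < N \<Longrightarrow> i \<noteq> j \<Longrightarrow> G i * G j = - (G j * G i)"
begin

abbreviation one :: fmat where "one \<equiv> fdiag m (\<lambda>_. 1)"

lemma contraction_of_square:
  assumes "adj T = T" "T * T = one"
  shows "contraction T"
  unfolding contraction_def
proof
  fix M
  have "(norm (T * M))\<^sup>2 = inner M (one * M)"
    using assms by (simp add: power2_norm_eq_inner inner_times_left flip: mult.assoc)
  also have "\<dots> \<le> norm M * norm (one * M)" by (rule norm_cauchy_schwarz)
  also have "\<dots> \<le> (norm M)\<^sup>2"
    using contraction_times_le[OF contraction_fdiag_one] by (simp add: power2_eq_square mult_left_mono)
  finally show "norm (T * M) \<le> norm M" by (rule power2_le_imp_le) simp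
qed

lemma G_contraction: "i < N \<Longrightarrow> contraction (G i)"
  by (rule contraction_of_square) (simp_all add: G_adj G_square)

sublocale almost_clifford G N one 0
  by standard (auto simp: G_contraction G_adj G_square fdiag_one_times times_fdiag_one G_supported distrib_right
      dest: G_anti)

definition monomial :: "nat set \<Rightarrow> fmat"
  where "monomial S = act G (word N S) one"

lemma act_supported: "set w \<subseteq> {..<N} \<Longrightarrow> supported m M \<Longrightarrow> supported m (act G w M)"
  by (induction w) (auto simp: G_supported)

lemma monomial_supported [simp]: "supported m (monomial S)"
  unfolding monomial_def by (rule act_supported) (auto simp: set_word_subset)

text \<open>With \<open>\<kappa> = 0\<close> the error in \<open>word_act\<close> vanishes, and a
  matrix of trace norm 0 is 0.\<close>

lemma act_monomial:
  assumes "set w \<subseteq> {..<N}"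
  shows "act G w (monomial S) = wsign w S *\<^sub>R monomial (wset w S)"
  using trnorm_eq_0D[OF order_trans[OF word_act[OF assms, of S]]]
  by (simp add: monomial_def swap_error_def)

lemma adj_monomial_times: "supported m Y \<Longrightarrow> adj (monomial S) * Y = act G (rev (word N S)) Y"
  unfolding monomial_def by (rule adj_act_times) (auto simp: G_supported set_word_subset)

lemma G_act:
  assumes "i < N" "set w \<subseteq> {..<N}"
  shows "G i * act G w M = (- 1) ^ length (filter (\<lambda>j. j \<noteq> i) w) *\<^sub>R act G w (G i * M)"
  using assms(2)
proof (induction w)
  case (Cons j w)
  then have IH: "G i * act G w M = (- 1) ^ length (filter (\<lambda>j. j \<noteq> i) w) *\<^sub>R act G w (G i * M)" by simp
  show ?case
  proof (cases "j = i")
    case True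
    then show ?thesis by (simp add: IH)
  next
    case False
    then have "G i * (G j * act G w M) = - (G j * (G i * act G w M))"
      using G_anti[OF assms(1), of j] Cons.prems by (simp flip: mult.assoc)
    then show ?thesis using False by (simp add: IH)
  qed
qed simp

text \<open>Some generator anticommutes with a nontrivial monomial, and conjugation by it negates
  the trace: a member of \<open>S\<close> if \<open>S\<close> has even size, and otherwise a
  non-member, which exists because \<open>N\<close> is even.\<close>

lemma tr_monomial:
  assumes S: "S \<subseteq> {..<N}"
  shows "tr (monomial S) = (if S = {} then of_nat m else 0)"
proof (cases "S = {}")
  case False
  have fin: "finite S" using S finite_subset by blast
  have len: "length (filter (\<lambda>j. j \<noteq> i) (word N S)) = card (S - {i})" for i
  proof -
    have "length (filter (\<lambda>j. j \<noteq> i) (word N S)) = card (set (filter (\<lambda>j. j \<noteq> i) (word N S)))"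
      by (rule distinct_card[symmetric]) simp
    also have "set (filter (\<lambda>j. j \<noteq> i) (word N S)) = S - {i}" using S by auto
    finally show ?thesis .
  qed
  have "\<exists>i<N. odd (card (S - {i}))"
  proof (cases "even (card S)")
    case True
    obtain i where "i \<in> S" using False by blast
    then show ?thesis using True fin S card_gt_0_iff[of S] False
      by (intro exI[of _ i]) (auto simp: card_Diff_singleton)
  next
    case odd: False
    have "S \<noteq> {..<N}" using odd even_N by auto
    then obtain i where "i < N" "i \<notin> S" using S by blast
    then show ?thesis using odd by (intro exI[of _ i]) auto
  qed
  then obtain i where i: "i < N" "odd (card (S - {i}))" by blast
  have "tr (monomial S) = tr (G i * (G i * monomial S))"
    using i by (simp add: G_square fdiag_one_times flip: mult.assoc)
  also have "G i * monomial S = - (monomial S * G i)"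
    unfolding monomial_def G_act[OF i(1) set_word_subset] len
    using i by (simp add: act_times[symmetric] fdiag_one_times times_fdiag_one G_supported)
  also have "tr (G i * - (monomial S * G i)) = - tr (monomial S * (G i * G i))"
    by (simp add: tr_commute[of "G i"] mult.assoc)
  also have "\<dots> = - tr (monomial S)" using i by (simp add: G_square times_fdiag_one)
  finally show ?thesis using False by simp
qed (simp add: monomial_def)

lemma tr_monomials:
  assumes "h \<subseteq> {..<N}" "g \<subseteq> {..<N}" "g' \<subseteq> {..<N}"
  shows "tr (adj (monomial h) * (adj (monomial g) * monomial g')) =
    (if g' = sym_diff g h then of_nat m * of_real (twist N g h) else 0)"
proof -
  let ?w = "rev (word N h) @ rev (word N g)"
  have w: "set ?w \<subseteq> {..<N}" by (simp add: set_word_subset)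
  have wset: "wset ?w g' = sym_diff h (sym_diff g g')"
    using assms by (simp add: wset_append wset_distinct)
  have "adj (monomial h) * (adj (monomial g) * monomial g') = act G ?w (monomial g')"
    by (simp add: adj_monomial_times act_append act_supported set_word_subset)
  also have "\<dots> = wsign ?w g' *\<^sub>R monomial (sym_diff h (sym_diff g g'))"
    unfolding act_monomial[OF w] wset by simp
  finally have "tr (adj (monomial h) * (adj (monomial g) * monomial g')) =
      of_real (wsign ?w g') * tr (monomial (sym_diff h (sym_diff g g')))" by simp
  also have "sym_diff h (sym_diff g g') = {} \<longleftrightarrow> g' = sym_diff g h" by blast
  then have "tr (monomial (sym_diff h (sym_diff g g'))) = (if g' = sym_diff g h then of_nat m else 0)"
    using assms by (subst tr_monomial) auto
  finally show ?thesis by (simp add: twist_def)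
qed

lemma tr_monomial_pair:
  assumes "g \<subseteq> {..<N}" "g' \<subseteq> {..<N}"
  shows "tr (adj (monomial g) * monomial g') = (if g' = g then of_nat m else 0)"
proof -
  have "tr (adj (monomial g) * monomial g') = tr (adj (monomial {}) * (adj (monomial g) * monomial g'))"
    by (simp add: adj_monomial_times act_supported set_word_subset)
  also have "\<dots> = (if g' = sym_diff g {} then of_nat m * of_real (twist N g {}) else 0)"
    using assms by (intro tr_monomials) auto
  \<comment> \<open>The sign cannot be -1, since the trace of
    \<open>adj (monomial g) * monomial g\<close> is a squared norm.\<close>
  also have "twist N g {} = 1"
  proof -
    have w: "set (rev (word N g)) \<subseteq> {..<N}" by (simp add: set_word_subset)
    have "tr (adj (monomial g) * monomial g) = of_real (wsign (rev (word N g)) g) * of_nat m"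
      using assms by (simp add: adj_monomial_times act_monomial[OF w] wset_distinct tr_monomial)
    moreover have "Re (tr (adj (monomial g) * monomial g)) \<ge> 0"
      using inner_ge_zero[of "monomial g"] by (simp only: inner_fmat)
    ultimately have "wsign (rev (word N g)) g \<ge> 0" using m_pos by (simp add: zero_le_mult_iff)
    then show ?thesis using wsign_abs[of "rev (word N g)" g] by (simp add: twist_def)
  qed
  finally show ?thesis by simp
qed

text \<open>The inner product is real, so each monomial enters also multiplied by the imaginary
  unit; the two pairings give the real part and, up to sign, the imaginary part of the
  trace.\<close>

lemma bessel_monomials:
  "(\<Sum>h\<in>Pow {..<N}. (cmod (tr (adj (monomial h) * M)))\<^sup>2) \<le> m * (norm M)\<^sup>2"
proof -
  define v where "v = (\<lambda>(h, b). if b then monomial h else cscale \<i> (monomial h))"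
  have "(\<Sum>h\<in>Pow {..<N}. (cmod (tr (adj (monomial h) * M)))\<^sup>2) =
      (\<Sum>h\<in>Pow {..<N}. \<Sum>b\<in>(UNIV :: bool set). (inner (v (h, b)) M)\<^sup>2)"
    by (intro sum.cong refl) (simp add: UNIV_bool v_def inner_fmat cmod_power2)
  also have "\<dots> = (\<Sum>a\<in>Pow {..<N} \<times> UNIV. (inner (v a) M)\<^sup>2)"
    by (simp add: sum.cartesian_product)
  also have "\<dots> \<le> m * (norm M)\<^sup>2"
  proof (rule bessel_inequality)
    fix a b assume a: "a \<in> Pow {..<N} \<times> (UNIV :: bool set)"
    then show "inner (v a) (v a) = m"
      by (auto simp: v_def inner_fmat tr_monomial_pair)
    assume "b \<in> Pow {..<N} \<times> (UNIV :: bool set)" "a \<noteq> b"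
    then show "inner (v a) (v b) = 0" using a
      by (auto simp: v_def inner_fmat tr_monomial_pair split: if_splits)
  qed (use m_pos in auto)
  finally show ?thesis .
qed

text \<open>Up to the factor \<open>m\<close>, the convolution at \<open>h\<close> is the pairing of
  \<open>monomial h\<close> with a sum of products \<open>adj (H (x l)) * H (y l)\<close>, where
  \<open>H z\<close> has the Clifford coefficients \<open>z\<close>. The Hilbert-Schmidt norm of the
  products is then controlled by submultiplicativity. Estimating each \<open>h\<close> separately by
  Cauchy-Schwarz would give the number \<open>2 ^ N\<close> of subsets in place of the factor
  \<open>m\<close>.\<close>

lemma twisted_convolution_bound:
  fixes x y :: "nat \<Rightarrow> nat set \<Rightarrow> complex"
  shows "(\<Sum>h\<in>Pow {..<N}. (cmod (\<Sum>l<d. \<Sum>g\<in>Pow {..<N}. of_real (twist N g h) * (cnj (x l g) * y l (sym_diff g h))))\<^sup>2)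
    \<le> m * (\<Sum>l<d. \<Sum>g\<in>Pow {..<N}. (cmod (x l g))\<^sup>2) * (\<Sum>l<d. \<Sum>g\<in>Pow {..<N}. (cmod (y l g))\<^sup>2)"
proof -
  let ?F = "Pow {..<N}"
  define H where "H z = (\<Sum>g\<in>?F. cscale (z g) (monomial g))" for z
  have prod_H: "adj (H a) * H b = (\<Sum>g\<in>?F. \<Sum>g'\<in>?F. cscale (cnj (a g) * b g') (adj (monomial g) * monomial g'))" for a b
    unfolding H_def adj_sum sum_product by (simp add: mult.commute)
  have norm_H: "(norm (H z))\<^sup>2 = m * (\<Sum>g\<in>?F. (cmod (z g))\<^sup>2)" for z
  proof -
    have "tr (adj (H z) * H z) = (\<Sum>g\<in>?F. \<Sum>g'\<in>?F. cnj (z g) * (z g' * tr (adj (monomial g) * monomial g')))"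
      unfolding prod_H by (simp add: tr_sum mult.assoc)
    also have "\<dots> = (\<Sum>g\<in>?F. \<Sum>g'\<in>?F. if g' = g then of_nat m * of_real ((cmod (z g))\<^sup>2) else 0)"
      by (intro sum.cong refl) (auto simp: tr_monomial_pair complex_norm_square mult_ac simp del: of_real_power)
    also have "\<dots> = of_real (m * (\<Sum>g\<in>?F. (cmod (z g))\<^sup>2))"
      by (simp add: sum_distrib_left)
    finally show ?thesis by (simp add: power2_norm_eq_inner inner_fmat)
  qed
  define M where "M = (\<Sum>l<d. adj (H (x l)) * H (y l))"
  have trM: "tr (adj (monomial h) * M) =
      of_nat m * (\<Sum>l<d. \<Sum>g\<in>?F. of_real (twist N g h) * (cnj (x l g) * y l (sym_diff g h)))" if h: "h \<in> ?F" for h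
  proof -
    have "tr (adj (monomial h) * M) = (\<Sum>l<d. \<Sum>g\<in>?F. \<Sum>g'\<in>?F.
        cnj (x l g) * (y l g' * tr (adj (monomial h) * (adj (monomial g) * monomial g'))))"
      unfolding M_def prod_H by (simp add: tr_sum sum_distrib_left mult.assoc)
    also have "\<dots> = (\<Sum>l<d. \<Sum>g\<in>?F. \<Sum>g'\<in>?F.
        if g' = sym_diff g h then of_nat m * (of_real (twist N g h) * (cnj (x l g) * y l (sym_diff g h))) else 0)"
      using h by (intro sum.cong refl) (auto simp: tr_monomials)
    also have "\<dots> = (\<Sum>l<d. \<Sum>g\<in>?F. of_nat m * (of_real (twist N g h) * (cnj (x l g) * y l (sym_diff g h))))"
      using h by (intro sum.cong refl) (subst sum.delta, auto)
    finally show ?thesis by (simp add: sum_distrib_left)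
  qed
  let ?X = "\<Sum>l<d. \<Sum>g\<in>?F. (cmod (x l g))\<^sup>2" and ?Y = "\<Sum>l<d. \<Sum>g\<in>?F. (cmod (y l g))\<^sup>2"
  let ?S = "\<Sum>h\<in>?F. (cmod (\<Sum>l<d. \<Sum>g\<in>?F. of_real (twist N g h) * (cnj (x l g) * y l (sym_diff g h))))\<^sup>2"
  have "norm M \<le> (\<Sum>l<d. norm (H (x l)) * norm (H (y l)))"
    unfolding M_def by (intro order_trans[OF norm_sum] sum_mono order_trans[OF norm_mult_ineq]) simp
  then have "(norm M)\<^sup>2 \<le> (\<Sum>l<d. norm (H (x l)) * norm (H (y l)))\<^sup>2" by (intro power_mono) auto
  also have "\<dots> \<le> (\<Sum>l<d. (norm (H (x l)))\<^sup>2) * (\<Sum>l<d. (norm (H (y l)))\<^sup>2)"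
    by (rule Cauchy_Schwarz_ineq_sum)
  also have "\<dots> = (m * ?X) * (m * ?Y)" by (simp add: norm_H sum_distrib_left)
  finally have M: "(norm M)\<^sup>2 \<le> (m * ?X) * (m * ?Y)" .
  have "(real m)\<^sup>2 * ?S = (\<Sum>h\<in>?F. (cmod (tr (adj (monomial h) * M)))\<^sup>2)"
    by (subst sum_distrib_left, intro sum.cong refl)
       (simp only: trM norm_mult power_mult_distrib norm_of_nat)
  also have "\<dots> \<le> m * (norm M)\<^sup>2" by (rule bessel_monomials)
  also have "\<dots> \<le> m * ((m * ?X) * (m * ?Y))" using M by (intro mult_left_mono) auto
  also have "\<dots> = (real m)\<^sup>2 * (m * ?X * ?Y)" by (simp add: power2_eq_square)
  finally show ?thesis using m_pos by simp
qed

end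

section \<open>The dimension bound\<close>

lemma act_sum: "act V w (sum f A) = (\<Sum>a\<in>A. act V w (f a))"
  by (induction w) (auto simp: sum_distrib_left)

lemma entry_sum: "entry (sum f A) i j = (\<Sum>a\<in>A. entry (f a) i j)"
  by (induction A rule: infinite_finite_induct) auto

lemma supported_sum: "(\<And>a. a \<in> A \<Longrightarrow> supported d (f a)) \<Longrightarrow> supported d (sum f A)"
  by (induction A rule: infinite_finite_induct) auto

context almost_clifford
begin

lemma supported_act:
  "(\<And>i. i < N \<Longrightarrow> supported d (V i)) \<Longrightarrow> set w \<subseteq> {..<N} \<Longrightarrow> supported d M \<Longrightarrow> supported d (act V w M)"
  by (induction w) auto

text \<open>Applying the word to the matrix unit \<open>e\<close> isolates column \<open>i\<close>,
  and contractions do not increase the norm of \<open>e\<close>, which is 1.\<close>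

lemma column_act_le:
  assumes sup: "\<And>i. i < N \<Longrightarrow> supported d (V i)" and w: "set w \<subseteq> {..<N}" and i: "i < d"
  shows "(\<Sum>l<d. (cmod (entry (act V w (fdiag d (\<lambda>_. 1))) l i))\<^sup>2) \<le> 1"
proof -
  define e where "e = fdiag d (\<lambda>j. if j = i then 1 else 0)"
  let ?A = "act V w (fdiag d (\<lambda>_. 1))"
  have A: "supported d ?A" using sup w by (rule supported_act) auto
  have e: "supported d e" by (simp add: e_def)
  have Ae: "act V w e = ?A * e"
    by (simp add: act_times[symmetric] fdiag_one_times e)
  have "entry (?A * e) l i = entry ?A l i" for l
  proof -
    have "entry (?A * e) l i = (\<Sum>j<d. if j = i then entry ?A l i else 0)"
      unfolding entry_times[OF A] by (intro sum.cong refl) (auto simp: e_def entry_fdiag i)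
    then show ?thesis using i by simp
  qed
  then have "(\<Sum>l<d. (cmod (entry ?A l i))\<^sup>2) = (\<Sum>l<d. (cmod (entry (act V w e) l i))\<^sup>2)"
    by (simp add: Ae)
  also have "\<dots> \<le> (\<Sum>j<d. \<Sum>l<d. (cmod (entry (act V w e) l j))\<^sup>2)"
    using i by (intro member_le_sum) (auto intro!: sum_nonneg)
  also have "\<dots> = (norm (act V w e))\<^sup>2"
    using supported_act[OF sup w e] by (simp add: norm_sq_eq)
  also have "\<dots> \<le> (norm e)\<^sup>2" using norm_act_le[OF w] by (intro power_mono) auto
  also have "\<dots> = (\<Sum>j<d. \<Sum>l<d. if l = i \<and> j = i then 1 else 0)"
    unfolding norm_sq_eq[OF e] by (intro sum.cong refl) (auto simp: e_def entry_fdiag)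
  also have "\<dots> = (\<Sum>j<d. if j = i then 1 else 0)"
    using i by (intro sum.cong refl) auto
  also have "\<dots> = 1" using i by simp
  finally show ?thesis .
qed

end

context clifford
begin

text \<open>The sum of \<open>(norm (\<Phi> h))\<^sup>2\<close> over all \<open>h\<close> is at
  least m^2 (m^2 q)^2 by the approximate relations, and at most d m^5 by one convolution bound for
  each of the \<open>d\<close> rows. The hypothesis \<open>dim\<close> says that there are as many
  monomials as entries in an \<open>m\<close> by \<open>m\<close> matrix.\<close>

theorem dimension_bound:
  fixes q \<kappa> :: real
  assumes "almost_clifford V N \<rho> \<kappa>"
    and V_supported: "\<And>i. i < N \<Longrightarrow> supported d (V i)"
    and rho: "supported d \<rho>" "trnorm \<rho> \<le> 1"
    and dim: "2 ^ N = m\<^sup>2"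
    and q: "0 \<le> q" "q \<le> Re (tr \<rho>) - 2 * N * (N * ((2 * N + 1) * \<kappa>))"
  shows "q\<^sup>2 * m \<le> d"
proof -
  interpret V: almost_clifford V N \<rho> \<kappa> by fact
  obtain L R where LR: "supported d L" "\<rho> = L * R" "norm L \<le> 1" "norm R \<le> 1"
  proof -
    obtain L R where "supported d L" "\<rho> = L * R" "(norm L)\<^sup>2 = trnorm \<rho>" "(norm R)\<^sup>2 = trnorm \<rho>"
      using trnorm_attained[OF rho(1)] by metis
    then show ?thesis
      using that rho(2) power_le_one_iff[of "norm L" 2] power_le_one_iff[of "norm R" 2] by simp
  qed
  let ?F = "Pow {..<N}" and ?E = "fdiag d (\<lambda>_. 1)"
  have card: "real (card ?F) = (real m)\<^sup>2" using dim by (simp add: card_Pow flip: of_nat_power)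
  note wN = set_word_subset[of N]
  \<comment> \<open>The outer word of \<open>h\<close> and the half \<open>R\<close> of
    \<open>\<rho>\<close> are left out. In the trace they cost nothing, being a product of
    contractions and a matrix of norm at most 1; what remains is a matrix-valued twisted
    convolution.\<close>
  define \<Phi> where "\<Phi> h = (\<Sum>g\<in>?F. twist N g h *\<^sub>R act V (rev (word N g)) (act V (word N (sym_diff g h)) L))" for h
  have lower: "(real m)\<^sup>2 * q \<le> norm (\<Phi> h)" if h: "h \<in> ?F" for h
  proof -
    have "q \<le> Re (tr (twist N g h *\<^sub>R act V (rev (word N h)) (act V (rev (word N g)) (act V (word N (sym_diff g h)) \<rho>))))"
      (is "q \<le> Re (tr (_ *\<^sub>R ?A))") if g: "g \<in> ?F" for g
    proof -
      let ?w = "rev (word N h) @ rev (word N g)"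
      have w: "set ?w \<subseteq> {..<N}" by (simp add: wN)
      have "wset ?w (sym_diff g h) = {}" using g h by (auto simp: wset_append wset_distinct)
      then have *: "trnorm (?A - twist N g h *\<^sub>R \<rho>) \<le> length ?w * (N * V.swap_error)"
        using V.word_act[OF w, of "sym_diff g h"] by (simp add: act_append twist_def)
      have tt: "twist N g h * twist N g h = 1" by (simp add: twist_def wsign_sq)
      have "real (length ?w) \<le> 2 * N" using length_word_le[of N g] length_word_le[of N h] by simp
      then have "length ?w * (N * V.swap_error) \<le> 2 * N * (N * V.swap_error)"
        using V.swap_error_nonneg by (intro mult_right_mono) auto
      with * have err: "trnorm (?A - twist N g h *\<^sub>R \<rho>) \<le> 2 * N * (N * V.swap_error)" by linarith
      have "\<rho> - twist N g h *\<^sub>R ?A = (- twist N g h) *\<^sub>R (?A - twist N g h *\<^sub>R \<rho>)"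
        using tt by (simp add: scaleR_diff_right)
      moreover have "trnorm ((- twist N g h) *\<^sub>R X) = trnorm X" for X
        using wsign_abs[of ?w "sym_diff g h"] by (cases "twist N g h = 1") (auto simp: twist_def abs_if split: if_splits)
      ultimately have "Re (tr (\<rho> - twist N g h *\<^sub>R ?A)) \<le> 2 * N * (N * V.swap_error)"
        using re_tr_le_trnorm[of "\<rho> - twist N g h *\<^sub>R ?A"] err by simp
      then show ?thesis using q(2) by (simp add: V.swap_error_def)
    qed
    then have "(\<Sum>g\<in>?F. q) \<le> (\<Sum>g\<in>?F. Re (tr (twist N g h *\<^sub>R act V (rev (word N h)) (act V (rev (word N g)) (act V (word N (sym_diff g h)) \<rho>)))))"
      by (rule sum_mono)
    also have "\<dots> = Re (tr (act V (rev (word N h)) (\<Phi> h) * R))"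
      by (simp add: \<Phi>_def LR(2) act_times act_sum act_scaleR sum_distrib_right tr_sum)
    also have "\<dots> \<le> norm (act V (rev (word N h)) (\<Phi> h))"
      by (rule order_trans[OF re_tr_le_trnorm trnorm_times_left_le[OF LR(4)]])
    also have "\<dots> \<le> norm (\<Phi> h)" by (rule V.norm_act_le) (simp add: wN)
    finally show ?thesis using card by simp
  qed
  have act_sup: "supported d (act V (word N S) M)" if "supported d M" for S M
    using V_supported wN that by (rule V.supported_act)
  have Phi_sup: "supported d (\<Phi> h)" for h
    unfolding \<Phi>_def using V_supported wN LR(1)
    by (intro supported_sum supported_scaleR V.supported_act) auto
  \<comment> \<open>Entry \<open>(i, c)\<close> of \<open>\<Phi> h\<close> is a twisted convolution
    of \<open>x i\<close>, taken from column \<open>i\<close> of the words as matrices, with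
    \<open>y c\<close>, taken from column \<open>c\<close> of the words applied to
    \<open>L\<close>.\<close>
  define x where "x i l g = entry (act V (word N g) ?E) l i" for i l g
  define y where "y c l S = entry (act V (word N S) L) l c" for c l S
  have Phi_entry: "entry (\<Phi> h) i c =
      (\<Sum>l<d. \<Sum>g\<in>?F. of_real (twist N g h) * (cnj (x i l g) * y c l (sym_diff g h)))" for h i c
  proof -
    have "entry (act V (rev (word N g)) Y) i c = (\<Sum>l<d. cnj (x i l g) * entry Y l c)" if Y: "supported d Y" for g Y
    proof -
      have "act V (rev (word N g)) Y = adj (act V (word N g) ?E) * Y"
        using wN V_supported Y by (rule V.adj_act_times[symmetric])
      then show ?thesis using act_sup[of ?E g] by (simp add: entry_times[of d] x_def)
    qed
    then have "entry (\<Phi> h) i c = (\<Sum>g\<in>?F. \<Sum>l<d. of_real (twist N g h) * (cnj (x i l g) * y c l (sym_diff g h)))"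
      using act_sup[OF LR(1)] by (simp add: \<Phi>_def entry_sum y_def sum_distrib_left)
    also have "\<dots> = (\<Sum>l<d. \<Sum>g\<in>?F. of_real (twist N g h) * (cnj (x i l g) * y c l (sym_diff g h)))"
      by (rule sum.swap)
    finally show ?thesis .
  qed
  \<comment> \<open>This bound holds for each \<open>i\<close> separately, so the sum over
    \<open>i\<close> produces the factor \<open>d\<close>. The bound for \<open>y\<close> covers all
    columns \<open>c\<close> together, because \<open>L\<close> has norm at most 1.\<close>
  have X: "(\<Sum>l<d. \<Sum>g\<in>?F. (cmod (x i l g))\<^sup>2) \<le> (real m)\<^sup>2" if i: "i < d" for i
  proof -
    have "(\<Sum>l<d. \<Sum>g\<in>?F. (cmod (x i l g))\<^sup>2) = (\<Sum>g\<in>?F. \<Sum>l<d. (cmod (x i l g))\<^sup>2)"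
      by (rule sum.swap)
    also have "\<dots> \<le> (\<Sum>g\<in>?F. 1)"
      unfolding x_def using V_supported wN i by (intro sum_mono V.column_act_le)
    finally show ?thesis using card by simp
  qed
  have Y: "(\<Sum>c<d. \<Sum>l<d. \<Sum>g\<in>?F. (cmod (y c l g))\<^sup>2) \<le> (real m)\<^sup>2"
  proof -
    have "(\<Sum>c<d. \<Sum>l<d. \<Sum>g\<in>?F. (cmod (y c l g))\<^sup>2) = (\<Sum>c<d. \<Sum>g\<in>?F. \<Sum>l<d. (cmod (y c l g))\<^sup>2)"
      by (intro sum.cong refl sum.swap)
    also have "\<dots> = (\<Sum>g\<in>?F. \<Sum>c<d. \<Sum>l<d. (cmod (y c l g))\<^sup>2)"
      by (rule sum.swap)
    also have "\<dots> = (\<Sum>g\<in>?F. (norm (act V (word N g) L))\<^sup>2)"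
      using act_sup[OF LR(1)] by (simp add: norm_sq_eq[of d] y_def)
    also have "\<dots> \<le> (\<Sum>g\<in>?F. 1)"
      using order_trans[OF V.norm_act_le[OF wN] LR(3)] by (intro sum_mono) (simp add: power_le_one)
    finally show ?thesis using card by simp
  qed
  have upper: "(\<Sum>h\<in>?F. (norm (\<Phi> h))\<^sup>2) \<le> d * m * (real m)\<^sup>2 * (real m)\<^sup>2"
  proof -
    have "(\<Sum>h\<in>?F. (norm (\<Phi> h))\<^sup>2) = (\<Sum>h\<in>?F. \<Sum>c<d. \<Sum>i<d. (cmod (entry (\<Phi> h) i c))\<^sup>2)"
      using Phi_sup by (simp add: norm_sq_eq[of d])
    also have "\<dots> = (\<Sum>c<d. \<Sum>h\<in>?F. \<Sum>i<d. (cmod (entry (\<Phi> h) i c))\<^sup>2)"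
      by (rule sum.swap)
    also have "\<dots> = (\<Sum>c<d. \<Sum>i<d. \<Sum>h\<in>?F. (cmod (entry (\<Phi> h) i c))\<^sup>2)"
      by (intro sum.cong refl sum.swap)
    also have "\<dots> \<le> (\<Sum>c<d. \<Sum>i<d. m * (real m)\<^sup>2 * (\<Sum>l<d. \<Sum>g\<in>?F. (cmod (y c l g))\<^sup>2))"
    proof (intro sum_mono)
      fix c i assume "i \<in> {..<d}"
      then have i: "i < d" by simp
      have "(\<Sum>h\<in>?F. (cmod (entry (\<Phi> h) i c))\<^sup>2) \<le>
          m * (\<Sum>l<d. \<Sum>g\<in>?F. (cmod (x i l g))\<^sup>2) * (\<Sum>l<d. \<Sum>g\<in>?F. (cmod (y c l g))\<^sup>2)"
        unfolding Phi_entry by (rule twisted_convolution_bound)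
      also have "\<dots> \<le> m * (real m)\<^sup>2 * (\<Sum>l<d. \<Sum>g\<in>?F. (cmod (y c l g))\<^sup>2)"
        using X[OF i] by (intro mult_right_mono mult_left_mono) (auto intro!: sum_nonneg)
      finally show "(\<Sum>h\<in>?F. (cmod (entry (\<Phi> h) i c))\<^sup>2) \<le> m * (real m)\<^sup>2 * (\<Sum>l<d. \<Sum>g\<in>?F. (cmod (y c l g))\<^sup>2)" .
    qed
    also have "\<dots> = d * m * (real m)\<^sup>2 * (\<Sum>c<d. \<Sum>l<d. \<Sum>g\<in>?F. (cmod (y c l g))\<^sup>2)"
      by (simp add: sum_distrib_left mult.assoc)
    also have "\<dots> \<le> d * m * (real m)\<^sup>2 * (real m)\<^sup>2"
      using Y by (intro mult_left_mono) auto
    finally show ?thesis .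
  qed
  have "(real m)\<^sup>2 * ((real m)\<^sup>2 * q)\<^sup>2 = (\<Sum>h\<in>?F. ((real m)\<^sup>2 * q)\<^sup>2)" using card by simp
  also have "\<dots> \<le> (\<Sum>h\<in>?F. (norm (\<Phi> h))\<^sup>2)"
    using lower q(1) by (intro sum_mono power_mono) auto
  also note upper
  finally have "real m ^ 5 * (q\<^sup>2 * m) \<le> real m ^ 5 * d"
    by (simp add: power_mult_distrib power_numeral_reduce mult_ac)
  then show ?thesis using m_pos by simp
qed

end

section \<open>Clifford generators\<close>

text \<open>The Kronecker product of a two by two matrix \<open>z\<close> with an \<open>n\<close>
  by \<open>n\<close> matrix \<open>A\<close>: block \<open>(a, b)\<close> is \<open>z a b\<close>
  times \<open>A\<close>. Only the values of \<open>z\<close> at 0 and 1 matter, hence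
  \<open>kron2_cong\<close>.\<close>

definition kron2 :: "nat \<Rightarrow> fmat \<Rightarrow> (nat \<Rightarrow> nat \<Rightarrow> complex) \<Rightarrow> fmat"
  where "kron2 n A z = Abs_fmat (\<lambda>i j. if i < 2 * n \<and> j < 2 * n
    then z (i div n) (j div n) * entry A (i mod n) (j mod n) else 0)"

lemma entry_kron2: "entry (kron2 n A z) i j =
    (if i < 2 * n \<and> j < 2 * n then z (i div n) (j div n) * entry A (i mod n) (j mod n) else 0)"
proof -
  have "\<exists>d. \<forall>i j. d \<le> i \<or> d \<le> j \<longrightarrow>
      (if i < 2 * n \<and> j < 2 * n then z (i div n) (j div n) * entry A (i mod n) (j mod n) else 0) = 0"
    by (intro exI[of _ "2 * n"]) auto
  then show ?thesis unfolding kron2_def by (subst Abs_fmat_inverse) auto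
qed

lemma supported_kron2 [simp]: "supported (2 * n) (kron2 n A z)"
  by (rule supportedI) (auto simp: entry_kron2)

lemma kron2_cong: "(\<And>a b. a < 2 \<Longrightarrow> b < 2 \<Longrightarrow> z a b = w a b) \<Longrightarrow> kron2 n A z = kron2 n A w"
  by (rule fmat_eqI) (auto simp: entry_kron2 less_mult_imp_div_less)

lemma adj_kron2: "adj (kron2 n A z) = kron2 n (adj A) (\<lambda>a b. cnj (z b a))"
  by (rule fmat_eqI) (auto simp: entry_kron2)

lemma kron2_uminus_left: "kron2 n (- A) z = - kron2 n A z"
  by (rule fmat_eqI) (auto simp: entry_kron2)

lemma kron2_uminus_right: "kron2 n A (\<lambda>a b. - z a b) = - kron2 n A z"
  by (rule fmat_eqI) (auto simp: entry_kron2)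

lemma sum_lessThan_add: "(\<Sum>r<n + k. f r) = (\<Sum>r<n. f r) + (\<Sum>r<k. f (n + r))"
  for f :: "nat \<Rightarrow> 'a::comm_monoid_add"
  by (induction k) (auto simp: add.assoc)

lemma kron2_mult:
  assumes A: "supported n A"
  shows "kron2 n A z * kron2 n B w = kron2 n (A * B) (\<lambda>a b. z a 0 * w 0 b + z a 1 * w 1 b)"
proof (rule fmat_eqI)
  fix i j
  show "entry (kron2 n A z * kron2 n B w) i j = entry (kron2 n (A * B) (\<lambda>a b. z a 0 * w 0 b + z a 1 * w 1 b)) i j"
  proof (cases "i < 2 * n \<and> j < 2 * n")
    case True
    define f where "f r = entry (kron2 n A z) i r * entry (kron2 n B w) r j" for r
    have n: "0 < n" using True by auto
    have 0: "(\<Sum>r<n. f r) = (\<Sum>r<n. z (i div n) 0 * w 0 (j div n) * (entry A (i mod n) r * entry B r (j mod n)))"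
      using True by (intro sum.cong refl) (auto simp: f_def entry_kron2)
    have 1: "(\<Sum>r<n. f (n + r)) = (\<Sum>r<n. z (i div n) 1 * w 1 (j div n) * (entry A (i mod n) r * entry B r (j mod n)))"
      using True n by (intro sum.cong refl) (auto simp: f_def entry_kron2)
    have "entry (kron2 n A z * kron2 n B w) i j = (\<Sum>r<n + n. f r)"
      unfolding entry_times[OF supported_kron2] by (simp add: f_def mult_2)
    also have "\<dots> = (\<Sum>r<n. f r) + (\<Sum>r<n. f (n + r))"
      by (rule sum_lessThan_add)
    also have "\<dots> = (z (i div n) 0 * w 0 (j div n) + z (i div n) 1 * w 1 (j div n)) * (\<Sum>r<n. entry A (i mod n) r * entry B r (j mod n))"
      unfolding 0 1 by (simp add: sum_distrib_left distrib_right)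
    finally show ?thesis using True by (simp add: entry_kron2 entry_times[OF A])
  next
    case False
    then have "2 * n \<le> i \<or> 2 * n \<le> j" by auto
    moreover have "supported (2 * n) (kron2 n A z * kron2 n B w)" by simp
    ultimately have "entry (kron2 n A z * kron2 n B w) i j = 0" by (intro supportedD)
    then show ?thesis using False by (auto simp: entry_kron2)
  qed
qed

definition pauli_I :: "nat \<Rightarrow> nat \<Rightarrow> complex" where "pauli_I a b = (if a = b then 1 else 0)"
definition pauli_X :: "nat \<Rightarrow> nat \<Rightarrow> complex" where "pauli_X a b = (if a = b then 0 else 1)"
definition pauli_Y :: "nat \<Rightarrow> nat \<Rightarrow> complex" where "pauli_Y a b = (if a = b then 0 else if a = 0 then - \<i> else \<i>)"
definition pauli_Z :: "nat \<Rightarrow> nat \<Rightarrow> complex" where "pauli_Z a b = (if a = b then (if a = 0 then 1 else - 1) else 0)"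

lemmas pauli_defs = pauli_I_def pauli_X_def pauli_Y_def pauli_Z_def

lemma kron2_one: "kron2 n (fdiag n (\<lambda>_. 1)) pauli_I = fdiag (2 * n) (\<lambda>_. 1)"
proof (rule fmat_eqI)
  fix i j
  have "i div n = j div n \<Longrightarrow> i mod n = j mod n \<Longrightarrow> i = j" by (metis div_mult_mod_eq)
  then show "entry (kron2 n (fdiag n (\<lambda>_. 1)) pauli_I) i j = entry (fdiag (2 * n) (\<lambda>_. 1)) i j"
    by (cases "n = 0") (auto simp: entry_kron2 entry_fdiag pauli_I_def)
qed

text \<open>The Jordan-Wigner construction: the old generators are twisted by Z, and X and Y on the
  new factor supply two more while the size doubles.\<close>

fun gamma :: "nat \<Rightarrow> nat \<Rightarrow> fmat"
  where "gamma 0 i = 0"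
  | "gamma (Suc k) i = (if i < 2 * k then kron2 (2 ^ k) (gamma k i) pauli_Z
      else kron2 (2 ^ k) (fdiag (2 ^ k) (\<lambda>_. 1)) (if i = 2 * k then pauli_X else pauli_Y))"

lemma clifford_gamma: "clifford (gamma k) (2 * k) (2 ^ k)"
proof (induction k)
  case 0
  then show ?case by standard auto
next
  case (Suc k)
  let ?n = "2 ^ k :: nat"
  let ?E = "fdiag ?n (\<lambda>_. 1)"
  interpret clifford "gamma k" "2 * k" ?n by fact
  have last: "i = 2 * k \<or> i = 2 * k + 1" if "i < 2 * Suc k" "\<not> i < 2 * k" for i using that by auto
  have EE: "?E * ?E = ?E" by simp
  have sq: "kron2 ?n A z * kron2 ?n A z = fdiag (2 * ?n) (\<lambda>_. 1)"
    if "supported ?n A" "A * A = ?E" "z \<in> {pauli_X, pauli_Y, pauli_Z}" for A z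
  proof -
    have "kron2 ?n A z * kron2 ?n A z = kron2 ?n ?E pauli_I"
      unfolding kron2_mult[OF that(1)] that(2)
      using that(3) by (intro kron2_cong) (auto simp: pauli_defs less_2_cases_iff)
    then show ?thesis by (simp add: kron2_one)
  qed
  \<comment> \<open>This covers commuting factors \<open>A\<close>, \<open>B\<close> with distinct
    Pauli matrices. Two old generators share \<open>pauli_Z\<close> and are treated through
    \<open>G_anti\<close> instead.\<close>
  have anti: "kron2 ?n A z * kron2 ?n B w = - (kron2 ?n B w * kron2 ?n A z)"
    if "supported ?n A" "supported ?n B" "A * B = B * A" "z \<in> {pauli_X, pauli_Y, pauli_Z}"
      "w \<in> {pauli_X, pauli_Y, pauli_Z}" "z \<noteq> w" for A B z w
    unfolding kron2_mult[OF that(1)] kron2_mult[OF that(2)] that(3) kron2_uminus_right[symmetric]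
    using that(4-) by (intro kron2_cong) (auto simp: pauli_defs less_2_cases_iff)
  have adjE: "kron2 ?n A (\<lambda>a b. cnj (z b a)) = kron2 ?n A z"
    if "z \<in> {pauli_X, pauli_Y, pauli_Z}" for A z
    using that by (intro kron2_cong) (auto simp: pauli_defs less_2_cases_iff)
  have neq: "pauli_X \<noteq> pauli_Y" "pauli_Y \<noteq> pauli_X" "pauli_Z \<noteq> pauli_X" "pauli_X \<noteq> pauli_Z"
    "pauli_Z \<noteq> pauli_Y" "pauli_Y \<noteq> pauli_Z"
  proof -
    have "pauli_X 0 1 \<noteq> pauli_Y 0 1" "pauli_X 0 0 \<noteq> pauli_Z 0 0" "pauli_Y 0 0 \<noteq> pauli_Z 0 0"
      by (simp_all add: pauli_defs complex_eq_iff)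
    then show "pauli_X \<noteq> pauli_Y" "pauli_Y \<noteq> pauli_X" "pauli_Z \<noteq> pauli_X" "pauli_X \<noteq> pauli_Z"
      "pauli_Z \<noteq> pauli_Y" "pauli_Y \<noteq> pauli_Z" by metis+
  qed
  show ?case
  proof
    fix i assume i: "i < 2 * Suc k"
    show "supported (2 ^ Suc k) (gamma (Suc k) i)" by simp
    show "adj (gamma (Suc k) i) = gamma (Suc k) i"
      using i by (auto simp: adj_kron2 adjE G_adj)
    show "gamma (Suc k) i * gamma (Suc k) i = fdiag (2 ^ Suc k) (\<lambda>_. 1)"
      using i by (auto simp: sq G_supported G_square EE)
    fix j assume j: "j < 2 * Suc k" and ij: "i \<noteq> j"
    consider "i < 2 * k" "j < 2 * k" | "i < 2 * k" "\<not> j < 2 * k" | "\<not> i < 2 * k" "j < 2 * k"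
      | "\<not> i < 2 * k" "\<not> j < 2 * k" by blast
    then show "gamma (Suc k) i * gamma (Suc k) j = - (gamma (Suc k) j * gamma (Suc k) i)"
    proof cases
      case 1
      then show ?thesis using G_anti[OF 1 ij]
        by (simp add: kron2_mult G_supported kron2_uminus_left)
    next
      case 2
      then show ?thesis
        by (auto simp: G_supported fdiag_one_times times_fdiag_one neq intro!: anti)
    next
      case 3
      then show ?thesis
        by (auto simp: G_supported fdiag_one_times times_fdiag_one neq intro!: anti)
    next
      case 4
      then show ?thesis using last[OF i] last[OF j] ij
        by (auto simp: neq intro!: anti)
    qed
  qed auto
qed

section \<open>Distances between the Clifford points\<close>

context clifford
begin

lemma tr_G [simp]: "i < N \<Longrightarrow> tr (G i) = 0"
proof -
  assume i: "i < N"
  have "word N {i} = [i]" unfolding word_split[OF i] by simp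
  then have "monomial {i} = G i" using i by (simp add: monomial_def times_fdiag_one G_supported)
  then show ?thesis using tr_monomial[of "{i}"] i by simp
qed

lemma tr_G_mult: "i < N \<Longrightarrow> j < N \<Longrightarrow> tr (G i * G j) = (if i = j then of_nat m else 0)"
proof (cases "i = j")
  case False
  assume ij: "i < N" "j < N"
  have "tr (G i * G j) = - tr (G i * G j)"
    using G_anti[OF ij False] by (metis tr_commute tr_uminus)
  then show ?thesis using False by simp
qed (simp add: G_square)

lemma norm_one_sq: "(norm one)\<^sup>2 = m"
  by (simp add: power2_norm_eq_inner inner_fmat)

lemma trnorm_scaled_one: "0 \<le> r \<Longrightarrow> trnorm (r *\<^sub>R one) = r * m"
proof -
  assume r: "0 \<le> r"
  have "trnorm one \<le> m" using trnorm_times_le[of one one] norm_one_sq by (simp add: power2_eq_square)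
  moreover have "trnorm one \<ge> m" using re_tr_le_trnorm[of one] by simp
  ultimately show ?thesis using trnorm_scaleR[OF r, of one] by simp
qed

text \<open>\<open>?B\<close> is Hermitian with square \<open>2 *\<^sub>R ?B\<close>, so it is twice
  a projection and its trace norm is its trace; the latter is \<open>m\<close> because
  \<open>G i\<close> is traceless.\<close>

lemma trnorm_one_minus_G:
  assumes i: "i < N" and s: "s\<^sup>2 = 1"
  shows "trnorm (one - s *\<^sub>R G i) \<le> m"
proof -
  let ?B = "one - s *\<^sub>R G i"
  have adjB: "adj ?B = ?B" using i by (simp add: G_adj)
  have BB: "?B * ?B = 2 *\<^sub>R ?B"
  proof -
    have "?B * ?B = one - s *\<^sub>R G i - s *\<^sub>R G i + s\<^sup>2 *\<^sub>R one"
      using i by (simp add: algebra_simps fdiag_one_times times_fdiag_one G_supported G_square power2_eq_square)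
    then show ?thesis by (simp add: s scaleR_2)
  qed
  have "2 * trnorm ?B = trnorm (?B * ?B)" unfolding BB by (simp add: trnorm_scaleR)
  also have "\<dots> \<le> (norm ?B)\<^sup>2" using trnorm_times_le[of ?B ?B] by (simp add: power2_eq_square)
  also have "\<dots> = Re (tr (?B * ?B))" unfolding power2_norm_eq_inner inner_fmat adjB ..
  also have "\<dots> = 2 * m" unfolding BB using i by simp
  finally show ?thesis by simp
qed

lemma trnorm_G_ge:
  assumes "i < N" shows "trnorm (2 *\<^sub>R G i) \<ge> 2 * m"
  using re_tr_contraction_le[OF G_contraction[OF assms], of "2 *\<^sub>R G i"] assms by (simp add: tr_G_mult)

text \<open>By anticommutation the Hermitian matrix \<open>?B\<close> has square
  \<open>2 *\<^sub>R one\<close>; divided by sqrt 2 it is a contraction and serves as its own dual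
  witness.\<close>

lemma trnorm_G_plus_G_ge:
  assumes ij: "i < N" "j < N" "i \<noteq> j" and s: "s\<^sup>2 = 1"
  shows "trnorm (G i + s *\<^sub>R G j) \<ge> sqrt 2 * m"
proof -
  let ?B = "G i + s *\<^sub>R G j"
  let ?T = "(1 / sqrt 2) *\<^sub>R ?B"
  have adjB: "adj ?B = ?B" using ij by (simp add: G_adj)
  have BB: "?B * ?B = 2 *\<^sub>R one"
    using ij s G_anti[OF ij] by (simp add: algebra_simps G_square scaleR_2 power2_eq_square)
  have "?T * ?T = (1 / sqrt 2 * (1 / sqrt 2)) *\<^sub>R (?B * ?B)" by (simp del: scaleR_add_right)
  then have "?T * ?T = one" unfolding BB by simp
  moreover have "adj ?T = ?T" using adjB by simp
  ultimately have "contraction ?T" by (intro contraction_of_square)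
  from re_tr_contraction_le[OF this, of ?B] have "Re (tr (?T * ?B)) \<le> trnorm ?B" .
  also have "?T * ?B = (1 / sqrt 2) *\<^sub>R (?B * ?B)" by (simp del: scaleR_add_right)
  finally show ?thesis unfolding BB by (simp add: real_div_sqrt)
qed

end

section \<open>The points\<close>

definition to_mat :: "nat \<Rightarrow> fmat \<Rightarrow> complex mat"
  where "to_mat m M = mat m m (\<lambda>(i, j). entry M i j)"

lemma to_mat_carrier [simp]: "to_mat m M \<in> carrier_mat m m"
  by (simp add: to_mat_def)

lemma of_mat_to_mat [simp]: "supported m M \<Longrightarrow> of_mat (to_mat m M) = M"
  unfolding to_mat_def by (rule supported_eq_of_mat[symmetric])

lemma schatten1_norm_diff:
  assumes "A \<in> carrier_mat d d" "B \<in> carrier_mat d d"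
  shows "schatten1_norm (A - B) = trnorm (of_mat A - of_mat B)"
  using schatten1_norm_eq_trnorm[OF minus_carrier_mat[OF assms(2)]] of_mat_minus[OF assms] by simp

text \<open>The last case is needed only for odd \<open>n\<close>, where it supplies two points that play no further role.\<close>

definition clifford_point :: "nat \<Rightarrow> nat \<Rightarrow> fmat"
  where "clifford_point k i =
    (if i = 1 then fdiag (2 ^ k) (\<lambda>_. 1) else if i = 2 then - fdiag (2 ^ k) (\<lambda>_. 1)
     else if i \<le> 4 * k + 2 then (if odd i then 1 else - 1) *\<^sub>R gamma k ((i - 3) div 2)
     else real i *\<^sub>R fdiag (2 ^ k) (\<lambda>_. 1))"

lemma gamma_index: "3 \<le> i \<Longrightarrow> i \<le> 4 * k + 2 \<Longrightarrow> (i - 3) div 2 < 2 * k" for i k :: nat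
  by auto

lemma supported_clifford_point:
  assumes "1 \<le> i"
  shows "supported (2 ^ k) (clifford_point k i)"
proof -
  interpret clifford "gamma k" "2 * k" "2 ^ k" by (rule clifford_gamma)
  show ?thesis using assms gamma_index[of i k] by (auto simp: clifford_point_def G_supported)
qed

lemma half_index:
  fixes l :: nat
  assumes "3 \<le> l"
  shows "l = 2 * ((l - 3) div 2) + (if odd l then 3 else 4)"
proof -
  from assms obtain b where b: "l = 3 + b" by (rule le_Suc_ex[THEN exE])
  show ?thesis unfolding b by (cases "even b") (auto elim!: oddE evenE)
qed

text \<open>The trace separates the multiples of the identity from each other and from the traceless
  signed generators; those are told apart by the trace against a generator.\<close>

lemma inj_on_clifford_point: "inj_on (clifford_point k) {1..}"
proof (rule inj_onI)
  fix i j :: nat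
  assume ij: "i \<in> {1..}" "j \<in> {1..}" and eq: "clifford_point k i = clifford_point k j"
  interpret clifford "gamma k" "2 * k" "2 ^ k" by (rule clifford_gamma)
  let ?e = "\<lambda>i. if i = 1 then 1 else if i = 2 then - 1 else if i \<le> 4 * k + 2 then 0 else real i"
  have e: "Re (tr (clifford_point k i)) = 2 ^ k * ?e i" if "1 \<le> i" for i
    using that gamma_index[of i k] by (auto simp: clifford_point_def)
  have "?e i = ?e j" using e[of i] e[of j] eq ij by simp
  then consider "i = j" | "3 \<le> i" "i \<le> 4 * k + 2" "3 \<le> j" "j \<le> 4 * k + 2"
    using ij by (auto split: if_splits)
  then show "i = j"
  proof cases
    case 2
    define s where "s i = (if odd i then 1 else - 1 :: real)" for i :: nat
    have p: "clifford_point k i = s i *\<^sub>R gamma k ((i - 3) div 2)"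
      "clifford_point k j = s j *\<^sub>R gamma k ((j - 3) div 2)"
      using 2 by (auto simp: clifford_point_def s_def)
    have "Re (tr (gamma k ((i - 3) div 2) * clifford_point k i)) = Re (tr (gamma k ((i - 3) div 2) * clifford_point k j))"
      by (simp add: eq)
    then have "s i = (if (i - 3) div 2 = (j - 3) div 2 then s j else 0)"
      using gamma_index 2 unfolding p by (auto simp: tr_G_mult)
    then have "(i - 3) div 2 = (j - 3) div 2" "odd i = odd j"
      by (auto simp: s_def split: if_splits)
    then have "2 * ((i - 3) div 2) + (if odd i then 3 else 4) = 2 * ((j - 3) div 2) + (if odd j then 3 else 4)"
      by simp
    then show ?thesis by (rule trans[OF half_index[OF 2(1)] trans[OF _ half_index[OF 2(3), symmetric]]])
  qed
qed

text \<open>The 6000 keeps the total error 2n * n * 3n * 189 t + 189 t at or below 1134/6000 +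
  189/6000 < 1/4. This allows \<open>q = 3 / 4\<close> in \<open>dimension_bound\<close>, and its
  square 9/16 exceeds the required 1/2.\<close>

lemma embedding_dimension_bound:
  fixes n d :: nat
  defines "k \<equiv> n div 2"
  assumes n: "1 \<le> n" and emb: "embeds_S1 (2 * n + 2) (\<lambda>i. to_mat (2 ^ k) (clifford_point k i)) d (1 + t ^ 8)"
    and t: "t = 1 / (6000 * real n ^ 3)"
  shows "2 ^ k \<le> 2 * d"
proof -
  define m :: nat where "m = 2 ^ k"
  interpret clifford "gamma k" "2 * k" m unfolding m_def by (rule clifford_gamma)
  have m0: "0 < real m" using m_pos by simp
  obtain A' where A': "\<And>i. i \<in> {1..2 * n + 2} \<Longrightarrow> A' i \<in> carrier_mat d d"
    and dist: "\<And>i j. i \<in> {1..2 * n + 2} \<Longrightarrow> j \<in> {1..2 * n + 2} \<Longrightarrow>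
      schatten1_norm (A' i - A' j) \<le> schatten1_norm (to_mat (2 ^ k) (clifford_point k i) - to_mat (2 ^ k) (clifford_point k j)) \<and>
      schatten1_norm (to_mat (2 ^ k) (clifford_point k i) - to_mat (2 ^ k) (clifford_point k j)) \<le> (1 + t ^ 8) * schatten1_norm (A' i - A' j)"
    using emb unfolding embeds_S1_def by blast
  define P where "P = clifford_point k"
  \<comment> \<open>Rescaled so that the distance from the identity to its negative, which is
    \<open>2 * m\<close>, becomes 2.\<close>
  define Y where "Y i = (1 / m) *\<^sub>R of_mat (A' i)" for i
  have kn: "2 * k \<le> n" by (simp add: k_def)
  have Y_sup: "supported d (Y i)" if "i \<in> {1..2 * n + 2}" for i
    using supported_of_mat[OF A'[OF that]] by (simp add: Y_def)
  have n3: "1 \<le> real n ^ 3" using n by (simp add: one_le_power)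
  have t0: "0 < t" using n by (simp add: t)
  have t1: "t \<le> 1 / 6000" unfolding t using n3 n by (intro divide_left_mono) auto
  have Y_dist: "m * trnorm (Y i - Y j) \<le> trnorm (P i - P j)" "trnorm (P i - P j) \<le> (1 + t ^ 8) * (m * trnorm (Y i - Y j))"
    if ij: "i \<in> {1..2 * n + 2}" "j \<in> {1..2 * n + 2}" for i j
  proof -
    have "trnorm (Y i - Y j) = 1 / m * trnorm (of_mat (A' i) - of_mat (A' j))"
      unfolding Y_def scaleR_diff_right[symmetric] by (rule trnorm_scaleR) simp
    then have "m * trnorm (Y i - Y j) = schatten1_norm (A' i - A' j)"
      using schatten1_norm_diff[OF A'[OF ij(1)] A'[OF ij(2)]] m0 by simp
    moreover have "trnorm (P i - P j) = schatten1_norm (to_mat (2 ^ k) (clifford_point k i) - to_mat (2 ^ k) (clifford_point k j))"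
      using ij schatten1_norm_diff[of "to_mat (2 ^ k) (clifford_point k i)" "2 ^ k" "to_mat (2 ^ k) (clifford_point k j)"]
      by (simp add: supported_clifford_point P_def)
    ultimately show "m * trnorm (Y i - Y j) \<le> trnorm (P i - P j)" "trnorm (P i - P j) \<le> (1 + t ^ 8) * (m * trnorm (Y i - Y j))"
      using dist[OF ij] by simp_all
  qed
  have up: "trnorm (Y i - Y j) \<le> r" if "i \<in> {1..2 * n + 2}" "j \<in> {1..2 * n + 2}" "trnorm (P i - P j) \<le> r * m" for i j and r :: real
  proof -
    have "m * trnorm (Y i - Y j) \<le> m * r" using Y_dist(1)[OF that(1,2)] that(3) by (simp add: mult.commute)
    then show ?thesis using m0 by simp
  qed
  \<comment> \<open>The restriction \<open>r \<le> 2\<close> turns the factor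
    \<open>1 + t ^ 8\<close> into the additive defect \<open>2 * t ^ 8\<close>.\<close>
  have low: "trnorm (Y i - Y j) \<ge> r - 2 * t ^ 8"
    if "i \<in> {1..2 * n + 2}" "j \<in> {1..2 * n + 2}" "trnorm (P i - P j) \<ge> r * m" "0 \<le> r" "r \<le> 2" for i j and r :: real
  proof -
    have "m * r \<le> m * ((1 + t ^ 8) * trnorm (Y i - Y j))"
      using Y_dist(2)[OF that(1,2)] that(3) by (simp add: mult_ac)
    then have 1: "r \<le> (1 + t ^ 8) * trnorm (Y i - Y j)" using m0 by simp
    show ?thesis
    proof (cases "trnorm (Y i - Y j) \<le> 2")
      case True
      then have "t ^ 8 * trnorm (Y i - Y j) \<le> t ^ 8 * 2" using t0 by (intro mult_left_mono) auto
      then show ?thesis using 1 by (simp add: distrib_right)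
    next
      case False
      moreover have "0 \<le> t ^ 8" using t0 by simp
      ultimately show ?thesis using that(5) by linarith
    qed
  qed
  have P1: "P (Suc 0) = one" "P 2 = - one" unfolding P_def by (simp_all add: clifford_point_def m_def)
  have Pp: "P (3 + 2 * j) = gamma k j" and Pq: "P (4 + 2 * j) = - gamma k j" if "j < 2 * k" for j
    using that by (simp_all add: P_def clifford_point_def)
  have idx: "3 + 2 * j \<in> {1..2 * n + 2}" "4 + 2 * j \<in> {1..2 * n + 2}" if "j < 2 * k" for j
    using that kn by auto
  have idx12: "1 \<in> {1..2 * n + 2}" "2 \<in> {1..2 * n + 2}" by auto
  have PPm: "P (Suc 0) - P 2 = 2 *\<^sub>R one" by (simp add: P1 scaleR_2)
  \<comment> \<open>\<open>Y 2\<close>, the image of the negative identity, serves as origin: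
    \<open>a\<close>, \<open>p j\<close> and \<open>q j\<close> are the counterparts of
    \<open>2 *\<^sub>R one\<close>, \<open>one + gamma k j\<close> and
    \<open>one - gamma k j\<close>, up to the scaling by \<open>m\<close>.\<close>
  define a where "a = Y 1 - Y 2"
  define p where "p j = Y (3 + 2 * j) - Y 2" for j
  define q where "q j = Y (4 + 2 * j) - Y 2" for j
  have ap: "a - p j = Y 1 - Y (3 + 2 * j)" and aq: "a - q j = Y 1 - Y (4 + 2 * j)"
    and pq: "p i - q j = Y (3 + 2 * i) - Y (4 + 2 * j)" and pp: "p i - p j = Y (3 + 2 * i) - Y (3 + 2 * j)" for i j
    by (simp_all add: a_def p_def q_def)
  have near: "trnorm (one - gamma k j) \<le> m" "trnorm (one + gamma k j) \<le> m" if "j < 2 * k" for j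
    using trnorm_one_minus_G[OF that, of 1] trnorm_one_minus_G[OF that, of "- 1"] by simp_all
  have near': "trnorm (gamma k j + one) \<le> m" "trnorm (one - gamma k j) \<le> m" if "j < 2 * k" for j
    using near[OF that] by (simp_all add: add.commute)
  have far: "trnorm (gamma k i - gamma k j) \<ge> sqrt 2 * m" "trnorm (gamma k i + gamma k j) \<ge> sqrt 2 * m"
    if "i < 2 * k" "j < 2 * k" "i \<noteq> j" for i j
    using trnorm_G_plus_G_ge[OF that, of "- 1"] trnorm_G_plus_G_ge[OF that, of 1] by simp_all
  obtain \<rho> V where \<rho>: "supported d \<rho>" "trnorm \<rho> \<le> 1" "Re (tr \<rho>) \<ge> 1 - 189 * t"
    and V: "\<And>i. i \<in> {..<2 * k} \<Longrightarrow> supported d (V i)" "\<And>i. i \<in> {..<2 * k} \<Longrightarrow> contraction (V i)"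
      "\<And>i. i \<in> {..<2 * k} \<Longrightarrow> adj (V i) = V i"
      "\<And>i. i \<in> {..<2 * k} \<Longrightarrow> trnorm (V i * \<rho> - \<rho> * V i) \<le> 189 * t"
      "\<And>i. i \<in> {..<2 * k} \<Longrightarrow> trnorm (V i * (V i * \<rho>) - \<rho>) \<le> 189 * t"
      "\<And>i j. i \<in> {..<2 * k} \<Longrightarrow> j \<in> {..<2 * k} \<Longrightarrow> i \<noteq> j \<Longrightarrow> trnorm ((V i * V j + V j * V i) * \<rho>) \<le> 189 * t"
  proof (rule approximate_clifford_relations[of t d a "{..<2 * k}" p q])
    show "trnorm a \<le> 2" unfolding a_def
      by (rule up[OF idx12]) (simp add: PPm trnorm_scaled_one)
    show "2 - 2 * t ^ 8 \<le> trnorm a" unfolding a_def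
      by (rule low[OF idx12]) (simp_all add: PPm trnorm_scaled_one)
    show "supported d a" unfolding a_def using Y_sup idx12 by auto
    fix i assume "i \<in> {..<2 * k}"
    then have i: "i < 2 * k" by simp
    show "supported d (p i)" "supported d (q i)" unfolding p_def q_def using Y_sup idx[OF i] idx12 by auto
    show "trnorm (p i) \<le> 1" unfolding p_def
      by (rule up[OF idx(1)[OF i] idx12(2)]) (use near'[OF i] in \<open>simp add: Pp[OF i] P1\<close>)
    show "trnorm (a - p i) \<le> 1" unfolding ap
      by (rule up[OF idx12(1) idx(1)[OF i]]) (use near[OF i] in \<open>simp add: Pp[OF i] P1\<close>)
    show "trnorm (q i) \<le> 1" unfolding q_def
      by (rule up[OF idx(2)[OF i] idx12(2)]) (use near'[OF i] in \<open>simp add: Pq[OF i] P1\<close>)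
    show "trnorm (a - q i) \<le> 1" unfolding aq
      by (rule up[OF idx12(1) idx(2)[OF i]]) (use near[OF i] in \<open>simp add: Pq[OF i] P1\<close>)
    show "2 - 2 * t ^ 8 \<le> trnorm (p i - q i)" unfolding pq
      by (rule low[OF idx[OF i]]) (use trnorm_G_ge[OF i] in \<open>simp_all add: Pq[OF i] Pp[OF i] scaleR_2\<close>)
    fix j assume "j \<in> {..<2 * k}" and ij: "i \<noteq> j"
    then have j: "j < 2 * k" by simp
    have s2: "0 \<le> sqrt 2" "sqrt 2 \<le> 2" using sqrt_2_le by auto
    show "sqrt 2 - 2 * t ^ 8 \<le> trnorm (p i - p j)" unfolding pp
      by (rule low[OF idx(1)[OF i] idx(1)[OF j] _ s2]) (use far[OF i j ij] in \<open>simp add: Pp[OF i] Pp[OF j]\<close>)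
    show "sqrt 2 - 2 * t ^ 8 \<le> trnorm (p i - q j)" unfolding pq
      by (rule low[OF idx(1)[OF i] idx(2)[OF j] _ s2]) (use far[OF i j ij] in \<open>simp add: Pp[OF i] Pq[OF j]\<close>)
  qed (use t0 t1 in auto)
  have AC: "almost_clifford V (2 * k) \<rho> (189 * t)"
    using V t0 by unfold_locales auto
  have err: "3 / 4 \<le> Re (tr \<rho>) - real (2 * (2 * k)) * (real (2 * k) * (real (2 * (2 * k) + 1) * (189 * t)))"
  proof -
    have "real (2 * k) \<le> real n" using kn by linarith
    then have "real (2 * (2 * k)) * (real (2 * k) * (real (2 * (2 * k) + 1) * (189 * t))) \<le>
        2 * real n * (real n * ((2 * real n + 1) * (189 * t)))"
      using t0 by (intro mult_mono) auto
    also have "\<dots> \<le> 2 * real n * (real n * ((3 * real n) * (189 * t)))"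
      using t0 n by (intro mult_left_mono mult_right_mono) auto
    also have "\<dots> = 1134 * (real n ^ 3 * t)" by (simp add: power3_eq_cube)
    also have "real n ^ 3 * t = 1 / 6000" using n by (simp add: t)
    finally have "real (2 * (2 * k)) * (real (2 * k) * (real (2 * (2 * k) + 1) * (189 * t))) \<le> 1134 / 6000" by simp
    then show ?thesis using \<rho>(3) t1 by linarith
  qed
  have "(3 / 4)\<^sup>2 * m \<le> d"
    by (rule dimension_bound[OF AC _ \<rho>(1,2) _ _ err]) (use V(1) in \<open>auto simp: m_def power_mult_distrib mult.commute simp flip: power_mult\<close>)
  then have "real m \<le> 2 * real d" by (simp add: power2_eq_square)
  then have "m \<le> 2 * d" by linarith
  then show ?thesis by (simp add: m_def)
qed

theorem theorem1:
  shows "\<exists>c C :: real. c > 0 \<and> C > 0 \<and>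
    (\<forall>n m :: nat. n \<ge> 1 \<longrightarrow> m = 2 ^ (n div 2) \<longrightarrow>
      (\<exists>A :: nat \<Rightarrow> complex mat.
        (\<forall>i\<in>{1..2*n+2}. A i \<in> carrier_mat m m) \<and>
        inj_on A {1..2*n+2} \<and>
        (\<forall>d :: nat. d \<ge> 1 \<longrightarrow>
          embeds_S1 (2*n+2) A d (1 + C * real n powr (- c)) \<longrightarrow>
          real d \<ge> 2 powi (int (n div 2) - 1))))"
proof (rule exI[of _ 24], rule exI[of _ "(1 / 6000) ^ 8"], intro conjI allI impI)
  fix n m :: nat
  assume n: "n \<ge> 1" and m: "m = 2 ^ (n div 2)"
  let ?k = "n div 2" and ?t = "1 / (6000 * real n ^ 3)"
  let ?A = "\<lambda>i. to_mat (2 ^ ?k) (clifford_point ?k i)"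
  \<comment> \<open>The exponent 24 is 8 * 3: the distortion defect is \<open>?t ^ 8\<close>, and
    \<open>?t\<close> is of order n^(-3).\<close>
  have t: "(1 / 6000) ^ 8 * real n powr (- 24) = ?t ^ 8"
  proof -
    have "real n powr (- 24) = 1 / real n ^ 24"
      using n powr_realpow[of "real n" 24] by (simp add: powr_minus_divide)
    then show ?thesis by (simp add: power_mult_distrib power_divide flip: power_mult)
  qed
  show "\<exists>A. (\<forall>i\<in>{1..2*n+2}. A i \<in> carrier_mat m m) \<and> inj_on A {1..2*n+2} \<and>
      (\<forall>d\<ge>1. embeds_S1 (2*n+2) A d (1 + (1 / 6000) ^ 8 * real n powr (- 24)) \<longrightarrow>
        real d \<ge> 2 powi (int ?k - 1))"
  proof (intro exI[of _ ?A] conjI ballI allI impI)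
    show "inj_on ?A {1..2*n+2}"
    proof (rule inj_onI)
      fix i j assume ij: "i \<in> {1..2*n+2}" "j \<in> {1..2*n+2}" and "?A i = ?A j"
      then have "of_mat (?A i) = of_mat (?A j)" by simp
      then have "clifford_point ?k i = clifford_point ?k j"
        using ij by (simp add: supported_clifford_point)
      then show "i = j" using inj_onD[OF inj_on_clifford_point, of ?k i j] ij by simp
    qed
  next
    fix d :: nat assume "embeds_S1 (2*n+2) ?A d (1 + (1 / 6000) ^ 8 * real n powr (- 24))"
    then have "2 ^ ?k \<le> 2 * d"
      unfolding t by (rule embedding_dimension_bound[OF n]) simp
    then have "real (2 ^ ?k) \<le> real (2 * d)" by (simp only: of_nat_le_iff)
    then have "2 ^ ?k / 2 \<le> real d" by simp
    \<comment> \<open>The power is an integer power because for \<open>n = 1\<close> the exponent is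
      -1 and the bound reads 1/2.\<close>
    then show "real d \<ge> 2 powi (int ?k - 1)" by (simp add: power_int_diff)
  qed (simp add: m)
qed simp_all

end
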